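(* There exists an absolute constant $c>0$ such that for all real $x\geq 3$ $$M(x)\geq c\,\frac{\ln x}{(\ln\ln x)^2},$$ where $M(x)$ denotes the length of the largest subinterval of $[1,x]$ which contains no element of the set $\mathcal V$ of sums of two squareful numbers.
   Context: A non-negative integer $n$ is called squareful (or powerful) if either $n=0$ or in its prime factorization $n=p_1^{\alpha_1}\cdots p_s^{\alpha_s}$ one has $\alpha_i\geq 2$ for all $i$ (so $n=1$ is squareful); equivalently, $n=a^2b^3$ for some non-negative integers $a,b$. The set $\mathcal V$ consists of all integers of the form $m+n$ with $m$ and $n$ squareful. For real $x\ge 3$, $M(x)$ is the length of the largest subinterval of $[1,x]$ without elements of $\mathcal V$, i.e. the supremum of the lengths of intervals $I\subset[1,x]$ with $I\cap\mathcal V=\emptyset$. *)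

theory Defs
  imports "HOL-Analysis.Analysis" "HOL-Computational_Algebra.Primes"
begin

definition squareful :: "nat \<Rightarrow> bool" where
  "squareful n \<longleftrightarrow> n = 0 \<or> (\<forall>p \<in> prime_factors n. 2 \<le> multiplicity p n)"

definition squareful_sums :: "nat set" where
  "squareful_sums = {m + n |m n. squareful m \<and> squareful n}"

definition gap_intervals :: "real \<Rightarrow> real set set" where
  "gap_intervals x = {I. is_interval I \<and> I \<subseteq> {1..x} \<and> I \<inter> real ` squareful_sums = {}}"

text \<open>Intervals may be open, half-open or closed, and may be degenerate; the length of an
  interval is its Lebesgue measure.\<close>

definition max_gap :: "real \<Rightarrow> real" where
  "max_gap x = (SUP I \<in> gap_intervals x. measure lborel I)"

text \<open>The supremum is over a nonempty set of reals that is bounded above, so it is the true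
  supremum and not an unspecified value.\<close>

lemma gap_intervals_nonempty: "gap_intervals x \<noteq> {}"
proof -
  have "{} \<in> gap_intervals x"
    by (simp add: gap_intervals_def)
  then show ?thesis by blast
qed

lemma bdd_above_gap_lengths: "bdd_above (measure lborel ` gap_intervals x)"
proof (rule bdd_aboveI2)
  fix I assume "I \<in> gap_intervals x"
  then have I: "is_interval I" "I \<subseteq> {1..x}"
    by (auto simp: gap_intervals_def)
  have "I \<in> sets lborel"
    using I(1) by (simp add: real_interval_borel_measurable)
  then show "measure lborel I \<le> measure lborel {1..x}"
    using I(2) by (intro measure_mono_fmeasurable) (auto simp: fmeasurable_def emeasure_lborel_Icc_eq)
qed

end

theory Submission
  imports Defs "HOL-Number_Theory.Number_Theory"
begin

text \<open>
  A squareful number is \<open>a\<^sup>2 b\<^sup>3\<close>, and a prime \<open>p\<close> that divides \<open>N\<close> exactly once prevents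
  \<open>N = a\<^sup>2 b\<^sup>3 + c\<^sup>2 d\<^sup>3\<close> as soon as \<open>-bd\<close> is a quadratic non-residue modulo \<open>p\<close>. To each of
  \<open>L\<close> consecutive integers \<open>n + j\<close> we attach a set \<open>S\<^sub>j\<close> of \<open>O(log L)\<close> primes of size
  \<open>L\<^sup>O\<^sup>(\<^sup>1\<^sup>)\<close> such that every pair \<open>(b, d)\<close> with \<open>b, d \<le> B\<close>, where \<open>B\<close> is a power of \<open>L\<close>, is
  excluded by some \<open>p \<in> S\<^sub>j\<close>, and prescribe \<open>p | n + j\<close> by the Chinese remainder theorem. The modulus
  \<open>P\<close> satisfies \<open>log P = O(L (log L)\<^sup>2)\<close>, whence the bound. The remaining pairs are handled by
  counting: on average over \<open>n\<close> in the residue class, representations with \<open>max b d > B\<close> hit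
  fewer than one of the \<open>L\<close> integers. Since \<open>p | n + j\<close> doubles the density of the forms for
  which \<open>-bd\<close> is a residue modulo \<open>p\<close>, the sets \<open>S\<^sub>j\<close> are chosen greedily so that the weighted
  number of surviving pairs, each weighted by the product of these doublings, hardly grows.

  The greedy choice needs the character \<open>\<psi> = (-e/\<cdot>)\<close> to have average at most \<open>\<epsilon>\<close> over primes up to a
  fixed power of \<open>e\<close>. This one-sided bound is insensitive to Siegel zeros (which bias \<open>\<psi>\<close>
  towards \<open>-1\<close>), and it has an elementary proof: with \<open>r = 1 * \<psi> \<ge> 0\<close> one has
  \<open>r log = ((1 + \<psi>) \<Lambda>) * r\<close>, the smoothed sums of \<open>r\<close> up to \<open>y\<close> are asymptotic to a multiple of
  \<open>y\<close> once \<open>y\<close> exceeds a power of \<open>e\<close>, and therefore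
  \<open>\<Sum> (1 + \<psi>(p)) log p / p \<le> (1 + \<epsilon>) log X\<close>.
\<close>

section \<open>The quadratic character of \<open>-e\<close>\<close>

text \<open>All sizes are powers of \<open>2^s\<close>, with \<open>L = 2^(4*s)\<close>. Pairs (b,d)
  beyond \<open>B = 2^(36*s)\<close> have total density of order \<open>B^(-1/4) = 2^(-9*s)\<close>.
  The \<open>80*s\<close> greedy steps may multiply this by
  \<open>(33/32)^(80*s) \<le> 2^(4*s)\<close>, and the union over the \<open>L\<close> positions
  costs another \<open>2^(4*s)\<close>. What remains is a constant times \<open>2^(-s)\<close>,
  small enough from \<open>s = 13\<close> on. The greedy choice can average only over boundedly many
  \<open>e = b*d\<close>, since the primes must reach a fixed power of \<open>e\<close>. Hence the
  cutoff \<open>T = 2^(340*s)\<close>: beyond it the worst factor \<open>2^(80*s)\<close> is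
  accepted and beaten by \<open>T^(-1/4) = 2^(-85*s)\<close>. Beyond \<open>P^4\<close> the boxes
  for a or c may be shorter than the modulus \<open>P\<close>, and the congruences are ignored. The
  primes exceed \<open>L\<close>, so each divides only one of the integers n + j. They are even
  taken beyond \<open>2^(16*s)\<close>, so that in n = n0 + P*u the values u for which some
  prescribed prime divides its n + j twice form a small proportion.\<close>

lemma Legendre_range: "Legendre a p \<in> {-1, 0, 1}"
  by (simp add: Legendre_def)

lemma Legendre_mod: "Legendre (a mod p) p = Legendre a p"
  by (simp add: Legendre_def QuadRes_def cong_def)

text \<open>Turns Euler's criterion, which is a congruence, into equalities between symbols with
  values -1, 0, 1.\<close>

lemma small_cong_imp_eq:
  fixes x y :: int
  assumes "[x = y] (mod int p)" "2 < p" "\<bar>x\<bar> \<le> 1" "\<bar>y\<bar> \<le> 1"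
  shows "x = y"
proof -
  have "int p dvd x - y" using assms(1) by (simp add: cong_iff_dvd_diff)
  moreover have "\<bar>x - y\<bar> < int p" using assms by linarith
  ultimately show ?thesis using zdvd_imp_le[of "int p" "\<bar>x - y\<bar>"] by (cases "x = y") auto
qed

lemma Legendre_mult:
  assumes "prime p" "2 < p"
  shows "Legendre (a * b) (int p) = Legendre a (int p) * Legendre b (int p)"
proof (rule small_cong_imp_eq)
  show "[Legendre (a * b) (int p) = Legendre a (int p) * Legendre b (int p)] (mod int p)"
    using euler_criterion[OF assms, of "a * b"]
      cong_mult[OF euler_criterion[OF assms, of a] euler_criterion[OF assms, of b]]
    by (metis cong_sym cong_trans power_mult_distrib)
  show "\<bar>Legendre (a * b) (int p)\<bar> \<le> 1" using Legendre_range[of "a * b" "int p"] by auto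
  show "\<bar>Legendre a (int p) * Legendre b (int p)\<bar> \<le> 1"
    using Legendre_range[of a "int p"] Legendre_range[of b "int p"] by auto
qed (fact assms)

definition chi4 :: "int \<Rightarrow> int" where
  "chi4 n = (if n mod 4 = 1 then 1 else if n mod 4 = 3 then - 1 else 0)"

text \<open>The symbol (q/n) rewritten as a function of n modulo \<open>8 * q\<close>: the second
  supplementary law for q = 2, otherwise (n/q) with the sign of quadratic reciprocity, which is
  present only if q is 3 modulo 4.\<close>

definition recip_symbol :: "nat \<Rightarrow> int \<Rightarrow> int" where
  "recip_symbol q n =
     (if q = 2 then (if n mod 8 \<in> {1, 7} then 1 else if n mod 8 \<in> {3, 5} then - 1 else 0)
      else Legendre n (int q) * (if q mod 4 = 3 then chi4 n else 1))"

text \<open>For an odd prime \<open>p\<close> not dividing \<open>e\<close> this is the Legendre symbol of \<open>-e\<close> modulo \<open>p\<close>, by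
  quadratic reciprocity; in this form it is visibly a periodic function of \<open>p\<close>.\<close>

definition neg_char :: "nat \<Rightarrow> int \<Rightarrow> int" where
  "neg_char e n = chi4 n * (\<Prod>q\<in>#prime_factorization e. recip_symbol q n)"

lemma Legendre_minus_one:
  assumes "prime p" "2 < p"
  shows "Legendre (- 1) (int p) = (- 1) ^ ((p - 1) div 2)"
  by (rule small_cong_imp_eq[OF euler_criterion[OF assms] assms(2)])
     (use Legendre_range[of "-1" "int p"] in auto)

lemma minus_one_power_half:
  assumes "odd p"
  shows "(- 1 :: int) ^ ((p - 1) div 2) = (if p mod 4 = 3 then - 1 else 1)"
proof -
  have "p mod 4 = 1 \<or> p mod 4 = 3" using assms by presburger
  moreover have "even ((p - 1) div 2)" if "p mod 4 = 1" using that by presburger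
  moreover have "odd ((p - 1) div 2)" if "p mod 4 = 3" using that by presburger
  ultimately show ?thesis by auto
qed

lemma chi4_of_nat: "odd p \<Longrightarrow> chi4 (int p) = (if p mod 4 = 3 then - 1 else 1)"
proof -
  assume "odd p"
  then have "p mod 4 = 1 \<or> p mod 4 = 3" by presburger
  moreover have "int p mod 4 = int (p mod 4)" by (simp add: zmod_int)
  ultimately show ?thesis by (auto simp: chi4_def)
qed

lemma chi4_mod: "chi4 (n mod 4) = chi4 n"
  by (simp add: chi4_def)

lemma chi4_mult: "chi4 (a * b) = chi4 a * chi4 b"
proof -
  have "\<forall>x\<in>set [0..3]. \<forall>y\<in>set [0..3]. chi4 (x * y) = chi4 x * chi4 y"
    by code_simp
  moreover have "a mod 4 \<in> set [0..3]" "b mod 4 \<in> set [0..3]" by simp_all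
  ultimately have "chi4 ((a mod 4) * (b mod 4)) = chi4 (a mod 4) * chi4 (b mod 4)" by blast
  then show ?thesis by (metis chi4_mod mod_mult_eq)
qed

lemma chi4_range: "chi4 n \<in> {-1, 0, 1}"
  by (simp add: chi4_def)

lemma chi4_minus: "chi4 (- n) = - chi4 n"
proof -
  have "\<forall>x\<in>set [0..3]. chi4 (- x) = - chi4 x" by code_simp
  moreover have "n mod 4 \<in> set [0..3]" by simp
  ultimately have "chi4 (- (n mod 4)) = - chi4 (n mod 4)" by blast
  then show ?thesis by (metis chi4_mod mod_minus_eq)
qed

lemma recip_symbol_mult:
  assumes "prime q"
  shows "recip_symbol q (a * b) = recip_symbol q a * recip_symbol q b"
proof (cases "q = 2")
  case True
  define f :: "int \<Rightarrow> int" where "f x = (if x \<in> {1, 7} then 1 else if x \<in> {3, 5} then - 1 else 0)" for x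
  have "\<forall>x\<in>set [0..7]. \<forall>y\<in>set [0..7]. f (x * y mod 8) = f x * f y"
    unfolding f_def by code_simp
  moreover have "a mod 8 \<in> set [0..7]" "b mod 8 \<in> set [0..7]" by simp_all
  ultimately have "f ((a mod 8) * (b mod 8) mod 8) = f (a mod 8) * f (b mod 8)" by blast
  then have "f ((a * b) mod 8) = f (a mod 8) * f (b mod 8)" by (simp only: mod_mult_eq)
  then show ?thesis unfolding recip_symbol_def f_def using True by simp
next
  case False
  then have "2 < q" using prime_ge_2_nat[OF assms] by simp
  then show ?thesis using False Legendre_mult[OF assms] by (simp add: recip_symbol_def chi4_mult)
qed

lemma recip_symbol_range: "recip_symbol q n \<in> {-1, 0, 1}"
proof (cases "q = 2")
  case False
  have "x * y \<in> {-1, 0, 1}" if "x \<in> {-1, 0, 1}" "y \<in> {-1, 0, 1}" for x y :: int using that by auto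
  from this[OF Legendre_range[of n "int q"] chi4_range[of n]] show ?thesis
    using False Legendre_range[of n "int q"] by (simp add: recip_symbol_def)
qed (simp add: recip_symbol_def)

text \<open>For q congruent to 3 modulo 4 the sign of (-1/q) cancels against that of
  \<open>chi4\<close>; for q congruent to 1 neither sign occurs; for q = 2 the classes {1,7} and
  {3,5} are symmetric.\<close>

lemma recip_symbol_uminus:
  assumes "prime q"
  shows "recip_symbol q (- n) = recip_symbol q n"
proof (cases "q = 2")
  case True
  define f :: "int \<Rightarrow> int" where "f x = (if x \<in> {1, 7} then 1 else if x \<in> {3, 5} then - 1 else 0)" for x
  have "\<forall>x\<in>set [0..7]. f ((- x) mod 8) = f x"
    unfolding f_def by code_simp
  moreover have "n mod 8 \<in> set [0..7]" by simp
  ultimately have "f ((- (n mod 8)) mod 8) = f (n mod 8)" by blast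
  then have "f ((- n) mod 8) = f (n mod 8)" by (simp only: mod_minus_eq)
  then show ?thesis unfolding recip_symbol_def f_def using True by simp
next
  case False
  then have q: "2 < q" "odd q" using prime_ge_2_nat[OF assms] prime_odd_nat[OF assms] by auto
  have "Legendre (- n) (int q) = Legendre (- 1) (int q) * Legendre n (int q)"
    using Legendre_mult[OF assms q(1), of "-1" n] by simp
  then show ?thesis using False q Legendre_minus_one[OF assms q(1)] minus_one_power_half[OF q(2)]
    by (simp add: recip_symbol_def chi4_minus)
qed

lemma recip_symbol_cong:
  assumes "[a = b] (mod 8 * int q)"
  shows "recip_symbol q a = recip_symbol q b"
proof -
  have 8: "[a = b] (mod 8)" using assms by (rule cong_modulus_mult)
  have 4: "a mod 4 = b mod 4" using cong_modulus_mult[of a b 4 2] 8 by (simp add: cong_def)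
  have q: "[a = b] (mod int q)" using assms cong_modulus_mult[of a b "int q" 8] by (simp add: mult.commute)
  have "Legendre a (int q) = Legendre b (int q)" using q Legendre_mod by (metis cong_def)
  then show ?thesis using 8 4 by (simp add: recip_symbol_def chi4_def cong_def)
qed

text \<open>Gauss's lemma with multiplier 2: for 0 < x \<le> h = (p-1)/2 the residues 2x stay below
  p, and those above h come from x > h/2. The exponent is therefore \<open>h - h div 2\<close>,
  whose parity depends on p modulo 8.\<close>

lemma Legendre_two:
  assumes "prime p" "2 < p"
  shows "Legendre 2 (int p) = recip_symbol 2 (int p)"
proof -
  interpret GAUSS p 2
    using assms by unfold_locales (auto simp: cong_0_iff dest: zdvd_imp_le)
  define h where "h = (int p - 1) div 2"
  have p: "int p = 2 * h + 1" using p_eq2 by (simp add: h_def)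
  have A': "A = {0<..h}" by (simp add: A_def h_def)
  have C': "C = (\<lambda>x. 2 * x) ` {0<..h}"
  proof -
    have "C = (\<lambda>x. (x * 2) mod int p) ` {0<..h}" by (simp add: C_def B_def A' image_image)
    also have "\<dots> = (\<lambda>x. 2 * x) ` {0<..h}" 
      by (intro image_cong refl) (auto simp: p)
    finally show ?thesis .
  qed
  have "E = (\<lambda>x. 2 * x) ` {h div 2<..h}" 
    unfolding E_def C' h_def[symmetric] using p assms by (auto simp: image_iff)
  then have "card E = nat (h - h div 2)"
    by (simp add: card_image inj_on_def)
  then have L: "Legendre 2 (int p) = (-1) ^ nat (h - h div 2)" using gauss_lemma by simp
  have h0: "h \<ge> 0" using p assms by simp
  have even: "even (nat (h - h div 2)) = even (h - h div 2)"
    using h0 by (intro even_nat_iff) simp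
  have "even (h - h div 2) \<longleftrightarrow> (2 * h + 1) mod 8 \<in> {1, 7}"
    by (simp, presburger)
  moreover have "(2 * h + 1) mod 8 \<in> {1, 7} \<or> (2 * h + 1) mod 8 \<in> {3, 5}"
    by (simp, presburger)
  ultimately show ?thesis using L even unfolding recip_symbol_def p[symmetric] by auto
qed

lemma Legendre_eq_recip_symbol:
  assumes "prime p" "2 < p" "prime q" "p \<noteq> q"
  shows "Legendre (int q) (int p) = recip_symbol q (int p)"
proof (cases "q = 2")
  case True
  then show ?thesis using Legendre_two[OF assms(1,2)] by simp
next
  case False
  then have q: "2 < q" "odd q" using prime_ge_2_nat[OF assms(3)] prime_odd_nat[OF assms(3)] by auto
  have p: "odd p" using assms(1,2) prime_odd_nat by blast
  have "Legendre (int p) (int q) * Legendre (int q) (int p)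
      = ((- 1) ^ ((p - 1) div 2)) ^ ((q - 1) div 2)"
    using Quadratic_Reciprocity[OF assms(1,2,3) q(1) assms(4)] by (simp add: power_mult)
  also have "\<dots> = (if q mod 4 = 3 then chi4 (int p) else 1)"
    using minus_one_power_half[OF q(2)] chi4_of_nat[OF p] minus_one_power_half[OF p] by (auto simp: chi4_def)
  finally have *: "Legendre (int p) (int q) * Legendre (int q) (int p) = \<dots>" .
  have "\<not> int q dvd int p" "\<not> int p dvd int q" using assms primes_dvd_imp_eq by auto
  then have "Legendre (int p) (int q) \<in> {-1, 1}" "Legendre (int q) (int p) \<in> {-1, 1}"
    by (auto simp: Legendre_def cong_0_iff)
  moreover have "chi4 (int p) * chi4 (int p) = 1" using chi4_of_nat[OF p] by simp
  ultimately show ?thesis using * False by (auto simp: recip_symbol_def split: if_splits)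
qed

lemma neg_char_mult: "neg_char e (a * b) = neg_char e a * neg_char e b"
proof -
  have "(\<Prod>q\<in>#prime_factorization e. recip_symbol q (a * b))
      = (\<Prod>q\<in>#prime_factorization e. recip_symbol q a * recip_symbol q b)"
    by (intro arg_cong[of _ _ prod_mset] image_mset_cong recip_symbol_mult) auto
  then show ?thesis by (simp add: neg_char_def chi4_mult prod_mset.distrib)
qed

lemma prod_mset_range:
  assumes "\<And>q. f q \<in> {-1, 0, 1 :: int}"
  shows "(\<Prod>q\<in>#M. f q) \<in> {-1, 0, 1}"
proof (induction M)
  case (add x M) then show ?case using assms[of x] by auto
qed auto

lemma neg_char_range: "neg_char e n \<in> {-1, 0, 1}"
  using chi4_range[of n] prod_mset_range[of "\<lambda>q. recip_symbol q n" "prime_factorization e", OF recip_symbol_range]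
  unfolding neg_char_def by auto

lemma neg_char_one [simp]: "neg_char e 1 = 1"
proof -
  have "recip_symbol q 1 = 1" if "prime q" for q
  proof -
    have "\<not> int q dvd 1" "QuadRes (int q) 1" 
      using that unfolding QuadRes_def by (auto intro!: exI[of _ 1] simp: prime_int_iff)
    then have "Legendre 1 (int q) = 1" by (simp add: Legendre_def cong_0_iff)
    then show ?thesis by (simp add: recip_symbol_def chi4_def)
  qed
  then have "image_mset (\<lambda>q. recip_symbol q 1) (prime_factorization e)
      = image_mset (\<lambda>q. 1) (prime_factorization e)"
    by (intro image_mset_cong) auto
  then show ?thesis by (simp add: neg_char_def chi4_def prod_mset.neutral)
qed

lemma neg_char_cong:
  assumes "[a = b] (mod 8 * int e)"
  shows "neg_char e a = neg_char e b"
proof -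
  have "a mod 4 = b mod 4"
    using assms cong_modulus_mult[of a b 4 "2 * int e"] by (simp add: cong_def)
  moreover have "recip_symbol q a = recip_symbol q b" if "q \<in># prime_factorization e" for q
  proof (rule recip_symbol_cong)
    have "int q dvd int e" using that by auto
    then have "8 * int q dvd 8 * int e" by simp
    then show "[a = b] (mod 8 * int q)" using assms cong_dvd_modulus by blast
  qed
  then have "image_mset (\<lambda>q. recip_symbol q a) (prime_factorization e)
      = image_mset (\<lambda>q. recip_symbol q b) (prime_factorization e)"
    by (intro image_mset_cong) auto
  ultimately show ?thesis by (simp add: neg_char_def chi4_def)
qed

text \<open>The factor \<open>chi4\<close> is odd and all others are even. Oddness reflects that -e
  is negative, and it makes the sum over a period vanish for every e at once, with no discussion of
  principal characters.\<close>

lemma neg_char_uminus: "neg_char e (- n) = - neg_char e n"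
proof -
  have "image_mset (\<lambda>q. recip_symbol q (- n)) (prime_factorization e)
      = image_mset (\<lambda>q. recip_symbol q n) (prime_factorization e)"
    by (intro image_mset_cong recip_symbol_uminus) auto
  then show ?thesis by (simp add: neg_char_def chi4_minus)
qed

lemma neg_char_prime:
  assumes "prime p" "2 < p" "\<not> p dvd e" "e > 0"
  shows "neg_char e (int p) = Legendre (- int e) (int p)"
proof -
  have p: "odd p" using assms(1,2) prime_odd_nat by blast
  have "(\<Prod>q\<in>#prime_factorization e. recip_symbol q (int p))
      = (\<Prod>q\<in>#prime_factorization e. Legendre (int q) (int p))"
  proof (intro arg_cong[of _ _ prod_mset] image_mset_cong)
    fix q assume q: "q \<in># prime_factorization e"
    then have "prime q" "p \<noteq> q" using assms(3) by auto
    then show "recip_symbol q (int p) = Legendre (int q) (int p)"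
      using Legendre_eq_recip_symbol[OF assms(1,2)] by simp
  qed
  also have "(\<Prod>q\<in>#M. Legendre (int q) (int p)) = Legendre (\<Prod>q\<in>#M. int q) (int p)"
    for M :: "nat multiset"
  proof (induction M)
    case empty
    have "\<not> int p dvd 1" "QuadRes (int p) 1" 
      using assms(1) unfolding QuadRes_def by (auto intro!: exI[of _ 1] simp: prime_int_iff)
    then show ?case by (simp add: Legendre_def cong_0_iff)
  next
    case (add x M)
    then show ?case by (simp add: Legendre_mult[OF assms(1,2)])
  qed
  also have "(\<Prod>q\<in>#prime_factorization e. int q) = int e"
  proof -
    have "(\<Prod>q\<in>#M. int q) = int (prod_mset M)" for M by (induction M) auto
    then show ?thesis using prod_mset_prime_factorization_nat[of e] assms(4) by simp
  qed
  finally show ?thesis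
    using Legendre_mult[OF assms(1,2), of "-1" "int e"] Legendre_minus_one[OF assms(1,2)]
      minus_one_power_half[OF p] chi4_of_nat[OF p] by (simp add: neg_char_def)
qed

section \<open>A one-sided bound for real characters on primes\<close>

text \<open>Substitute n = d * l. Since \<open>F\<close> vanishes for d * l > N, the sum over the
  region below the hyperbola may be written over the whole square.\<close>

lemma sum_divisor_swap:
  fixes F :: "nat \<Rightarrow> nat \<Rightarrow> real"
  assumes "\<And>d l. d * l > N \<Longrightarrow> F d l = 0"
  shows "(\<Sum>n\<in>{1..N}. \<Sum>d | d dvd n. F d (n div d)) = (\<Sum>d\<in>{1..N}. \<Sum>l\<in>{1..N}. F d l)"
proof -
  have "(\<Sum>n\<in>{1..N}. \<Sum>d | d dvd n. F d (n div d))
      = (\<Sum>(n,d)\<in>(SIGMA n:{1..N}. {d. d dvd n}). F d (n div d))"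
    by (rule sum.Sigma) auto
  also have "\<dots> = (\<Sum>(d,l)\<in>{(d,l). d \<in> {1..N} \<and> l \<in> {1..N} \<and> d * l \<le> N}. F d l)"
  proof (rule sum.reindex_bij_witness[of _ "\<lambda>(d,l). (d * l, d)" "\<lambda>(n,d). (d, n div d)"])
    fix a assume a: "a \<in> (SIGMA n:{1..N}. {d. d dvd n})"
    obtain n d where nd: "a = (n, d)" "n \<in> {1..N}" "d dvd n" using a by auto
    then obtain l where l: "n = d * l" by auto
    then have "d > 0" "l > 0" "d * l \<le> N" using nd by (auto intro: Nat.gr0I)
    moreover have "d * 1 \<le> d * l" "1 * l \<le> d * l" using calculation by (intro mult_mono; simp)+
    then have "d \<le> N" "l \<le> N" using \<open>d * l \<le> N\<close> by linarith+
    ultimately show "(case a of (n, d) \<Rightarrow> (d, n div d)) \<in> {(d,l). d \<in> {1..N} \<and> l \<in> {1..N} \<and> d * l \<le> N}"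
      using nd l by auto
    show "(case case a of (n, d) \<Rightarrow> (d, n div d) of (d, l) \<Rightarrow> (d * l, d)) = a"
      using nd by auto
    show "(case case a of (n, d) \<Rightarrow> (d, n div d) of (d, l) \<Rightarrow> F d l) = (case a of (n, d) \<Rightarrow> F d (n div d))"
      using nd by auto
  next
    fix b assume "b \<in> {(d,l). d \<in> {1..N} \<and> l \<in> {1..N} \<and> d * l \<le> N}"
    then obtain d l where "b = (d,l)" "d \<ge> 1" "l \<ge> 1" "d * l \<le> N" by auto
    then show "(case case b of (d, l) \<Rightarrow> (d * l, d) of (n, d) \<Rightarrow> (d, n div d)) = b"
      "(case b of (d, l) \<Rightarrow> (d * l, d)) \<in> (SIGMA n:{1..N}. {d. d dvd n})" by auto
  qed
  also have "\<dots> = (\<Sum>(d,l)\<in>{1..N} \<times> {1..N}. F d l)"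
    using assms by (intro sum.mono_neutral_left) (auto simp flip: not_less)
  also have "\<dots> = (\<Sum>d\<in>{1..N}. \<Sum>l\<in>{1..N}. F d l)"
    by (simp add: sum.cartesian_product)
  finally show ?thesis .
qed

lemma divisor_sum_coprime:
  fixes f :: "nat \<Rightarrow> real"
  assumes "coprime a b" "a > 0" "b > 0" "\<And>x y. f (x * y) = f x * f y"
  shows "(\<Sum>d | d dvd a * b. f d) = (\<Sum>d | d dvd a. f d) * (\<Sum>d | d dvd b. f d)"
proof -
  have "(\<Sum>d | d dvd a. f d) * (\<Sum>d | d dvd b. f d)
      = (\<Sum>(x,y)\<in>{d. d dvd a} \<times> {d. d dvd b}. f x * f y)"
    by (simp add: sum_product sum.cartesian_product)
  also have "\<dots> = (\<Sum>d | d dvd a * b. f d)"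
  proof (rule sum.reindex_bij_betw[of "\<lambda>(x,y). x * y" _ _ f, unfolded case_prod_beta, THEN trans[rotated]])
    show "bij_betw (\<lambda>p. fst p * snd p) ({d. d dvd a} \<times> {d. d dvd b}) {d. d dvd a * b}"
      unfolding bij_betw_def
    proof
      show "inj_on (\<lambda>p. fst p * snd p) ({d. d dvd a} \<times> {d. d dvd b})"
      proof (rule inj_onI)
        fix p q assume pq: "p \<in> {d. d dvd a} \<times> {d. d dvd b}" "q \<in> {d. d dvd a} \<times> {d. d dvd b}"
          "fst p * snd p = fst q * snd q"
        have g: "gcd (fst r * snd r) a = fst r \<and> gcd (fst r * snd r) b = snd r"
          if "r \<in> {d. d dvd a} \<times> {d. d dvd b}" for r
        proof -
          have d: "fst r dvd a" "snd r dvd b" using that by auto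
          have "coprime a (snd r)" "coprime b (fst r)"
            using assms(1) d by (meson coprime_commute coprime_divisors dvd_refl)+
          then have "gcd (fst r * snd r) a = gcd (fst r) a" "gcd (fst r * snd r) b = gcd (snd r) b"
            by (simp_all add: gcd_mult_left_right_cancel gcd_mult_left_left_cancel)
          then show ?thesis using d by (simp add: gcd_proj1_iff)
        qed
        show "p = q" using g[OF pq(1)] g[OF pq(2)] pq(3) by (metis prod_eqI)
      qed
      show "(\<lambda>p. fst p * snd p) ` ({d. d dvd a} \<times> {d. d dvd b}) = {d. d dvd a * b}"
      proof (intro equalityI subsetI)
        fix x assume "x \<in> {d. d dvd a * b}"
        then obtain c d where "x = c * d" "c dvd a" "d dvd b" using division_decomp[of x a b] by auto
        then show "x \<in> (\<lambda>p. fst p * snd p) ` ({d. d dvd a} \<times> {d. d dvd b})"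
          by (intro image_eqI[of _ _ "(c, d)"]) auto
      qed (auto intro: mult_dvd_mono)
    qed
  qed (simp add: assms(4) case_prod_beta)
  finally show ?thesis by simp
qed

text \<open>With t the fractional part of Y, the difference is exactly t(1-t)/(2Y). The continuity
  of the weight thus improves the error O(1) of a sharp cutoff to O(1/Y).\<close>

lemma hat_sum:
  fixes Y :: real
  assumes "Y > 0" "Y \<le> N"
  defines "G \<equiv> (\<Sum>l\<in>{1..N}. max 0 (1 - real l / Y))"
  shows "Y \<ge> 1 \<Longrightarrow> \<bar>G - (Y / 2 - 1 / 2)\<bar> \<le> 1 / (2 * Y)" and "G \<le> Y / 2"
proof -
  define M where "M = nat \<lfloor>Y\<rfloor>"
  define t where "t = Y - real M"
  have M: "real M \<le> Y" "Y < real M + 1" using assms by (auto simp: M_def)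
  then have t: "0 \<le> t" "t < 1" by (auto simp: t_def)
  have "M \<le> N" using M assms by linarith
  have "G = (\<Sum>l\<in>{1..M}. max 0 (1 - real l / Y))" unfolding G_def
  proof (rule sum.mono_neutral_right)
    show "\<forall>i\<in>{1..N} - {1..M}. max 0 (1 - real i / Y) = 0"
      using M assms(1) by (auto simp: max_def field_simps)
  qed (use \<open>M \<le> N\<close> in auto)
  also have "\<dots> = (\<Sum>l\<in>{1..M}. 1 - real l / Y)"
    using M assms(1) by (intro sum.cong refl) (auto simp: max_def field_simps)
  also have "\<dots> = real M - (\<Sum>l\<in>{1..M}. real l) / Y"
    by (simp add: sum_subtractf sum_divide_distrib)
  also have "(\<Sum>l\<in>{1..M}. real l) = real M * (real M + 1) / 2"
    by (induction M) (auto simp: field_simps)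
  finally have "G = real M - real M * (real M + 1) / 2 / Y" .
  then have eq: "G - (Y / 2 - 1 / 2) = t * (1 - t) / (2 * Y)"
    using assms(1) by (simp add: t_def field_simps) 
  have tt: "0 \<le> t * (1 - t)" "t * (1 - t) \<le> t" "t * (1 - t) \<le> 1"
    using t by (auto simp: mult_left_le mult_le_one)
  show "\<bar>G - (Y / 2 - 1 / 2)\<bar> \<le> 1 / (2 * Y)"
    unfolding eq using tt assms(1) by (simp add: divide_right_mono)
  show "G \<le> Y / 2"
  proof (cases "Y \<ge> 1")
    case True
    have "t * (1 - t) / (2 * Y) \<le> 1 / 2" using tt True by (simp add: field_simps)
    then show ?thesis using eq by linarith
  next
    case False
    then have "M = 0" by (simp add: M_def)
    then show ?thesis using \<open>G = real M - real M * (real M + 1) / 2 / Y\<close> assms by simp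
  qed
qed

text \<open>What is kept of a real nonprincipal character: complete multiplicativity and bounded
  sums over intervals. The bound \<open>m\<close> plays the part of the modulus.\<close>

locale real_char =
  fixes \<psi> :: "nat \<Rightarrow> real" and m :: nat
  assumes mult: "\<psi> (a * b) = \<psi> a * \<psi> b"
    and one: "\<psi> 1 = 1"
    and range: "\<psi> n \<in> {-1, 0, 1}"
    and sums: "\<bar>\<Sum>n\<in>{a..<b}. \<psi> n\<bar> \<le> real m"
    and m_pos: "m \<ge> 1"
begin

lemma char_power: "\<psi> (a ^ k) = \<psi> a ^ k"
  by (induction k) (use one in \<open>auto simp: mult\<close>)

lemma one_plus_nonneg: "0 \<le> 1 + \<psi> n"
  using range[of n] by auto

text \<open>Partial summation: the differences of \<open>h\<close> are nonnegative and
  telescope.\<close>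

lemma abel_bound:
  assumes "\<And>i j. a \<le> i \<Longrightarrow> i \<le> j \<Longrightarrow> h j \<le> h i" "\<And>i. a \<le> i \<Longrightarrow> 0 \<le> (h i :: real)"
  shows "\<bar>\<Sum>d\<in>{a..<b}. \<psi> d * h d\<bar> \<le> real m * h a"
proof (cases "a \<le> b")
  case True
  let ?S = "\<lambda>b. \<Sum>n\<in>{a..<b}. \<psi> n"
  have "(\<Sum>d\<in>{a..<b}. \<psi> d * h d) = ?S b * h b + (\<Sum>d\<in>{a..<b}. ?S (Suc d) * (h d - h (Suc d)))"
    using True by (induction b rule: dec_induct) (auto simp: algebra_simps)
  also have "\<bar>\<dots>\<bar> \<le> \<bar>?S b * h b\<bar> + \<bar>\<Sum>d\<in>{a..<b}. ?S (Suc d) * (h d - h (Suc d))\<bar>" by simp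
  also have "\<dots> \<le> m * h b + (\<Sum>d\<in>{a..<b}. m * (h d - h (Suc d)))"
  proof (intro add_mono)
    show "\<bar>?S b * h b\<bar> \<le> m * h b"
      using sums[of a b] assms(2)[OF True] by (simp add: abs_mult mult_right_mono)
    show "\<bar>\<Sum>d\<in>{a..<b}. ?S (Suc d) * (h d - h (Suc d))\<bar> \<le> (\<Sum>d\<in>{a..<b}. m * (h d - h (Suc d)))"
    proof (rule order_trans[OF sum_abs sum_mono])
      fix d assume "d \<in> {a..<b}"
      then have "0 \<le> h d - h (Suc d)" using assms(1)[of d "Suc d"] by simp
      then show "\<bar>?S (Suc d) * (h d - h (Suc d))\<bar> \<le> m * (h d - h (Suc d))"
        using sums[of a "Suc d"] by (simp only: abs_mult abs_of_nonneg mult_right_mono)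
    qed
  qed
  also have "(\<Sum>d\<in>{a..<b}. m * (h d - h (Suc d))) = m * (h a - h b)"
    using True by (induction b rule: dec_induct) (auto simp: algebra_simps)
  finally show ?thesis by (simp add: algebra_simps)
next
  case False
  then show ?thesis using assms(2)[of a] by simp
qed

section \<open>The convolution of 1 and \<psi>, its smoothed sums, and a lower bound for
  L(1,\<psi>)\<close>

text \<open>When \<psi> is the character of a quadratic field, this is the number of ideals of norm
  n.\<close>

definition r :: "nat \<Rightarrow> real" where
  "r n = (\<Sum>d | d dvd n. \<psi> d)"

lemma r_coprime_mult: "coprime a b \<Longrightarrow> a > 0 \<Longrightarrow> b > 0 \<Longrightarrow> r (a * b) = r a * r b"
  unfolding r_def by (rule divisor_sum_coprime) (auto simp: mult)

lemma r_prime_power: "prime p \<Longrightarrow> r (p ^ k) = (\<Sum>i\<le>k. \<psi> p ^ i)"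
proof -
  assume p: "prime p"
  then have "{d. d dvd p ^ k} = (\<lambda>i. p ^ i) ` {..k}"
    by (auto simp: divides_primepow_nat le_imp_power_dvd)
  then have "r (p ^ k) = (\<Sum>i\<in>{..k}. \<psi> (p ^ i))"
    unfolding r_def using p by (subst sum.reindex[symmetric, unfolded o_def]) 
       (auto simp: inj_on_def prime_power_inj)
  then show ?thesis by (simp add: char_power)
qed

text \<open>By multiplicativity it suffices to look at prime powers, where \<open>r (p ^ k)\<close>
  is 1 for \<psi>(p) = 0, k + 1 for \<psi>(p) = 1, and alternates between 1 and 0 for \<psi>(p) =
  -1. Even exponents always give at least 1. The induction peels off the full power of one
  prime.\<close>

lemma r_nonneg_aux: "n > 0 \<Longrightarrow> 0 \<le> r n \<and> 1 \<le> r (n ^ 2)"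
proof (induction n rule: less_induct)
  case (less n)
  show ?case
  proof (cases "n = 1")
    case True
    have "{d::nat. d dvd Suc 0} = {1}" by auto
    then show ?thesis using True one by (simp add: r_def)
  next
    case False
    then obtain p where p: "prime p" "p dvd n" using prime_factor_nat by blast
    obtain n' where n': "n = p ^ multiplicity p n * n'" "\<not> p dvd n'"
      using multiplicity_decompose'[of n p] p less.prems by (metis not_prime_unit not_gr_zero)
    define v where "v = multiplicity p n"
    have "v > 0" using p less.prems by (simp add: v_def prime_multiplicity_gt_zero_iff)
    have "n' > 0" using n' less.prems by (auto intro: Nat.gr0I)
    have "p ^ v > 1" using p(1) \<open>v > 0\<close> by (intro one_less_power prime_gt_1_nat)
    then have "1 * n' < p ^ v * n'" using \<open>n' > 0\<close> by (intro mult_strict_right_mono)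
    then have "n' < n" using n'(1) v_def by simp
    have IH: "0 \<le> r n'" "1 \<le> r (n' ^ 2)" using less.IH[OF \<open>n' < n\<close> \<open>n' > 0\<close>] by auto
    have cop: "coprime p n'" using p(1) n'(2) by (simp add: prime_imp_coprime)
    have c1: "r n = r (p ^ v) * r n'"
      using r_coprime_mult[of "p ^ v" n'] n'(1) cop \<open>n' > 0\<close> p(1) v_def by (simp add: prime_gt_0_nat)
    have "n ^ 2 = (p ^ v * n') ^ 2" using n'(1) v_def by metis
    also have "\<dots> = p ^ (2 * v) * n' ^ 2"
      by (simp add: power_mult_distrib power_mult[symmetric] mult.commute)
    finally have n2: "n ^ 2 = p ^ (2 * v) * n' ^ 2" .
    then have c2: "r (n ^ 2) = r (p ^ (2 * v)) * r (n' ^ 2)"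
      using r_coprime_mult[of "p ^ (2 * v)" "n' ^ 2"] cop \<open>n' > 0\<close> p(1) by (simp add: prime_gt_0_nat)
    have x: "\<psi> p \<in> {-1, 0, 1}" by (rule range)
    have m1: "(\<Sum>i\<le>k. (-1::real) ^ i) = (if even k then 1 else 0)" for k
      by (induction k) auto
    have z: "(\<Sum>i\<le>k. (0::real) ^ i) = 1" for k
      by (induction k) auto
    have "0 \<le> r (p ^ v)" "1 \<le> r (p ^ (2 * v))"
      unfolding r_prime_power[OF p(1)] using x by (auto simp: m1 z)
    then show ?thesis using c1 c2 IH
      by (simp add: mult_ge1_I)
  qed
qed

lemma r_nonneg: "n > 0 \<Longrightarrow> 0 \<le> r n" and r_square: "n > 0 \<Longrightarrow> 1 \<le> r (n ^ 2)"
  using r_nonneg_aux by auto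

text \<open>With the weight \<open>1 - n/y\<close> the error term is \<open>O(y\<^sup>1\<^sup>/\<^sup>3)\<close>. It is thus smaller than the contribution
  \<open>y\<^sup>1\<^sup>/\<^sup>2\<close> of the squares, which forces the main term to be large.\<close>

definition V :: "nat \<Rightarrow> real \<Rightarrow> real" where
  "V N y = (\<Sum>n\<in>{1..N}. r n * max 0 (1 - real n / y))"

lemma V_nonneg: "0 \<le> V N y"
  unfolding V_def by (intro sum_nonneg mult_nonneg_nonneg r_nonneg) auto

lemma V_swap:
  assumes "0 < y" "y \<le> N"
  shows "V N y = (\<Sum>d\<in>{1..N}. \<psi> d * (\<Sum>l\<in>{1..N}. max 0 (1 - real l / (y / d))))"
proof -
  have "V N y = (\<Sum>n\<in>{1..N}. \<Sum>d | d dvd n. \<psi> d * max 0 (1 - real (d * (n div d)) / y))"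
    unfolding V_def r_def sum_distrib_right by (intro sum.cong refl) auto
  also have "\<dots> = (\<Sum>d\<in>{1..N}. \<Sum>l\<in>{1..N}. \<psi> d * max 0 (1 - real (d * l) / y))"
  proof (rule sum_divisor_swap)
    fix d l assume "N < d * l"
    then have "y \<le> real (d * l)" using assms by linarith
    then show "\<psi> d * max 0 (1 - real (d * l) / y) = 0" using assms by (simp add: max_def field_simps)
  qed
  finally show ?thesis by (simp add: sum_distrib_left mult.commute)
qed

text \<open>L(1,\<psi>) truncated at the same N that bounds all other sums, so that no infinite
  series enters.\<close>

definition ell :: "nat \<Rightarrow> real" where
  "ell N = (\<Sum>d\<in>{1..N}. \<psi> d / d)"

text \<open>Split the sum over d at w^2, where y = w^3. Below, \<open>hat_sum\<close> gives the main
  term y/(2d) - 1/2 with error d/(2y), in total at most w^4/(2y) = w/2. Above, the inner sum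
  decreases in d and is at most w/2 at the cut, so \<open>abel_bound\<close> gives m * w/2. The
  choice y^(2/3) of the cut balances the two.\<close>

lemma V_approx:
  fixes w :: real
  assumes "w \<ge> 1" "w ^ 3 \<le> N"
  shows "\<bar>V N (w ^ 3) - w ^ 3 / 2 * ell N\<bar> \<le> 2 * m * w"
proof -
  define y where "y = w ^ 3"
  define D where "D = nat \<lfloor>w ^ 2\<rfloor>"
  define G where "G = (\<lambda>Y. \<Sum>l\<in>{1..N}. max 0 (1 - real l / Y))"
  have y1: "y \<ge> 1" "y \<le> N" using assms by (auto simp: y_def)
  have D: "real D \<le> w ^ 2" "w ^ 2 < real (Suc D)" using assms by (auto simp: D_def) linarith
  have wy: "w ^ 2 \<le> y" using assms by (simp add: y_def power_increasing)
  have DN: "D \<le> N" using D wy y1 by linarith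
  have split: "{1..N} = {1..D} \<union> {Suc D..<Suc N}" using DN by auto
  have disj: "{1..D} \<inter> {Suc D..<Suc N} = {}" by auto
  define A where "A = (\<Sum>d\<in>{Suc D..<Suc N}. \<psi> d * G (y / d))"
  define C where "C = (\<Sum>d\<in>{Suc D..<Suc N}. \<psi> d * (1 / real d))"
  define S1 where "S1 = (\<Sum>d\<in>{1..D}. \<psi> d * (G (y / d) - (y / d / 2 - 1 / 2)))"
  define S2 where "S2 = (\<Sum>d\<in>{1..D}. \<psi> d)"
  have A: "\<bar>A\<bar> \<le> m * (w / 2)"
  proof -
    have "\<bar>A\<bar> \<le> m * G (y / Suc D)" unfolding A_def
    proof (rule abel_bound)
      fix i j assume ij: "Suc D \<le> i" "i \<le> j"
      then have *: "y / real j \<le> y / real i" "0 < y / real j" using y1 by (auto intro!: divide_left_mono)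
      moreover from this have "0 < y / real i" by linarith
      ultimately have "real l / (y / real i) \<le> real l / (y / real j)" for l
        by (intro divide_left_mono[OF *(1)] mult_pos_pos of_nat_0_le_iff)
      then show "G (y / real j) \<le> G (y / real i)" unfolding G_def
        by (intro sum_mono max.mono diff_mono) auto
    next
      fix i show "0 \<le> G (y / real i)" unfolding G_def by (intro sum_nonneg) auto
    qed
    also have "m * G (y / Suc D) \<le> m * (w / 2)"
    proof (rule mult_left_mono)
    have "G (y / Suc D) \<le> (y / Suc D) / 2" unfolding G_def
      using y1 by (intro hat_sum(2)) (auto simp: field_simps intro: order_trans[OF y1(2)])
    also have "y / Suc D \<le> y / w ^ 2" using D assms y1 by (intro divide_left_mono) auto
    also have "y / w ^ 2 = w" using assms by (simp add: y_def power3_eq_cube power2_eq_square)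
    finally show "G (y / Suc D) \<le> w / 2" by simp
    qed simp
    finally show ?thesis .
  qed
  have C: "\<bar>C\<bar> \<le> m * (1 / w ^ 2)"
  proof -
    have "\<bar>C\<bar> \<le> m * (1 / real (Suc D))" unfolding C_def
      by (rule abel_bound) (auto intro!: divide_left_mono)
    also have "\<dots> \<le> m * (1 / w ^ 2)" using D assms by (intro mult_left_mono divide_left_mono) auto
    finally show ?thesis .
  qed
  have "V N y = (\<Sum>d\<in>{1..D}. \<psi> d * G (y / d)) + A"
    unfolding A_def G_def V_swap[OF less_le_trans[OF zero_less_one y1(1)] y1(2)]
    unfolding split by (rule sum.union_disjoint) auto
  moreover have "ell N = (\<Sum>d\<in>{1..D}. \<psi> d / d) + C"
    unfolding ell_def C_def unfolding split 
    by (subst sum.union_disjoint) auto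
  ultimately have "V N y - y / 2 * ell N
    = (\<Sum>d\<in>{1..D}. \<psi> d * (G (y / d) - (y / d / 2 - 1 / 2))) - (\<Sum>d\<in>{1..D}. \<psi> d) / 2 + A - y / 2 * C"
    by (simp add: algebra_simps sum_subtractf sum.distrib sum_distrib_left sum_divide_distrib)
  then have "V N y - y / 2 * ell N = S1 - S2 / 2 + A - y / 2 * C" by (simp only: S1_def S2_def)
  moreover have "\<bar>y / 2 * C\<bar> = y / 2 * \<bar>C\<bar>" using y1 by (simp add: abs_mult)
  ultimately have "\<bar>V N y - y / 2 * ell N\<bar> \<le> \<bar>S1\<bar> + \<bar>S2\<bar> / 2 + \<bar>A\<bar> + y / 2 * \<bar>C\<bar>"
    by linarith
  also have "\<bar>S1\<bar> + \<bar>S2\<bar> / 2 + \<bar>A\<bar> + y / 2 * \<bar>C\<bar> \<le> w / 2 + m / 2 + m * (w / 2) + m * (w / 2)"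
  proof (intro add_mono)
    show "\<bar>A\<bar> \<le> m * (w / 2)" by (rule A)
    have "y / 2 * \<bar>C\<bar> \<le> y / 2 * (m * (1 / w ^ 2))" using C y1 by (intro mult_left_mono) auto
    also have "\<dots> = m * (w / 2)" using assms by (simp add: y_def power3_eq_cube power2_eq_square)
    finally show "y / 2 * \<bar>C\<bar> \<le> m * (w / 2)" .
    show "\<bar>S2\<bar> / 2 \<le> real m / 2" unfolding S2_def using sums[of 1 "Suc D"]
      by (simp add: atLeastLessThanSuc_atLeastAtMost)
    have "\<bar>S1\<bar> \<le> (\<Sum>d\<in>{1..D}. D / (2 * y))"
      unfolding S1_def
    proof (rule order_trans[OF sum_abs sum_mono])
      fix d assume d: "d \<in> {1..D}"
      then have d1: "1 \<le> real d" "real d \<le> y" using D wy by auto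
      have "\<bar>G (y / d) - (y / d / 2 - 1 / 2)\<bar> \<le> 1 / (2 * (y / d))" unfolding G_def
        using d1 y1 by (intro hat_sum(1)) (auto simp: field_simps intro: order_trans[OF y1(2)])
      also have "\<dots> \<le> D / (2 * y)" using d y1 by (simp add: field_simps)
      finally show "\<bar>\<psi> d * (G (y / d) - (y / d / 2 - 1 / 2))\<bar> \<le> D / (2 * y)"
        using range[of d] by (auto simp: abs_mult)
    qed
    also have "\<dots> = real D * real D / (2 * y)" by simp
    also have "\<dots> \<le> w ^ 2 * w ^ 2 / (2 * y)" using y1 by (intro divide_right_mono mult_mono[OF D(1) D(1)]) simp_all
    also have "\<dots> = w / 2" using assms by (simp add: y_def power3_eq_cube power2_eq_square)
    finally show "\<bar>S1\<bar> \<le> w / 2" .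
  qed
  also have "\<dots> \<le> 2 * m * w"
  proof -
    have "w * 1 \<le> w * real m" "real m * 1 \<le> real m * w" using assms m_pos by (intro mult_left_mono; simp)+
    then show ?thesis by (simp add: field_simps)
  qed
  finally show ?thesis by (simp add: y_def)
qed

text \<open>Take y = w^3 = 8q^6. The squares up to K^2 = y/2 carry weight at least 1/2 each, which
  contributes q^3 to \<open>V\<close>. The error 2mw = 4mq^2 is exactly half of this for q = 8m, so
  the main term 4q^6 * \<open>ell N\<close> must supply the other half.\<close>

lemma ell_lower:
  assumes "8 * (8 * m) ^ 6 \<le> N"
  shows "ell N \<ge> 1 / (4096 * real m ^ 3)"
proof -
  define q where "q = 8 * m"
  have q: "q \<ge> 1" using m_pos by (simp add: q_def)
  define w where "w = 2 * real q ^ 2"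
  have "real q ^ 2 \<ge> 1" using q by simp
  then have w1: "w \<ge> 1" by (simp add: w_def)
  have w3: "w ^ 3 = real (8 * q ^ 6)" by (simp add: w_def power_mult_distrib flip: power_mult)
  have wN: "w ^ 3 \<le> N" unfolding w3 using assms by (simp only: q_def of_nat_le_iff)
  define K where "K = 2 * q ^ 3"
  have "real K * (1 / 2) = (\<Sum>n\<in>(\<lambda>k. k ^ 2) ` {1..K}. 1 / 2)"
    by (subst sum.reindex) (auto simp: inj_on_def)
  also have "\<dots> \<le> (\<Sum>n\<in>(\<lambda>k. k ^ 2) ` {1..K}. r n * max 0 (1 - real n / w ^ 3))"
  proof (rule sum_mono)
    fix n assume "n \<in> (\<lambda>k. k ^ 2) ` {1..K}"
    then obtain k where k: "n = k ^ 2" "1 \<le> k" "k \<le> K" by auto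
    have "real n \<le> real K ^ 2" using k by (simp add: power_mono)
    also have "\<dots> = w ^ 3 / 2" unfolding w3 by (simp add: K_def power_mult_distrib flip: power_mult)
    finally have "1 / 2 \<le> 1 - real n / w ^ 3" using w1 by (simp add: field_simps)
    then have *: "1 / 2 \<le> max 0 (1 - real n / w ^ 3)" by (rule max.coboundedI2)
    moreover have "1 \<le> r n" using r_square[of k] k by simp
    ultimately have "1 * (1 / 2) \<le> r n * max 0 (1 - real n / w ^ 3)" 
      by (intro mult_mono *) auto
    then show "1 / 2 \<le> r n * max 0 (1 - real n / w ^ 3)" by simp
  qed
  also have "\<dots> \<le> V N (w ^ 3)" unfolding V_def
  proof (rule sum_mono2)
    have "K ^ 2 \<le> N"
    proof -
      have "K ^ 2 \<le> 8 * q ^ 6" by (simp add: K_def power_mult_distrib flip: power_mult)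
      then show ?thesis using assms by (simp add: q_def)
    qed
    then have "k ^ 2 \<le> N" if "k \<le> K" for k using power_mono[OF that, of 2] by linarith
    then show "(\<lambda>k. k ^ 2) ` {1..K} \<subseteq> {1..N}" by auto
  qed (auto intro!: mult_nonneg_nonneg r_nonneg)
  also have "\<dots> \<le> w ^ 3 / 2 * ell N + 2 * m * w"
    using V_approx[OF w1 wN] by linarith
  finally have "real q ^ 3 \<le> 4 * real q ^ 6 * ell N + 4 * m * real q ^ 2"
    by (simp add: K_def w3) (simp add: w_def)
  moreover have "4 * m * real q ^ 2 = real q ^ 3 / 2"
    by (simp add: q_def power2_eq_square power3_eq_cube)
  ultimately have "real q ^ 3 / 2 \<le> 4 * real q ^ 6 * ell N" by linarith
  also have "\<dots> = real q ^ 3 * (4 * real q ^ 3 * ell N)" by (simp flip: power_add)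
  finally have "real q ^ 3 * (1 / 2) \<le> real q ^ 3 * (4 * real q ^ 3 * ell N)" by simp
  then have "1 / 2 \<le> 4 * real q ^ 3 * ell N" by (rule mult_left_le_imp_le) (use q in simp)
  then show ?thesis using m_pos by (simp add: q_def field_simps power_mult_distrib)
qed

section \<open>The logarithmic identity and the sum over primes\<close>

text \<open>Write log n = log d + log (n/d) in the sum over d. Complete multiplicativity turns
  \<psi> log into (\<psi>\<Lambda>) * \<psi>, which yields the terms with \<psi>(k); the second part
  is \<Lambda> * 1 * \<psi>.\<close>

lemma r_ln:
  assumes "n > 0"
  shows "r n * ln (real n) = (\<Sum>k | k dvd n. mangoldt k * (1 + \<psi> k) * r (n div k))"
proof -
  have fin: "finite {d. d dvd n}" using assms by simp
  have "(\<Sum>k | k dvd n. mangoldt k * \<psi> k * r (n div k))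
      = (\<Sum>k | k dvd n. \<Sum>d | d dvd n \<and> k dvd d. mangoldt k * \<psi> d)"
  proof (rule sum.cong[OF refl])
    fix k assume "k \<in> {k. k dvd n}"
    then have k: "k dvd n" "k > 0" using assms by (auto intro: Nat.gr0I)
    then obtain c where c: "n = k * c" by blast
    have "(\<Sum>d | d dvd n \<and> k dvd d. mangoldt k * \<psi> d)
        = (\<Sum>d | d dvd n div k. mangoldt k * \<psi> (k * d))"
      by (rule sum.reindex_bij_witness[of _ "\<lambda>d. k * d" "\<lambda>d. d div k"])
         (use k c in \<open>auto\<close>)
    then show "mangoldt k * \<psi> k * r (n div k) = (\<Sum>d | d dvd n \<and> k dvd d. mangoldt k * \<psi> d)"
      by (simp add: r_def mult sum_distrib_left mult.assoc)
  qed
  also have "\<dots> = (\<Sum>d | d dvd n. \<Sum>k | k dvd n \<and> k dvd d. mangoldt k * \<psi> d)"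
    using sum.swap_restrict[OF fin fin, of "\<lambda>k d. mangoldt k * \<psi> d" "\<lambda>k d. k dvd d"] by simp
  also have "\<dots> = (\<Sum>d | d dvd n. \<psi> d * ln (real d))"
  proof (rule sum.cong[OF refl])
    fix d assume "d \<in> {d. d dvd n}"
    then have d: "d dvd n" "d \<noteq> 0" using assms by auto
    then have "{k. k dvd n \<and> k dvd d} = {k. k dvd d}" by (auto intro: dvd_trans)
    then show "(\<Sum>k | k dvd n \<and> k dvd d. mangoldt k * \<psi> d) = \<psi> d * ln (real d)"
      using mangoldt_sum[OF d(2), where ?'a = real] by (simp flip: sum_distrib_right add: mult.commute)
  qed
  finally have 1: "(\<Sum>k | k dvd n. mangoldt k * \<psi> k * r (n div k)) = \<dots>" .
  have "(\<Sum>k | k dvd n. mangoldt k * r (n div k))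
      = (\<Sum>k | k dvd n. \<Sum>d | d dvd n \<and> k * d dvd n. mangoldt k * \<psi> d)"
  proof (rule sum.cong[OF refl])
    fix k assume "k \<in> {k. k dvd n}"
    then have k: "k dvd n" "k > 0" using assms by (auto intro: Nat.gr0I)
    then have "{d. d dvd n \<and> k * d dvd n} = {d. d dvd n div k}"
      by (auto simp: dvd_div_iff_mult mult.commute intro: dvd_mult_right)
    then show "mangoldt k * r (n div k) = (\<Sum>d | d dvd n \<and> k * d dvd n. mangoldt k * \<psi> d)"
      by (simp add: r_def sum_distrib_left)
  qed
  also have "\<dots> = (\<Sum>d | d dvd n. \<Sum>k | k dvd n \<and> k * d dvd n. mangoldt k * \<psi> d)"
    using sum.swap_restrict[OF fin fin, of "\<lambda>k d. mangoldt k * \<psi> d" "\<lambda>k d. k * d dvd n"] by simp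
  also have "\<dots> = (\<Sum>d | d dvd n. \<psi> d * ln (real (n div d)))"
  proof (rule sum.cong[OF refl])
    fix d assume "d \<in> {d. d dvd n}"
    then have d: "d dvd n" "d \<noteq> 0" "n div d \<noteq> 0" using assms by (auto simp: dvd_div_eq_0_iff)
    then have "{k. k dvd n \<and> k * d dvd n} = {k. k dvd n div d}"
      by (auto simp: dvd_div_iff_mult intro: dvd_mult_left)
    then show "(\<Sum>k | k dvd n \<and> k * d dvd n. mangoldt k * \<psi> d) = \<psi> d * ln (real (n div d))"
      using mangoldt_sum[OF d(3), where ?'a = real] by (simp flip: sum_distrib_right add: mult.commute)
  qed
  finally have 2: "(\<Sum>k | k dvd n. mangoldt k * r (n div k)) = \<dots>" .
  have "r n * ln (real n) = (\<Sum>d | d dvd n. \<psi> d * ln (real d) + \<psi> d * ln (real (n div d)))"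
    unfolding r_def sum_distrib_right
  proof (rule sum.cong[OF refl])
    fix d assume "d \<in> {d. d dvd n}"
    then obtain c where c: "n = d * c" by auto
    then have "d > 0" "c > 0" using assms by auto
    then show "\<psi> d * ln (real n) = \<psi> d * ln (real d) + \<psi> d * ln (real (n div d))"
      using c by (simp add: ln_mult algebra_simps)
  qed
  also have "\<dots> = (\<Sum>k | k dvd n. mangoldt k * (1 + \<psi> k) * r (n div k))"
    unfolding sum.distrib 1[symmetric] 2[symmetric]
    by (simp add: algebra_simps flip: sum.distrib)
  finally show ?thesis .
qed

lemma V_ln:
  assumes "y = real N" "N \<ge> 1"
  shows "(\<Sum>k\<in>{1..N}. mangoldt k * (1 + \<psi> k) * V N (y / k)) \<le> ln y * V N y"
proof -
  have y: "y \<ge> 1" using assms by simp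
  have "(\<Sum>k\<in>{1..N}. mangoldt k * (1 + \<psi> k) * V N (y / k))
     = (\<Sum>k\<in>{1..N}. \<Sum>l\<in>{1..N}. mangoldt k * (1 + \<psi> k) * (r l * max 0 (1 - real (k * l) / y)))"
    by (simp add: V_def sum_distrib_left mult.commute)
  also have "\<dots> = (\<Sum>n\<in>{1..N}. \<Sum>k | k dvd n. mangoldt k * (1 + \<psi> k) * 
      (r (n div k) * max 0 (1 - real (k * (n div k)) / y)))"
  proof (rule sum_divisor_swap[symmetric])
    fix d l assume "N < d * l"
    then have "y < real (d * l)" using assms by (simp only: of_nat_less_iff)
    then show "mangoldt d * (1 + \<psi> d) * (r l * max 0 (1 - real (d * l) / y)) = 0"
      using y by (simp add: max_def field_simps)
  qed
  also have "\<dots> = (\<Sum>n\<in>{1..N}. r n * ln (real n) * max 0 (1 - real n / y))"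
    by (intro sum.cong refl) (auto simp: r_ln sum_distrib_right mult.assoc intro!: sum.cong)
  also have "\<dots> \<le> (\<Sum>n\<in>{1..N}. ln y * (r n * max 0 (1 - real n / y)))"
  proof (rule sum_mono)
    fix n assume n: "n \<in> {1..N}"
    then have "ln (real n) \<le> ln y" using assms by simp
    moreover have "0 \<le> r n * max 0 (1 - real n / y)" using r_nonneg[of n] n by simp
    ultimately have "ln (real n) * (r n * max 0 (1 - real n / y)) \<le> ln y * (r n * max 0 (1 - real n / y))"
      by (rule mult_right_mono)
    then show "r n * ln (real n) * max 0 (1 - real n / y) \<le> ln y * (r n * max 0 (1 - real n / y))"
      by (simp add: mult_ac)
  qed
  finally show ?thesis by (simp add: V_def sum_distrib_left)
qed

text \<open>Both sides of \<open>V_ln\<close> are compared with the main term l * z of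
  \<open>V N z\<close>. The factor l is about L(1,\<psi>)/2 and may be tiny, but it cancels; its
  lower bound only determines from where on the main term dominates.\<close>

lemma prime_sum_upper:
  assumes "0 < \<epsilon>" "\<epsilon> < 1" "16384 \<le> real c ^ 2 * \<epsilon>" "X \<ge> 1"
  shows "(\<Sum>p | prime p \<and> p \<le> X. (1 + \<psi> p) * ln (real p) / real p)
    \<le> (1 + \<epsilon>) / (1 - \<epsilon>) * ln (real (X * (c * m ^ 2) ^ 3))"
proof -
  define W where "W = c * m ^ 2"
  define N where "N = X * W ^ 3"
  define y where "y = real N"
  define l where "l = ell N / 2"
  have "real c ^ 2 \<ge> 16384"
  proof -
    have "real c ^ 2 * \<epsilon> \<le> real c ^ 2 * 1" using assms by (intro mult_left_mono) auto
    then show ?thesis using assms by simp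
  qed
  then have c: "real c \<ge> 128" using power2_le_imp_le[of 128 "real c"] by simp
  then have c': "c \<ge> 128" by simp
  have W1: "W \<ge> 128 * m ^ 2" using c' by (simp add: W_def)
  have m2: "m ^ 2 \<ge> 1" using m_pos by simp
  have W2: "W \<ge> 1" using W1 m2 by linarith
  have "8 * (8 * m) ^ 6 \<le> (128 * m ^ 2) ^ 3" by (simp add: power_mult_distrib flip: power_mult)
  also have "\<dots> \<le> W ^ 3" using W1 by (rule power_mono) simp
  also have "\<dots> \<le> N" using assms by (simp add: N_def)
  finally have "ell N \<ge> 1 / (4096 * real m ^ 3)" by (rule ell_lower)
  then have l: "l \<ge> 1 / (8192 * real m ^ 3)" by (simp add: l_def)
  have "1 / (8192 * real m ^ 3) > 0" using m_pos by simp
  with l have l0: "l > 0" by linarith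
  have N1: "N \<ge> 1" using assms W2 by (simp add: N_def)
  have V: "\<bar>V N z - l * z\<bar> \<le> \<epsilon> * (l * z)" if z: "real (W ^ 3) \<le> z" "z \<le> y" for z
  proof -
    define w where "w = root 3 z"
    have z0: "z \<ge> 0" using z(1) by (smt (verit) of_nat_0_le_iff)
    have wz: "w ^ 3 = z" unfolding w_def using z0 by (simp add: real_root_pow_pos2)
    have "root 3 (real W ^ 3) \<le> w" unfolding w_def using z by simp
    then have wW: "real W \<le> w" by (simp add: real_root_power_cancel)
    then have w1: "w \<ge> 1" using W2 by linarith
    have "\<bar>V N (w ^ 3) - w ^ 3 / 2 * ell N\<bar> \<le> 2 * m * w"
      using w1 z wz by (intro V_approx) (auto simp: y_def)
    \<comment> \<open>Since l \<ge> 1/(8192 m^3), this needs \<epsilon> w^2 \<ge> 16384 m^4. It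
      follows from w \<ge> c * m^2 and the hypothesis on c.\<close>
    also have "2 * m * w \<le> \<epsilon> * (l * w ^ 3)"
    proof -
      have "16384 * real m ^ 4 \<le> (real c ^ 2 * \<epsilon>) * real m ^ 4"
        using assms by (intro mult_right_mono) auto
      also have "\<dots> = \<epsilon> * real W ^ 2" by (simp add: W_def power_mult_distrib flip: power_mult)
      also have "\<dots> \<le> \<epsilon> * w ^ 2" using wW assms by (intro mult_left_mono power_mono) auto
      finally have "16384 * real m ^ 4 * (1 / (8192 * real m ^ 3)) \<le> \<epsilon> * w ^ 2 * l"
        by (rule mult_mono[OF _ l]) (use assms(1) in auto)
      moreover have "16384 * real m ^ 4 * (1 / (8192 * real m ^ 3)) = 2 * m"
        using m_pos by (simp add: power4_eq_xxxx power3_eq_cube)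
      ultimately have "2 * m * w \<le> \<epsilon> * w ^ 2 * l * w" using w1 by (intro mult_right_mono) auto
      then show ?thesis by (simp add: power2_eq_square power3_eq_cube mult_ac)
    qed
    finally show ?thesis by (simp add: wz l_def mult.commute)
  qed
  have y0: "y > 0" using N1 by (simp add: y_def)
  have "(1 - \<epsilon>) * l * y * (\<Sum>p | prime p \<and> p \<le> X. (1 + \<psi> p) * ln (real p) / real p)
      = (\<Sum>p | prime p \<and> p \<le> X. mangoldt p * (1 + \<psi> p) * ((1 - \<epsilon>) * (l * (y / p))))"
    unfolding sum_distrib_left by (intro sum.cong refl) (auto simp: field_simps)
  also have "\<dots> \<le> (\<Sum>p | prime p \<and> p \<le> X. mangoldt p * (1 + \<psi> p) * V N (y / p))"
  proof (intro sum_mono mult_left_mono)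
    fix p assume "p \<in> {p. prime p \<and> p \<le> X}"
    then have p: "p \<ge> 1" "p \<le> X" using prime_ge_1_nat by auto
    have "real (p * W ^ 3) \<le> real (X * W ^ 3)" using p by (intro of_nat_mono mult_right_mono) auto
    then have "real (W ^ 3) \<le> y / p" using p by (simp add: y_def N_def field_simps)
    moreover have "y / p \<le> y" using p y0 by (simp add: field_simps)
    ultimately have "\<bar>V N (y / p) - l * (y / p)\<bar> \<le> \<epsilon> * (l * (y / p))" by (rule V)
    then show "(1 - \<epsilon>) * (l * (y / p)) \<le> V N (y / p)" unfolding left_diff_distrib by linarith
    show "0 \<le> mangoldt p * (1 + \<psi> p)" by (intro mult_nonneg_nonneg mangoldt_nonneg one_plus_nonneg)
  qed
  \<comment> \<open>All terms are nonnegative because 1 + \<psi> \<ge> 0. This positivity is what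
    makes the bound one-sided.\<close>
  also have "\<dots> \<le> (\<Sum>k\<in>{1..N}. mangoldt k * (1 + \<psi> k) * V N (y / k))"
  proof (rule sum_mono2)
    have "X \<le> N" using W2 by (simp add: N_def)
    then show "{p. prime p \<and> p \<le> X} \<subseteq> {1..N}" using prime_ge_1_nat by auto
  qed (use mangoldt_nonneg one_plus_nonneg V_nonneg in auto)
  also have "\<dots> \<le> ln y * V N y" by (rule V_ln[OF y_def N1])
  also have "\<dots> \<le> ln y * ((1 + \<epsilon>) * (l * y))"
  proof (rule mult_left_mono)
    have "1 * W ^ 3 \<le> X * W ^ 3" using assms by (intro mult_right_mono) auto
    then have "real (W ^ 3) \<le> y" unfolding y_def N_def by (simp only: of_nat_le_iff mult_1)
    then have "\<bar>V N y - l * y\<bar> \<le> \<epsilon> * (l * y)" by (rule V) simp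
    then show "V N y \<le> (1 + \<epsilon>) * (l * y)" unfolding distrib_right by linarith
    show "0 \<le> ln y" using N1 by (simp add: y_def)
  qed
  finally have "(l * y) * ((1 - \<epsilon>) * (\<Sum>p | prime p \<and> p \<le> X. (1 + \<psi> p) * ln (real p) / real p))
    \<le> (l * y) * ((1 + \<epsilon>) * ln y)" by (simp add: mult_ac)
  then have "(1 - \<epsilon>) * (\<Sum>p | prime p \<and> p \<le> X. (1 + \<psi> p) * ln (real p) / real p) \<le> (1 + \<epsilon>) * ln y"
    using l0 y0 by (simp add: mult_le_cancel_left_pos)
  then have "(\<Sum>p | prime p \<and> p \<le> X. (1 + \<psi> p) * ln (real p) / real p) \<le> (1 + \<epsilon>) * ln y / (1 - \<epsilon>)"
    using assms(2) by (simp add: pos_le_divide_eq mult.commute)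
  then show ?thesis by (simp only: y_def N_def W_def times_divide_eq_left)
qed

end

section \<open>Prime averages\<close>

lemma sum_periodic_block:
  fixes f :: "nat \<Rightarrow> real"
  assumes "\<And>n. f (n + M) = f n"
  shows "(\<Sum>n\<in>{a..<a + M}. f n) = (\<Sum>n\<in>{0..<M}. f n)"
proof (induction a)
  case (Suc a)
  show ?case
  proof (cases "M = 0")
    case False
    have "(\<Sum>n\<in>{Suc a..<Suc a + M}. f n) = (\<Sum>n\<in>{Suc a..<a + M}. f n) + f (a + M)"
      using False by simp
    also have "\<dots> = (\<Sum>n\<in>{a..<a + M}. f n)"
      using assms[of a] False by (simp add: sum.atLeast_Suc_lessThan)
    finally show ?thesis using Suc by simp
  qed simp
qed simp

lemma sum_periodic_bound:
  fixes f :: "nat \<Rightarrow> real"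
  assumes per: "\<And>n. f (n + M) = f n" and z: "(\<Sum>n\<in>{0..<M}. f n) = 0"
    and b: "\<And>n. \<bar>f n\<bar> \<le> 1" and "M > 0"
  shows "\<bar>\<Sum>n\<in>{a..<b}. f n\<bar> \<le> real M"
proof (induction "b - a" arbitrary: a rule: less_induct)
  case less
  show ?case
  proof (cases "b \<le> a + M")
    case True
    have "\<bar>\<Sum>n\<in>{a..<b}. f n\<bar> \<le> (\<Sum>n\<in>{a..<b}. 1)" using b by (intro order_trans[OF sum_abs sum_mono])
    also have "\<dots> \<le> real M" using True by simp
    finally show ?thesis .
  next
    case False
    have "(\<Sum>n\<in>{a..<b}. f n) = (\<Sum>n\<in>{a..<a + M}. f n) + (\<Sum>n\<in>{a + M..<b}. f n)"
      using False by (simp add: sum.atLeastLessThan_concat)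
    moreover have "(\<Sum>n\<in>{a..<a + M}. f n) = 0" using sum_periodic_block[of f M a] per z by simp
    moreover have "\<bar>\<Sum>n\<in>{a + M..<b}. f n\<bar> \<le> real M" using False \<open>M > 0\<close> by (intro less) simp
    ultimately show ?thesis by simp
  qed
qed

lemma real_char_neg_char:
  assumes "e \<ge> 1"
  shows "real_char (\<lambda>n. of_int (neg_char e (int n))) (8 * e)"
proof
  define f where "f = (\<lambda>n. real_of_int (neg_char e (int n)))"
  define M where "M = 8 * e"
  have per: "f (n + M) = f n" for n
    unfolding f_def by (intro arg_cong[of _ _ real_of_int] neg_char_cong) (simp add: M_def cong_iff_dvd_diff)
  have refl: "f (M - n) = - f n" if "n \<le> M" for n
  proof -
    have "neg_char e (int (M - n)) = neg_char e (- int n)"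
      using that by (intro neg_char_cong) (simp add: M_def cong_iff_dvd_diff of_nat_diff)
    then show ?thesis by (simp add: f_def neg_char_uminus)
  qed
  \<comment> \<open>The shift to 1, ..., M makes n \<mapsto> M - n a bijection onto 0, ..., M - 1;
    oddness then shows that the sum equals its own negative.\<close>
  have "(\<Sum>n\<in>{0..<M}. f n) = (\<Sum>n\<in>{1..<1 + M}. f n)" using sum_periodic_block[of f M 1] per by simp
  also have "\<dots> = (\<Sum>n\<in>{0..<M}. f (M - n))"
    by (rule sum.reindex_bij_witness[of _ "\<lambda>n. M - n" "\<lambda>n. M - n"]) auto
  also have "\<dots> = - (\<Sum>n\<in>{0..<M}. f n)"
    unfolding sum_negf[symmetric] using refl by (intro sum.cong) auto
  finally have z: "(\<Sum>n\<in>{0..<M}. f n) = 0" by simp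
  have b: "\<bar>f n\<bar> \<le> 1" for n using neg_char_range[of e "int n"] by (auto simp: f_def)
  show "\<bar>\<Sum>n = a..<b. real_of_int (neg_char e (int n))\<bar> \<le> real (8 * e)" for a b
    using sum_periodic_bound[of f M a b, OF per z b] assms by (simp add: f_def M_def)
  show "real_of_int (neg_char e (int n)) \<in> {- 1, 0, 1}" for n
    using neg_char_range[of e "int n"] by auto
qed (use assms in \<open>auto simp: neg_char_mult\<close>)

section \<open>Sums of the powers b^(-5/4)\<close>

lemma powr_diff_le:
  fixes x :: real
  assumes "x \<ge> 2"
  shows "x powr (-5/4) \<le> 4 * ((x - 1) powr (-1/4) - x powr (-1/4))"
proof -
  have "\<exists>t>x - 1. t < x \<and> (- 4 * x powr (-1/4)) - (- 4 * (x - 1) powr (-1/4)) = (x - (x - 1)) * (t powr (-5/4))"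
    by (rule MVT2) (use assms in \<open>auto intro!: derivative_eq_intros\<close>)
  then obtain t where t: "x - 1 < t" "t < x" "4 * ((x - 1) powr (-1/4) - x powr (-1/4)) = t powr (-5/4)"
    by auto
  have "x powr (-5/4) \<le> t powr (-5/4)" using t assms by (intro powr_mono2') auto
  then show ?thesis using t by simp
qed

text \<open>The exponent 5/4 is 3/2 - 1/4: the number of a with a^2 b^3 \<le> Y decays like
  b^(-3/2), and b^(1/4) is given away for the prescribed primes that divide b.\<close>

lemma sum_powr_tail:
  assumes "a \<ge> 1"
  shows "(\<Sum>b\<in>{a<..N}. real b powr (-5/4)) \<le> 4 * real a powr (-1/4)"
proof (cases "a \<le> N")
  case True
  then have "(\<Sum>b\<in>{a<..N}. real b powr (-5/4)) \<le> 4 * (real a powr (-1/4) - real N powr (-1/4))"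
  proof (induction N rule: dec_induct)
    case (step n)
    have "{a<..Suc n} = insert (Suc n) {a<..n}" using step by auto
    then show ?case using step powr_diff_le[of "real (Suc n)"] assms by simp
  qed simp
  then show ?thesis using powr_ge_zero[of "real N" "-1/4"] by argo
qed simp

lemma sum_powr_all: "(\<Sum>b\<in>{1..N}. real b powr (-5/4)) \<le> 5"
proof (cases "N \<ge> 1")
  case True
  then have "{1..N} = insert 1 {1<..N}" by auto
  then show ?thesis using sum_powr_tail[of 1 N] by simp
qed simp

section \<open>Mertens-type estimates for primes\<close>

lemma ln_fact_lower: "n \<ge> 1 \<Longrightarrow> (\<Sum>k\<in>{1..n}. ln (real k)) \<ge> real n * ln (real n) - real n"
proof (induction n rule: dec_induct)
  case (step n)
  have "ln (real (Suc n)) - ln (real n) = ln (real (Suc n) / real n)"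
    using step by (simp add: ln_div)
  also have "real (Suc n) / real n = 1 + 1 / real n" using step by (simp add: field_simps)
  also have "ln (1 + 1 / real n) \<le> 1 / real n" by (rule ln_add_one_self_le_self) simp
  finally have "real n * (ln (real (Suc n)) - ln (real n)) \<le> 1" using step by (simp add: field_simps)
  then show ?case using step by (simp add: algebra_simps)
qed simp

text \<open>Legendre's formula for the logarithm of N!.\<close>

lemma sum_mangoldt_floor:
  "(\<Sum>k\<in>{1..N}. ln (real k)) = (\<Sum>d\<in>{1..N}. mangoldt d * real (N div d))"
proof -
  have "(\<Sum>k\<in>{1..N}. ln (real k)) = (\<Sum>n\<in>{1..N}. \<Sum>d | d dvd n. (if d * (n div d) \<le> N then mangoldt d else 0))"
  proof (rule sum.cong[OF refl])
    fix n assume n: "n \<in> {1..N}"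
    then have "(\<Sum>d | d dvd n. (if d * (n div d) \<le> N then mangoldt d else 0)) = (\<Sum>d | d dvd n. mangoldt d :: real)"
      by (intro sum.cong) auto
    then show "ln (real n) = (\<Sum>d | d dvd n. (if d * (n div d) \<le> N then mangoldt d else 0))"
      using mangoldt_sum[of n, where ?'a = real] n by simp
  qed
  also have "\<dots> = (\<Sum>d\<in>{1..N}. \<Sum>l\<in>{1..N}. (if d * l \<le> N then mangoldt d else 0))"
    by (rule sum_divisor_swap) auto
  also have "\<dots> = (\<Sum>d\<in>{1..N}. mangoldt d * real (N div d))"
  proof (rule sum.cong[OF refl])
    fix d assume d: "d \<in> {1..N}"
    have "{l \<in> {1..N}. d * l \<le> N} = {1..N div d}"
    proof -
      have "d * l \<le> N \<longleftrightarrow> l \<le> N div d" for l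
        using d by (simp add: less_eq_div_iff_mult_less_eq mult.commute)
      moreover have "l \<le> N" if "l \<le> N div d" for l using that div_le_dividend[of N d] by linarith
      ultimately show ?thesis by auto
    qed
    then show "(\<Sum>l\<in>{1..N}. (if d * l \<le> N then mangoldt d else 0)) = mangoldt d * real (N div d)"
      by (simp flip: sum.inter_filter)
  qed
  finally show ?thesis .
qed

lemma sum_mangoldt_lower:
  assumes "N \<ge> 1"
  shows "(\<Sum>d\<in>{1..N}. mangoldt d / real d) \<ge> ln (real N) - 1"
proof -
  have "real N * ln (real N) - real N \<le> (\<Sum>d\<in>{1..N}. mangoldt d * real (N div d))"
    using ln_fact_lower[OF assms] sum_mangoldt_floor by simp
  also have "\<dots> \<le> (\<Sum>d\<in>{1..N}. mangoldt d * (real N / real d))"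
    by (intro sum_mono mult_left_mono mangoldt_nonneg) (metis of_nat_div_le_of_nat)
  also have "\<dots> = real N * (\<Sum>d\<in>{1..N}. mangoldt d / real d)"
    by (simp add: sum_distrib_left mult.commute)
  finally have "real N * (ln (real N) - 1) \<le> real N * (\<Sum>d\<in>{1..N}. mangoldt d / real d)"
    by (simp add: algebra_simps)
  then show ?thesis by (rule mult_left_le_imp_le) (use assms in simp)
qed

text \<open>The trivial bound \<Lambda>(d) \<le> log N replaces Chebyshev's estimate. The resulting
  factor 2 is harmless, because the bound serves only to discard the primes up to
  \<open>2^(16*s)\<close> from a range up to \<open>2^(200000*s)\<close>.\<close>

lemma sum_mangoldt_upper:
  assumes "N \<ge> 1"
  shows "(\<Sum>d\<in>{1..N}. mangoldt d / real d) \<le> 2 * ln (real N)"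
proof -
  have "real N * (\<Sum>d\<in>{1..N}. mangoldt d / real d) = (\<Sum>d\<in>{1..N}. mangoldt d * (real N / real d))"
    by (simp add: sum_distrib_left mult.commute)
  also have "\<dots> \<le> (\<Sum>d\<in>{1..N}. mangoldt d * (real (N div d) + 1))"
  proof (intro sum_mono mult_left_mono mangoldt_nonneg)
    fix d assume "d \<in> {1..N}"
    have "real N / real d < real_of_int \<lfloor>real N / real d\<rfloor> + 1" by linarith
    also have "\<lfloor>real N / real d\<rfloor> = int (N div d)" by (simp add: floor_divide_of_nat_eq)
    finally show "real N / real d \<le> real (N div d) + 1" by simp
  qed
  also have "\<dots> = (\<Sum>k\<in>{1..N}. ln (real k)) + (\<Sum>d\<in>{1..N}. mangoldt d)"
    unfolding sum_mangoldt_floor by (simp add: algebra_simps sum.distrib)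
  also have "\<dots> \<le> (\<Sum>k\<in>{1..N}. ln (real N)) + (\<Sum>d\<in>{1..N}. ln (real N))"
  proof (intro add_mono sum_mono)
    fix d assume d: "d \<in> {1..N}"
    then show 1: "ln (real d) \<le> ln (real N)" by simp
    have "mangoldt d \<le> ln (real d)" using mangoldt_le[of d] d by simp
    then show "mangoldt d \<le> ln (real N)" using 1 by linarith
  qed
  also have "\<dots> = real N * (2 * ln (real N))" by simp
  finally show ?thesis by (rule mult_left_le_imp_le) (use assms in simp)
qed

lemma sum_ln_prime_upper:
  assumes "N \<ge> 1"
  shows "(\<Sum>p | prime p \<and> p \<le> N. ln (real p) / real p) \<le> 2 * ln (real N)"
proof -
  have "(\<Sum>p | prime p \<and> p \<le> N. ln (real p) / real p) = (\<Sum>p | prime p \<and> p \<le> N. mangoldt p / real p)"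
    by (intro sum.cong) auto
  also have "\<dots> \<le> (\<Sum>d\<in>{1..N}. mangoldt d / real d)"
    using prime_ge_1_nat by (intro sum_mono2) (auto intro!: divide_nonneg_nonneg mangoldt_nonneg)
  also have "\<dots> \<le> 2 * ln (real N)" by (rule sum_mangoldt_upper[OF assms])
  finally show ?thesis .
qed

lemma geometric_tail:
  fixes x :: real
  assumes "0 \<le> x" "x \<le> 1 / 2"
  shows "(\<Sum>k\<in>{2..M}. x ^ k) \<le> 2 * x ^ 2"
proof (cases "M \<ge> 2")
  case True
  then have "(\<Sum>k\<in>{2..M}. x ^ k) + x ^ M \<le> 2 * x ^ 2"
  proof (induction M rule: dec_induct)
    case (step M)
    have "x * x ^ M \<le> 1 / 2 * x ^ M" using assms by (intro mult_right_mono) auto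
    then show ?case using step by simp
  qed simp
  then show ?thesis using assms(1) zero_le_power[of x M] by linarith
qed simp

text \<open>Proper prime powers contribute at most the sum of 2 log p / p^2. With log p \<le> (4/3)
  p^(3/4) this is a sum of (8/3) p^(-5/4), hence at most 40/3; together with the 1 of
  \<open>sum_mangoldt_lower\<close> it stays below 15.\<close>

lemma sum_ln_prime_lower:
  assumes "N \<ge> 1"
  shows "(\<Sum>p | prime p \<and> p \<le> N. ln (real p) / real p) \<ge> ln (real N) - 15"
proof -
  define P where "P = {p. prime p \<and> p \<le> N}"
  define Q where "Q = {q \<in> {1..N}. primepow q \<and> \<not> prime q}"
  have fP: "finite P" by (simp add: P_def)
  have "(\<Sum>d\<in>{1..N}. mangoldt d / real d) = (\<Sum>d\<in>P \<union> Q. mangoldt d / real d)"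
    using prime_ge_1_nat
    by (intro sum.mono_neutral_right) (auto simp: P_def Q_def mangoldt_def)
  also have "\<dots> = (\<Sum>p\<in>P. mangoldt p / real p) + (\<Sum>d\<in>Q. mangoldt d / real d)"
    by (rule sum.union_disjoint) (auto simp: P_def Q_def)
  also have "(\<Sum>p\<in>P. mangoldt p / real p) = (\<Sum>p\<in>P. ln (real p) / real p)"
    by (intro sum.cong) (auto simp: P_def)
  also have "(\<Sum>d\<in>Q. mangoldt d / real d) \<le> 40 / 3"
  proof -
    have sub: "Q \<subseteq> (\<lambda>(p,k). p ^ k) ` (P \<times> {2..N})"
    proof
      fix q assume "q \<in> Q"
      then have q: "1 \<le> q" "q \<le> N" "primepow q" "\<not> prime q" by (auto simp: Q_def)
      then obtain p k where pk: "prime p" "k > 0" "q = p ^ k" by (auto simp: primepow_def)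
      have "k \<noteq> 1" using pk q by auto
      then have "k \<ge> 2" using pk by simp
      have "p ^ 1 \<le> p ^ k" using pk prime_gt_0_nat[of p] by (intro power_increasing) auto
      moreover have "k < p ^ k" using prime_gt_1_nat[OF pk(1)]  by (simp add: power_gt_expt)
      ultimately have "(p, k) \<in> P \<times> {2..N}" using pk q \<open>k \<ge> 2\<close> by (auto simp: P_def)
      then show "q \<in> (\<lambda>(p,k). p ^ k) ` (P \<times> {2..N})" using pk(3) by force
    qed
    have "(\<Sum>d\<in>Q. mangoldt d / real d) \<le> (\<Sum>d\<in>(\<lambda>(p,k). p ^ k) ` (P \<times> {2..N}). mangoldt d / real d)"
      using sub fP by (intro sum_mono2) (auto intro!: divide_nonneg_nonneg mangoldt_nonneg)
    also have "\<dots> \<le> sum ((\<lambda>d. mangoldt d / real d) \<circ> (\<lambda>(p,k). p ^ k)) (P \<times> {2..N})"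
      using fP by (intro sum_image_le) (auto intro!: divide_nonneg_nonneg mangoldt_nonneg)
    also have "\<dots> = (\<Sum>p\<in>P. \<Sum>k\<in>{2..N}. ln (real p) * (1 / real p) ^ k)"
      unfolding sum.cartesian_product
      by (intro sum.cong) (auto simp: P_def power_divide)
    also have "\<dots> = (\<Sum>p\<in>P. ln (real p) * (\<Sum>k\<in>{2..N}. (1 / real p) ^ k))"
      by (simp add: sum_distrib_left)
    also have "\<dots> \<le> (\<Sum>p\<in>P. 8 / 3 * real p powr (-5/4))"
    proof (rule sum_mono)
      fix p assume "p \<in> P"
      then have p: "p \<ge> 2" using prime_ge_2_nat by (auto simp: P_def)
      have "ln (real p) \<le> real p powr (3/4) / (3/4)" using p by (intro ln_powr_bound) auto
      moreover have "(\<Sum>k\<in>{2..N}. (1 / real p) ^ k) \<le> 2 * (1 / real p) ^ 2"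
        using p by (intro geometric_tail) (auto simp: field_simps)
      ultimately have "ln (real p) * (\<Sum>k\<in>{2..N}. (1 / real p) ^ k)
          \<le> real p powr (3/4) / (3/4) * (2 * (1 / real p) ^ 2)"
        by (intro mult_mono) (auto intro!: sum_nonneg)
      also have "(1 / real p) ^ 2 = real p powr (-2)" using p by (simp add: powr_minus power_divide inverse_eq_divide)
      also have "real p powr (3/4) / (3/4) * (2 * real p powr (-2)) = 8 / 3 * real p powr (-5/4)"
        by (simp flip: powr_add)
      finally show "ln (real p) * (\<Sum>k\<in>{2..N}. (1 / real p) ^ k) \<le> 8 / 3 * real p powr (-5/4)" .
    qed
    also have "\<dots> \<le> (\<Sum>b\<in>{1..N}. 8 / 3 * real b powr (-5/4))"
      using prime_ge_1_nat by (intro sum_mono2) (auto simp: P_def)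
    also have "\<dots> \<le> 8 / 3 * 5" unfolding sum_distrib_left[symmetric]
      using sum_powr_all by (intro mult_left_mono) auto
    finally show ?thesis by simp
  qed
  finally show ?thesis using sum_mangoldt_lower[OF assms] by (simp add: P_def)
qed

section \<open>One-sided averages over the primes still available\<close>

lemma card_prime_factors_le:
  assumes "e > 0" 
  shows "2 ^ card (prime_factors e) \<le> (e :: nat)"
proof -
  have "2 ^ card (prime_factors e) = (\<Prod>p\<in>prime_factors e. 2)" by simp
  also have "\<dots> \<le> (\<Prod>p\<in>prime_factors e. p ^ multiplicity p e)"
  proof (rule prod_mono)
    fix p assume p: "p \<in> prime_factors e"
    then have "2 \<le> p" "multiplicity p e \<ge> 1" 
      using prime_ge_2_nat by (auto simp: prime_factors_multiplicity)
    then have "2 ^ 1 \<le> p ^ multiplicity p e" by (meson le_trans power_increasing power_mono le0 one_le_numeral order_trans)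
    then show "0 \<le> (2::nat) \<and> 2 \<le> p ^ multiplicity p e" by simp
  qed
  also have "\<dots> = e" using prime_factorization_nat[of e] assms by simp
  finally show ?thesis .
qed

lemma sum_Un_le:
  fixes f :: "'a \<Rightarrow> real"
  assumes "finite A" "finite B" "\<And>x. x \<in> A \<inter> B \<Longrightarrow> 0 \<le> f x"
  shows "sum f (A \<union> B) \<le> sum f A + sum f B"
  using sum_Un[OF assms(1,2), of f] sum_nonneg[of "A \<inter> B" f] assms(3) by auto

text \<open>Primes dividing \<open>e\<close> get the value \<open>1\<close> because they exclude no representation.\<close>

definition split_sign :: "nat \<Rightarrow> nat \<Rightarrow> real" where
  "split_sign e p = (if p dvd e \<or> Legendre (- int e) (int p) = 1 then 1 else - 1)"

lemma split_sign_le: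
  assumes "prime p" "2 < p" "e > 0"
  shows "1 + split_sign e p \<le> (1 + of_int (neg_char e (int p))) + (if p dvd e then 2 else 0)"
proof -
  have "neg_char e (int p) \<in> {-1, 0, 1}" by (rule neg_char_range)
  then show ?thesis using neg_char_prime[OF assms(1,2) _ assms(3)] by (auto simp: split_sign_def)
qed

text \<open>The upper bound for the sum of (1 + \<psi>(p)) log p / p over all primes up to X is
  compared with the lower bound for the sum of log p / p over \<open>Q\<close>. The set
  \<open>U\<close> holds the primes already spent; all primes in question are so large that those in
  \<open>U\<close> and those dividing e have negligible weight. The range up to
  \<open>2^(200000*s)\<close> is long enough that the factor (c m^2)^3 adds only about two percent
  to log X.\<close>

lemma split_sign_average:
  assumes s: "s \<ge> 4" and e: "1 \<le> e" "e \<le> 2 ^ (680 * s)"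
    and U: "finite U" "card U \<le> 80 * s * 2 ^ (4 * s)"
  defines "Q \<equiv> {p. prime p \<and> 2 ^ (16 * s) < p \<and> p \<le> 2 ^ (200000 * s)} - U"
  shows "(\<Sum>p\<in>Q. ln (real p) / real p * split_sign e p) \<le> 1 / 32 * (\<Sum>p\<in>Q. ln (real p) / real p)"
    and "0 < (\<Sum>p\<in>Q. ln (real p) / real p)"
proof -
  define w where "w = (\<lambda>p. ln (real p) / real p)"
  define X where "X = (2::nat) ^ (200000 * s)"
  define z where "z = (2::nat) ^ (16 * s)"
  define lam where "lam = real s * ln 2"
  have ln2: "ln (2::real) \<ge> 1 / 2"
  proof -
    have "exp (1 / 2) ^ 2 \<le> (2::real) ^ 2" using exp_le by (simp flip: exp_of_nat_mult)
    then have "exp (1 / 2) \<le> (2::real)" by (rule power2_le_imp_le) simp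
    then have "ln (exp (1 / 2)) \<le> ln (2::real)" by (subst ln_le_cancel_iff) simp_all
    then show ?thesis by simp
  qed
  have "4 * (1 / 2) \<le> real s * ln 2" using s ln2 by (intro mult_mono) auto
  then have lam2: "lam \<ge> 2" by (simp add: lam_def)
  have lnX: "ln (real X) = 200000 * lam" "ln (real z) = 16 * lam"
    by (auto simp: X_def z_def lam_def ln_realpow)
  have zX: "1 \<le> z" "z \<le> X" "1 \<le> X" by (auto simp: z_def X_def)
  have ss: "real s \<le> 2 ^ s" using less_exp[of s] by (simp add: less_imp_le)
  have w_small: "w p \<le> 2 / 2 ^ (8 * s)" if "z < p" for p
  proof -
    have p: "real p \<ge> 1" using that zX by simp
    have "ln (real p) \<le> real p powr (1/2) / (1/2)" using p by (intro ln_powr_bound) auto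
    then have "w p \<le> 2 * sqrt (real p) / real p" using p 
      by (simp add: w_def powr_half_sqrt divide_right_mono)
    also have "\<dots> = 2 / sqrt (real p)" using p by (simp add: field_simps)
    also have "\<dots> \<le> 2 / 2 ^ (8 * s)"
    proof (rule divide_left_mono)
      have "sqrt (real z) \<le> sqrt (real p)" using that by simp
      moreover have "real z = (2 ^ (8 * s)) ^ 2" by (simp add: z_def flip: power_mult)
      ultimately show "2 ^ (8 * s) \<le> sqrt (real p)" by simp
    qed (use p in auto)
    finally show ?thesis .
  qed
  have w_nonneg: "0 \<le> w p" if "prime p" for p using prime_ge_1_nat[OF that] by (simp add: w_def)
  have finQ: "finite Q" unfolding Q_def by (rule finite_subset[of _ "{..2 ^ (200000 * s)}"]) auto
  define R where "R = {p. prime p \<and> p \<le> X}"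
  have finR: "finite R" by (simp add: R_def)
  have small: "real (k * s) * 2 ^ (4 * s) * (2 / 2 ^ (8 * s)) \<le> 1" if "k \<le> 1360" for k
  proof -
    have "2 * real k \<le> 2 ^ 12" using that by simp
    also have "\<dots> \<le> 2 ^ (3 * s)" using s by (intro power_increasing) auto
    finally have "2 * real k * real s \<le> 2 ^ (3 * s) * 2 ^ s" using ss by (intro mult_mono) auto
    also have "\<dots> = 2 ^ (4 * s)" by (simp flip: power_add)
    finally have "2 * real k * real s * 2 ^ (4 * s) \<le> 2 ^ (4 * s) * 2 ^ (4 * s)" by (intro mult_right_mono) auto
    also have "\<dots> = 2 ^ (8 * s)" by (simp flip: power_add)
    finally show ?thesis by (simp add: field_simps)
  qed
  \<comment> \<open>The losses are 15 from the Mertens-type bound, \<open>32 * lam\<close> from the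
    primes up to \<open>z\<close>, and 1 from \<open>U\<close>.\<close>
  have W: "(\<Sum>p\<in>Q. w p) \<ge> 200000 * lam - 15 - 32 * lam - 1"
  proof -
    define U' where "U' = {p \<in> U. prime p \<and> z < p}"
    have "R \<subseteq> Q \<union> {p. prime p \<and> p \<le> z} \<union> U'"
      by (auto simp: R_def Q_def U'_def X_def z_def)
    then have "(\<Sum>p\<in>R. w p) \<le> (\<Sum>p\<in>Q \<union> {p. prime p \<and> p \<le> z} \<union> U'. w p)"
      using finQ U by (intro sum_mono2) (auto simp: Q_def U'_def intro: w_nonneg)
    also have "\<dots> \<le> (\<Sum>p\<in>Q \<union> {p. prime p \<and> p \<le> z}. w p) + (\<Sum>p\<in>U'. w p)"
      using finQ U by (intro sum_Un_le) (auto simp: Q_def U'_def intro: w_nonneg)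
    also have "\<dots> \<le> (\<Sum>p\<in>Q. w p) + (\<Sum>p | prime p \<and> p \<le> z. w p) + (\<Sum>p\<in>U'. w p)"
      using finQ by (intro add_right_mono sum_Un_le) (auto simp: Q_def intro: w_nonneg)
    also have "(\<Sum>p | prime p \<and> p \<le> z. w p) \<le> 32 * lam"
      using sum_ln_prime_upper[OF zX(1)] lnX by (simp add: w_def)
    also have "(\<Sum>p\<in>U'. w p) \<le> 1"
    proof -
      have "(\<Sum>p\<in>U'. w p) \<le> real (card U') * (2 / 2 ^ (8 * s))"
        by (rule sum_bounded_above) (auto simp: U'_def intro: w_small)
      also have "\<dots> \<le> real (80 * s * 2 ^ (4 * s)) * (2 / 2 ^ (8 * s))"
      proof (intro mult_right_mono of_nat_mono)
        have "card U' \<le> card U" using U by (intro card_mono) (auto simp: U'_def)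
        then show "card U' \<le> 80 * s * 2 ^ (4 * s)" using U by linarith
      qed simp
      also have "\<dots> \<le> 1" using small[of 80] by simp
      finally show ?thesis .
    qed
    finally have "(\<Sum>p\<in>R. w p) \<le> (\<Sum>p\<in>Q. w p) + 32 * lam + 1" by simp
    moreover have "(\<Sum>p\<in>R. w p) \<ge> 200000 * lam - 15"
      using sum_ln_prime_lower[OF zX(3)] lnX by (simp add: w_def R_def)
    ultimately show ?thesis by linarith
  qed
  interpret real_char "\<lambda>n. of_int (neg_char e (int n))" "8 * e" using e by (intro real_char_neg_char)
  \<comment> \<open>For \<epsilon> = 1/256 the choice c = 2048 satisfies c^2 \<epsilon> = 16384
    exactly. With m = 8e the exponent of 2 becomes 200000s + 3(11 + 2(3 + 680s)) = 204080s +
    51.\<close>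
  have main: "(\<Sum>p\<in>R. (1 + of_int (neg_char e (int p))) * w p) \<le> 257 / 255 * (204131 * lam)"
  proof -
    have "(\<Sum>p\<in>R. (1 + of_int (neg_char e (int p))) * w p)
        \<le> (1 + 1 / 256) / (1 - 1 / 256) * ln (real (X * (2048 * (8 * e) ^ 2) ^ 3))"
      using prime_sum_upper[of "1 / 256" 2048 X] zX(3) by (simp add: R_def w_def)
    also have "ln (real (X * (2048 * (8 * e) ^ 2) ^ 3)) \<le> ln (2 ^ (204131 * s))"
    proof -
      have "X * (2048 * (8 * e) ^ 2) ^ 3 \<le> X * (2 ^ 11 * (2 ^ 3 * 2 ^ (680 * s)) ^ 2) ^ 3"
        using e by (intro mult_left_mono power_mono) auto
      also have "\<dots> = 2 ^ (200000 * s + (11 + (3 + 680 * s) * 2) * 3)"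
        unfolding X_def power_add power_mult by (simp only: power_mult_distrib)
      also have "\<dots> \<le> 2 ^ (204131 * s)" using s by (intro power_increasing) auto
      finally have "real (X * (2048 * (8 * e) ^ 2) ^ 3) \<le> 2 ^ (204131 * s)"
        by (metis of_nat_le_iff of_nat_numeral of_nat_power)
      then show ?thesis using e zX by (subst ln_le_cancel_iff) auto
    qed
    also have "ln (2 ^ (204131 * s)) = 204131 * lam" by (simp add: ln_realpow lam_def)
    finally show ?thesis by simp
  qed
  have div: "(\<Sum>p\<in>Q. if p dvd e then 2 * w p else 0) \<le> 2"
  proof -
    have "(\<Sum>p\<in>Q. if p dvd e then 2 * w p else 0) = (\<Sum>p\<in>{p\<in>Q. p dvd e}. 2 * w p)"
      using finQ by (simp add: sum.inter_filter)
    also have "\<dots> \<le> real (card {p\<in>Q. p dvd e}) * (2 * (2 / 2 ^ (8 * s)))"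
    proof (rule sum_bounded_above)
      fix p assume "p \<in> {p\<in>Q. p dvd e}"
      then have "z < p" by (simp add: Q_def z_def)
      then show "2 * w p \<le> 2 * (2 / 2 ^ (8 * s))" using w_small by (intro mult_left_mono) auto
    qed
    also have "\<dots> \<le> real (680 * s) * (2 * (2 / 2 ^ (8 * s)))"
    proof (intro mult_right_mono of_nat_mono)
      have "card {p\<in>Q. p dvd e} \<le> card (prime_factors e)"
        using e by (intro card_mono) (auto simp: Q_def in_prime_factors_iff)
      also have "(2::nat) ^ card (prime_factors e) \<le> 2 ^ (680 * s)" 
        using card_prime_factors_le[of e] e by linarith
      then have "card (prime_factors e) \<le> 680 * s" by (rule power_le_imp_le_exp[rotated]) simp
      finally show "card {p\<in>Q. p dvd e} \<le> 680 * s" .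
    qed simp
    also have "\<dots> = 2 * (real (680 * s) * 1 * (2 / 2 ^ (8 * s)))" by simp
    also have "\<dots> \<le> 2 * (real (680 * s) * 2 ^ (4 * s) * (2 / 2 ^ (8 * s)))"
      by (intro mult_left_mono mult_right_mono) auto
    also have "\<dots> \<le> 2 * 1" using small[of 680] by (intro mult_left_mono) simp_all
    finally show ?thesis by simp
  qed
  have p2: "2 < p" if "p \<in> Q" for p
  proof -
    have "(2::nat) ^ 1 \<le> 2 ^ (16 * s)" using s by (intro power_increasing) auto
    then show ?thesis using that by (auto simp: Q_def)
  qed
  have "(\<Sum>p\<in>Q. w p * (1 + split_sign e p))
      \<le> (\<Sum>p\<in>Q. (1 + of_int (neg_char e (int p))) * w p + (if p dvd e then 2 * w p else 0))"
  proof (rule sum_mono)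
    fix p assume p: "p \<in> Q"
    then have "prime p" by (simp add: Q_def)
    have "w p * (1 + split_sign e p) \<le> w p * ((1 + of_int (neg_char e (int p))) + (if p dvd e then 2 else 0))"
      using split_sign_le[OF \<open>prime p\<close> p2[OF p], of e] e w_nonneg[OF \<open>prime p\<close>] by (intro mult_left_mono) auto
    then show "w p * (1 + split_sign e p)
      \<le> (1 + of_int (neg_char e (int p))) * w p + (if p dvd e then 2 * w p else 0)"
      by (auto simp: algebra_simps)
  qed
  also have "\<dots> \<le> (\<Sum>p\<in>R. (1 + of_int (neg_char e (int p))) * w p) + 2"
    unfolding sum.distrib
  proof (intro add_mono div sum_mono2)
    show "Q \<subseteq> R" by (auto simp: Q_def R_def X_def)
    show "0 \<le> (1 + of_int (neg_char e (int p))) * w p" if "p \<in> R - Q" for p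
      using that one_plus_nonneg[of p] w_nonneg[of p] by (auto simp: R_def)
  qed (use finR in auto)
  \<comment> \<open>Numerically (257/255) * 204131 < (33/32) * 199968, and the surplus times
    \<open>lam\<close> absorbs the additive constants.\<close>
  also have "\<dots> \<le> 33 / 32 * (\<Sum>p\<in>Q. w p)" using main W lam2 by argo
  finally have "(\<Sum>p\<in>Q. w p) + (\<Sum>p\<in>Q. w p * split_sign e p) \<le> 33 / 32 * (\<Sum>p\<in>Q. w p)"
    by (simp only: distrib_left mult_1_right sum.distrib)
  then have "(\<Sum>p\<in>Q. w p * split_sign e p) \<le> 1 / 32 * (\<Sum>p\<in>Q. w p)" by linarith
  then show "(\<Sum>p\<in>Q. ln (real p) / real p * split_sign e p) \<le> 1 / 32 * (\<Sum>p\<in>Q. ln (real p) / real p)"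
    by (simp only: w_def)
  show "0 < (\<Sum>p\<in>Q. ln (real p) / real p)" using W lam2 by (simp add: w_def)
qed

section \<open>Greedy choice of the covering primes\<close>

text \<open>Average the new potential over \<open>Q\<close> with weights \<open>w\<close>: some p
  does at least as well as the average.\<close>

lemma greedy_step:
  fixes W :: "'i \<Rightarrow> real" and w :: "'p \<Rightarrow> real"
  assumes "finite I" "finite Q" "\<And>i. i \<in> I \<Longrightarrow> 0 \<le> W i" "\<And>p. p \<in> Q \<Longrightarrow> 0 \<le> w p" "0 < sum w Q"
    and avg: "\<And>i. i \<in> I \<Longrightarrow> (\<Sum>p\<in>Q. w p * f i p) \<le> \<epsilon> * sum w Q"
  shows "\<exists>p\<in>Q. (\<Sum>i\<in>I. W i * (1 + f i p)) \<le> (1 + \<epsilon>) * sum W I"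
proof (rule ccontr)
  assume "\<not> ?thesis"
  then have *: "(1 + \<epsilon>) * sum W I < (\<Sum>i\<in>I. W i * (1 + f i p))" if "p \<in> Q" for p
    using that by (auto simp: not_le)
  obtain q where q: "q \<in> Q" "0 < w q"
    using assms(5) sum_nonpos[of Q w] by (meson not_less)
  have "sum w Q * ((1 + \<epsilon>) * sum W I) = (\<Sum>p\<in>Q. w p * ((1 + \<epsilon>) * sum W I))"
    by (simp add: sum_distrib_right)
  also have "\<dots> < (\<Sum>p\<in>Q. w p * (\<Sum>i\<in>I. W i * (1 + f i p)))"
  proof (rule sum_strict_mono_ex1)
    show "finite Q" by (rule assms)
    show "\<forall>p\<in>Q. w p * ((1 + \<epsilon>) * sum W I) \<le> w p * (\<Sum>i\<in>I. W i * (1 + f i p))"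
      using * assms(4) by (intro ballI mult_left_mono) (auto intro: less_imp_le)
    show "\<exists>p\<in>Q. w p * ((1 + \<epsilon>) * sum W I) < w p * (\<Sum>i\<in>I. W i * (1 + f i p))"
      using *[OF q(1)] q by (intro bexI[of _ q] mult_strict_left_mono) auto
  qed
  also have "\<dots> = (\<Sum>i\<in>I. W i * (sum w Q + (\<Sum>p\<in>Q. w p * f i p)))"
    unfolding sum_distrib_left sum.distrib[symmetric]
    by (subst sum.swap) (simp add: algebra_simps)
  also have "\<dots> \<le> (\<Sum>i\<in>I. W i * ((1 + \<epsilon>) * sum w Q))"
  proof (intro sum_mono mult_left_mono)
    fix i assume "i \<in> I"
    then show "sum w Q + (\<Sum>p\<in>Q. w p * f i p) \<le> (1 + \<epsilon>) * sum w Q"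
      using avg[of i] by (simp add: distrib_right)
  qed (use assms in auto)
  also have "\<dots> = sum w Q * ((1 + \<epsilon>) * sum W I)"
    unfolding sum_distrib_right[symmetric] by (simp add: mult_ac)
  finally show False by simp
qed

text \<open>The averaging hypothesis is required for every removed set of size at most K, so it
  survives the removal of each chosen prime.\<close>

lemma greedy_set:
  fixes W :: "'i \<Rightarrow> real" and w :: "'p \<Rightarrow> real"
  assumes I: "finite I" "\<And>i. i \<in> I \<Longrightarrow> 0 \<le> W i" and P: "finite P" "\<And>p. p \<in> P \<Longrightarrow> 0 \<le> w p" 
    and f: "\<And>i p. \<bar>f i p\<bar> \<le> 1" and "0 \<le> \<epsilon>"
    and pos: "\<And>U. finite U \<Longrightarrow> card U \<le> K \<Longrightarrow> 0 < sum w (P - U)"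
    and avg: "\<And>U i. finite U \<Longrightarrow> card U \<le> K \<Longrightarrow> i \<in> I \<Longrightarrow>
      (\<Sum>p\<in>P - U. w p * f i p) \<le> \<epsilon> * sum w (P - U)"
    and U: "finite U" "card U + k \<le> K"
  shows "\<exists>S. S \<subseteq> P - U \<and> card S = k \<and>
    (\<Sum>i\<in>I. W i * (\<Prod>p\<in>S. 1 + f i p)) \<le> (1 + \<epsilon>) ^ k * sum W I"
  using U(2)
proof (induction k)
  case 0
  then show ?case by (intro exI[of _ "{}"]) auto
next
  case (Suc k)
  then obtain S where S: "S \<subseteq> P - U" "card S = k"
    "(\<Sum>i\<in>I. W i * (\<Prod>p\<in>S. 1 + f i p)) \<le> (1 + \<epsilon>) ^ k * sum W I" by auto
  have finS: "finite S" using S(1) P(1) finite_subset by blast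
  have c: "card (U \<union> S) \<le> K" using card_Un_le[of U S] S(2) Suc.prems by linarith
  have nn: "0 \<le> W i * (\<Prod>p\<in>S. 1 + f i p)" if "i \<in> I" for i
  proof (intro mult_nonneg_nonneg prod_nonneg ballI)
    show "0 \<le> 1 + f i p" for p using f[of i p] by linarith
  qed (use I that in auto)
  have "\<exists>p\<in>P - (U \<union> S). (\<Sum>i\<in>I. (W i * (\<Prod>p\<in>S. 1 + f i p)) * (1 + f i p))
     \<le> (1 + \<epsilon>) * (\<Sum>i\<in>I. W i * (\<Prod>p\<in>S. 1 + f i p))"
    by (rule greedy_step[where w = w]) (use I P nn pos avg c finS U in auto)
  then obtain p where p: "p \<in> P - (U \<union> S)" "(\<Sum>i\<in>I. (W i * (\<Prod>p\<in>S. 1 + f i p)) * (1 + f i p))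
     \<le> (1 + \<epsilon>) * (\<Sum>i\<in>I. W i * (\<Prod>p\<in>S. 1 + f i p))" by auto
  have "(\<Sum>i\<in>I. W i * (\<Prod>p\<in>insert p S. 1 + f i p)) = (\<Sum>i\<in>I. (W i * (\<Prod>p\<in>S. 1 + f i p)) * (1 + f i p))"
    using p finS by (simp add: mult_ac)
  also note p(2)
  also have "(1 + \<epsilon>) * (\<Sum>i\<in>I. W i * (\<Prod>p\<in>S. 1 + f i p)) \<le> (1 + \<epsilon>) * ((1 + \<epsilon>) ^ k * sum W I)"
    using S(3) \<open>0 \<le> \<epsilon>\<close> by (intro mult_left_mono) auto
  finally have a3: "(\<Sum>i\<in>I. W i * (\<Prod>p\<in>insert p S. 1 + f i p)) \<le> (1 + \<epsilon>) ^ Suc k * sum W I"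
    by (simp only: power_Suc mult.assoc)
  have a1: "insert p S \<subseteq> P - U" using p(1) S(1) by blast
  have "p \<notin> S" using p(1) by blast
  then have a2: "card (insert p S) = Suc k" using card_insert_disjoint[OF finS] S(2) by metis
  show ?case by (rule exI[of _ "insert p S"]) (intro conjI a1 a2 a3)
qed

text \<open>Each set starts afresh from the weights \<open>W\<close>; the sets influence one another
  only through disjointness. Hence the potential grows by the k-th power, not by the (k *
  l)-th.\<close>

lemma greedy_family:
  fixes W :: "'i \<Rightarrow> real" and w :: "'p \<Rightarrow> real"
  assumes I: "finite I" "\<And>i. i \<in> I \<Longrightarrow> 0 \<le> W i" and P: "finite P" "\<And>p. p \<in> P \<Longrightarrow> 0 \<le> w p" 
    and f: "\<And>i p. \<bar>f i p\<bar> \<le> 1" and "0 \<le> \<epsilon>"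
    and pos: "\<And>U. finite U \<Longrightarrow> card U \<le> k * L \<Longrightarrow> 0 < sum w (P - U)"
    and avg: "\<And>U i. finite U \<Longrightarrow> card U \<le> k * L \<Longrightarrow> i \<in> I \<Longrightarrow>
      (\<Sum>p\<in>P - U. w p * f i p) \<le> \<epsilon> * sum w (P - U)"
    and "l \<le> L"
  shows "\<exists>S. (\<forall>j<l. S j \<subseteq> P \<and> card (S j) = k \<and>
    (\<Sum>i\<in>I. W i * (\<Prod>p\<in>S j. 1 + f i p)) \<le> (1 + \<epsilon>) ^ k * sum W I) \<and>
    (\<forall>j<l. \<forall>j'<l. j \<noteq> j' \<longrightarrow> S j \<inter> S j' = {})"
  using \<open>l \<le> L\<close>
proof (induction l)
  case (Suc l)
  have "l \<le> L" using Suc.prems by simp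
  from Suc.IH[OF this] obtain S where SS: "\<forall>j<l. S j \<subseteq> P \<and> card (S j) = k \<and>
    (\<Sum>i\<in>I. W i * (\<Prod>p\<in>S j. 1 + f i p)) \<le> (1 + \<epsilon>) ^ k * sum W I"
    "\<forall>j<l. \<forall>j'<l. j \<noteq> j' \<longrightarrow> S j \<inter> S j' = {}" by (elim exE conjE)
  have S: "S j \<subseteq> P \<and> card (S j) = k" if "j < l" for j using SS(1) that by simp
  define U where "U = (\<Union>j<l. S j)"
  have finU: "finite U" unfolding U_def using S P(1) by (auto intro: finite_subset)
  have "card U \<le> (\<Sum>j<l. card (S j))" unfolding U_def by (rule card_UN_le) simp
  also have "\<dots> = k * l" using S by simp
  finally have "card U + k \<le> k * Suc l" by simp
  also have "\<dots> \<le> k * L" using Suc.prems by (intro mult_left_mono) auto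
  finally have "card U + k \<le> k * L" .
  then have "\<exists>A. A \<subseteq> P - U \<and> card A = k \<and>
    (\<Sum>i\<in>I. W i * (\<Prod>p\<in>A. 1 + f i p)) \<le> (1 + \<epsilon>) ^ k * sum W I"
    by (intro greedy_set[where K = "k * L" and w = w] I P f pos avg finU \<open>0 \<le> \<epsilon>\<close>)
  then obtain A where A: "A \<subseteq> P - U" "card A = k"
    "(\<Sum>i\<in>I. W i * (\<Prod>p\<in>A. 1 + f i p)) \<le> (1 + \<epsilon>) ^ k * sum W I" by auto
  have disj: "A \<inter> S j = {}" if "j < l" for j using A(1) that by (auto simp: U_def)
  show ?case
  proof (intro exI[of _ "S(l := A)"] conjI allI impI)
    fix j assume j: "j < Suc l"
    show "(S(l := A)) j \<subseteq> P" "card ((S(l := A)) j) = k" using S[of j] A(1,2) j by (auto simp: less_Suc_eq)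
    show "(\<Sum>i\<in>I. W i * (\<Prod>p\<in>(S(l := A)) j. 1 + f i p)) \<le> (1 + \<epsilon>) ^ k * sum W I"
      using SS(1) A(3) j by (cases "j = l") auto
    fix j' assume "j' < Suc l" "j \<noteq> j'"
    then show "(S(l := A)) j \<inter> (S(l := A)) j' = {}"
      using SS(2)[rule_format, of j j'] disj[of j] disj[of j'] j
      by (cases "j = l"; cases "j' = l") (simp_all add: Int_commute)
  qed
qed auto

section \<open>Weights of pairs and the covering sets\<close>

lemma pair_tail:
  assumes "M \<ge> 1"
  shows "(\<Sum>(b,d) | b \<in> {1..N} \<and> d \<in> {1..N} \<and> M < max b d. (real b * real d) powr (-5/4))
    \<le> 40 * real M powr (-1/4)"
proof -
  define g where "g = (\<lambda>b. real b powr (-5/4))"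
  have prod: "(\<Sum>(b,d)\<in>X \<times> Y. (real b * real d) powr (-5/4)) = sum g X * sum g Y" for X Y
    by (simp add: g_def sum_product sum.cartesian_product powr_mult)
  have "{(b,d). b \<in> {1..N} \<and> d \<in> {1..N} \<and> M < max b d} = {M<..N} \<times> {1..N} \<union> {1..N} \<times> {M<..N}"
    by auto
  then have "(\<Sum>(b,d) | b \<in> {1..N} \<and> d \<in> {1..N} \<and> M < max b d. (real b * real d) powr (-5/4))
    = (\<Sum>(b,d)\<in>{M<..N} \<times> {1..N} \<union> {1..N} \<times> {M<..N}. (real b * real d) powr (-5/4))" by simp
  also have "\<dots> \<le> sum g {M<..N} * sum g {1..N} + sum g {1..N} * sum g {M<..N}"
    unfolding prod[symmetric] by (rule sum_Un_le) auto
  also have "\<dots> = 2 * (sum g {M<..N} * sum g {1..N})" by simp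
  also have "\<dots> \<le> 2 * (4 * real M powr (-1/4) * 5)"
    using sum_powr_tail[OF assms, of N] sum_powr_all[of N]
    by (intro mult_left_mono mult_mono) (auto simp: g_def intro!: sum_nonneg)
  finally show ?thesis by simp
qed

lemma abs_split_sign: "\<bar>split_sign e p\<bar> \<le> 1"
  by (simp add: split_sign_def)

lemma prod_split_sign: "(\<Prod>p\<in>S. 1 + split_sign e p) = 0 \<or> (\<Prod>p\<in>S. 1 + split_sign e p) = 2 ^ card S"
proof (cases "\<exists>p\<in>S. split_sign e p = - 1")
  case False
  then have "(\<Prod>p\<in>S. 1 + split_sign e p) = (\<Prod>p\<in>S. 2)"
    by (intro prod.cong) (auto simp: split_sign_def split: if_splits)
  then show ?thesis by simp
next
  case True
  then show ?thesis by (cases "finite S") (force simp: prod_zero_iff)+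
qed

text \<open>The weight \<open>2\<^sup>-\<^sup>8\<^sup>1\<^sup>s\<close> of the pairs with \<open>b, d \<le> 2\<^sup>3\<^sup>6\<^sup>s\<close> is so large that a single surviving pair, which
  carries the factor \<open>2\<^sup>8\<^sup>0\<^sup>s\<close>, would exceed the bound for the whole potential.\<close>

lemma covering_primes:
  assumes s: "s \<ge> 4"
  shows "\<exists>S :: nat \<Rightarrow> nat set.
    (\<forall>j<2 ^ (4 * s). S j \<subseteq> {p. prime p \<and> 2 ^ (16 * s) < p \<and> p \<le> 2 ^ (200000 * s)} \<and> card (S j) = 80 * s \<and>
       (\<forall>b\<in>{1..2 ^ (36 * s)}. \<forall>d\<in>{1..2 ^ (36 * s)}. (\<Prod>p\<in>S j. 1 + split_sign (b * d) p) = 0) \<and>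
       (\<Sum>(b,d) | b \<in> {1..2 ^ (340 * s)} \<and> d \<in> {1..2 ^ (340 * s)} \<and> 2 ^ (36 * s) < max b d.
          (real b * real d) powr (-5/4) * (\<Prod>p\<in>S j. 1 + split_sign (b * d) p)) \<le> 41 / 2 ^ (5 * s)) \<and>
    (\<forall>j<2 ^ (4 * s). \<forall>j'<2 ^ (4 * s). j \<noteq> j' \<longrightarrow> S j \<inter> S j' = {})"
proof -
  define B T :: nat where "B = 2 ^ (36 * s)" and "T = 2 ^ (340 * s)"
  define P where "P = {p. prime p \<and> 2 ^ (16 * s) < p \<and> p \<le> (2::nat) ^ (200000 * s)}"
  define I where "I = {1..T} \<times> {1..T}"
  define W :: "nat \<times> nat \<Rightarrow> real" where
    "W = (\<lambda>(b,d). if max b d \<le> B then 1 / 2 ^ (81 * s) else (real b * real d) powr (-5/4))"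
  define w where "w = (\<lambda>p. ln (real p) / real p)"
  define f where "f = (\<lambda>(b,d) p. split_sign (b * d) p)"
  have BT: "B \<le> T" by (auto simp: B_def T_def)
  have finP: "finite P" unfolding P_def by (rule finite_subset[of _ "{..2 ^ (200000 * s)}"]) auto
  have W0: "0 \<le> W i" for i by (auto simp: W_def split: prod.splits)
  \<comment> \<open>The two kinds of pairs are balanced: the \<open>2^(72*s)\<close> small ones
    weigh \<open>2^(-81*s)\<close> each, and the tail beyond \<open>B\<close> weighs at most
    \<open>40 * B^(-1/4) = 40 * 2^(-9*s)\<close>.\<close>
  have sumW: "sum W I \<le> 41 / 2 ^ (9 * s)"
  proof -
    have "I = {1..B} \<times> {1..B} \<union> {(b,d). b \<in> {1..T} \<and> d \<in> {1..T} \<and> B < max b d}"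
      using BT by (auto simp: I_def)
    then have "sum W I = sum W ({1..B} \<times> {1..B} \<union> {(b,d). b \<in> {1..T} \<and> d \<in> {1..T} \<and> B < max b d})"
      by simp
    also have "\<dots> \<le> sum W ({1..B} \<times> {1..B}) + sum W {(b,d). b \<in> {1..T} \<and> d \<in> {1..T} \<and> B < max b d}"
      using W0 by (intro sum_Un_le) (auto intro: finite_subset[of _ "{1..T} \<times> {1..T}"])
    also have "sum W ({1..B} \<times> {1..B}) = (\<Sum>i\<in>{1..B} \<times> {1..B}. 1 / 2 ^ (81 * s))"
      by (intro sum.cong) (auto simp: W_def)
    also have "\<dots> = 2 ^ (72 * s) / 2 ^ (81 * s)" by (simp add: B_def flip: power_add)
    also have "\<dots> = 1 / 2 ^ (9 * s)" by (simp add: field_simps flip: power_add)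
    also have "sum W {(b,d). b \<in> {1..T} \<and> d \<in> {1..T} \<and> B < max b d}
        = (\<Sum>(b,d) | b \<in> {1..T} \<and> d \<in> {1..T} \<and> B < max b d. (real b * real d) powr (-5/4))"
      by (intro sum.cong) (auto simp: W_def)
    also have "\<dots> \<le> 40 * real B powr (-1/4)" by (rule pair_tail) (simp add: B_def)
    also have "real B powr (-1/4) = 1 / 2 ^ (9 * s)"
    proof -
      have "real B = 2 powr (36 * real s)" by (simp add: B_def powr_realpow[symmetric])
      then have "real B powr (-1/4) = 2 powr (- real (9 * s))" by (simp add: powr_powr)
      then show ?thesis by (simp only: powr_minus powr_realpow zero_less_numeral inverse_eq_divide)
    qed
    finally show ?thesis by simp
  qed
  have "\<exists>S :: nat \<Rightarrow> nat set. (\<forall>j<2 ^ (4 * s). S j \<subseteq> P \<and> card (S j) = 80 * s \<and>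
    (\<Sum>i\<in>I. W i * (\<Prod>p\<in>S j. 1 + f i p)) \<le> (1 + 1 / 32) ^ (80 * s) * sum W I) \<and>
    (\<forall>j<2 ^ (4 * s). \<forall>j'<2 ^ (4 * s). j \<noteq> j' \<longrightarrow> S j \<inter> S j' = {})"
  proof (rule greedy_family[where w = w and L = "2 ^ (4 * s)"])
    show "finite I" by (simp add: I_def)
    show "0 \<le> w p" if "p \<in> P" for p using that prime_ge_1_nat by (auto simp: P_def w_def)
    show "\<bar>f i p\<bar> \<le> 1" for i p using abs_split_sign by (auto simp: f_def split: prod.splits)
    show "0 < sum w (P - U)" if "finite U" "card U \<le> 80 * s * 2 ^ (4 * s)" for U
      unfolding w_def P_def using split_sign_average(2)[OF s _ _ that, of 1] by simp
    show "(\<Sum>p\<in>P - U. w p * f i p) \<le> 1 / 32 * sum w (P - U)"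
      if "finite U" "card U \<le> 80 * s * 2 ^ (4 * s)" "i \<in> I" for U i
    proof -
      have "i \<in> I" by (rule that)
      then obtain b d where i: "i = (b, d)" "b \<in> {1..T}" "d \<in> {1..T}" by (cases i) (auto simp: I_def)
      have "b * d \<le> T * T" using i by (intro mult_mono) auto
      also have "T * T = 2 ^ (680 * s)" by (simp add: T_def flip: power_add)
      finally have "b * d \<le> 2 ^ (680 * s)" .
      then show ?thesis unfolding w_def P_def i f_def
        using split_sign_average(1)[OF s _ _ that(1,2), of "b * d"] i by simp
    qed
  qed (use W0 finP in auto)
  then obtain S :: "nat \<Rightarrow> nat set" where S: "\<And>j. j < 2 ^ (4 * s) \<Longrightarrow> S j \<subseteq> P \<and> card (S j) = 80 * s \<and>
    (\<Sum>i\<in>I. W i * (\<Prod>p\<in>S j. 1 + f i p)) \<le> (1 + 1 / 32) ^ (80 * s) * sum W I"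
    "\<forall>j<2 ^ (4 * s). \<forall>j'<2 ^ (4 * s). j \<noteq> j' \<longrightarrow> S j \<inter> S j' = {}" by blast
  have bound: "(1 + 1 / 32) ^ (80 * s) * sum W I \<le> 41 / 2 ^ (5 * s)"
  proof -
    \<comment> \<open>(33/32)^20 \<le> 2, and 80s = 20 * 4s.\<close>
    have "((1 + 1 / 32 :: real) ^ 20) ^ (4 * s) \<le> 2 ^ (4 * s)"
      by (rule power_mono) (simp_all add: power_divide)
    then have "(1 + 1 / 32 :: real) ^ (80 * s) \<le> 2 ^ (4 * s)" by (simp flip: power_mult)
    then have "(1 + 1 / 32) ^ (80 * s) * sum W I \<le> 2 ^ (4 * s) * (41 / 2 ^ (9 * s))"
      using sumW W0 by (intro mult_mono) (auto intro: sum_nonneg)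
    also have "\<dots> = 41 / 2 ^ (5 * s)" by (simp add: field_simps flip: power_add)
    finally show ?thesis .
  qed
  have nn: "0 \<le> (\<Prod>p\<in>A. 1 + f i p)" for A i
    by (intro prod_nonneg) (auto simp: f_def split_sign_def split: prod.splits)
  have main: "(\<Sum>i\<in>J. W i * (\<Prod>p\<in>S j. 1 + f i p)) \<le> 41 / 2 ^ (5 * s)" if "j < 2 ^ (4 * s)" "J \<subseteq> I" for j J
  proof -
    have "(\<Sum>i\<in>J. W i * (\<Prod>p\<in>S j. 1 + f i p)) \<le> (\<Sum>i\<in>I. W i * (\<Prod>p\<in>S j. 1 + f i p))"
      using that W0 nn by (intro sum_mono2) (auto simp: I_def)
    then show ?thesis using S(1)[OF that(1)] bound by linarith
  qed
  have cov: "(\<Prod>p\<in>S j. 1 + split_sign (b * d) p) = 0"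
    if j: "j < 2 ^ (4 * s)" and bd: "b \<in> {1..B}" "d \<in> {1..B}" for j b d
  proof (rule ccontr)
    assume "\<not> ?thesis"
    then have "(\<Prod>p\<in>S j. 1 + f (b,d) p) = 2 ^ (80 * s)"
      using prod_split_sign[where S = "S j"] S(1)[OF j] by (auto simp: f_def)
    then have "W (b,d) * 2 ^ (80 * s) \<le> 41 / 2 ^ (5 * s)"
      using main[OF j, of "{(b,d)}"] bd BT by (auto simp: I_def)
    moreover have "W (b,d) = 1 / 2 ^ (81 * s)" using bd by (simp add: W_def)
    ultimately have "2 ^ (80 * s) * 2 ^ (5 * s) \<le> 41 * (2::real) ^ (81 * s)" by (simp add: field_simps)
    also have "\<dots> < 2 ^ (4 * s) * 2 ^ (81 * s)"
    proof (rule mult_strict_right_mono)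
      have "(41::real) < 2 ^ (4 * 2)" by simp
      also have "\<dots> \<le> 2 ^ (4 * s)" using s by (intro power_increasing) auto
      finally show "(41::real) < 2 ^ (4 * s)" .
    qed simp
    finally show False by (simp flip: power_add)
  qed
  have tail: "(\<Sum>(b,d) | b \<in> {1..T} \<and> d \<in> {1..T} \<and> B < max b d.
          (real b * real d) powr (-5/4) * (\<Prod>p\<in>S j. 1 + split_sign (b * d) p)) \<le> 41 / 2 ^ (5 * s)"
    if j: "j < 2 ^ (4 * s)" for j
  proof -
    have "(\<Sum>(b,d) | b \<in> {1..T} \<and> d \<in> {1..T} \<and> B < max b d.
          (real b * real d) powr (-5/4) * (\<Prod>p\<in>S j. 1 + split_sign (b * d) p))
      = (\<Sum>i\<in>{(b,d). b \<in> {1..T} \<and> d \<in> {1..T} \<and> B < max b d}. W i * (\<Prod>p\<in>S j. 1 + f i p))"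
      by (intro sum.cong) (auto simp: W_def f_def)
    also have "\<dots> \<le> 41 / 2 ^ (5 * s)" by (rule main[OF j]) (auto simp: I_def)
    finally show ?thesis .
  qed
  show ?thesis
  proof (intro exI[of _ S] conjI allI impI)
    fix j :: nat assume j: "j < 2 ^ (4 * s)"
    show "S j \<subseteq> {p. prime p \<and> 2 ^ (16 * s) < p \<and> p \<le> 2 ^ (200000 * s)}" "card (S j) = 80 * s"
      using S(1)[OF j] by (simp_all add: P_def)
    show "\<forall>b\<in>{1..2 ^ (36 * s)}. \<forall>d\<in>{1..2 ^ (36 * s)}. (\<Prod>p\<in>S j. 1 + split_sign (b * d) p) = 0"
      using cov[OF j] unfolding B_def by blast
    show "(\<Sum>(b,d) | b \<in> {1..2 ^ (340 * s)} \<and> d \<in> {1..2 ^ (340 * s)} \<and> 2 ^ (36 * s) < max b d.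
          (real b * real d) powr (-5/4) * (\<Prod>p\<in>S j. 1 + split_sign (b * d) p)) \<le> 41 / 2 ^ (5 * s)"
      using tail[OF j] unfolding B_def T_def .
  next
    fix j j' :: nat assume "j < 2 ^ (4 * s)" "j' < 2 ^ (4 * s)" "j \<noteq> j'"
    then show "S j \<inter> S j' = {}" using S(2) by blast
  qed
qed

section \<open>Representations in a residue class\<close>

definition conic_points :: "nat \<Rightarrow> nat \<Rightarrow> nat \<Rightarrow> nat \<Rightarrow> (nat \<times> nat) set" where
  "conic_points n \<alpha> \<gamma> r = {(a,c). a < n \<and> c < n \<and> [\<alpha> * a\<^sup>2 + \<gamma> * c\<^sup>2 = r] (mod n)}"

lemma finite_conic [simp]: "finite (conic_points n \<alpha> \<gamma> r)"
  by (rule finite_subset[of _ "{..<n} \<times> {..<n}"]) (auto simp: conic_points_def)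

lemma conic_int:
  "(a,c) \<in> conic_points n \<alpha> \<gamma> r \<longleftrightarrow> a < n \<and> c < n \<and>
     int n dvd int \<alpha> * int a ^ 2 + int \<gamma> * int c ^ 2 - int r"
proof -
  have "[\<alpha> * a\<^sup>2 + \<gamma> * c\<^sup>2 = r] (mod n) \<longleftrightarrow> [int (\<alpha> * a\<^sup>2 + \<gamma> * c\<^sup>2) = int r] (mod int n)"
    by (rule cong_int_iff[symmetric])
  then show ?thesis by (auto simp: conic_points_def cong_iff_dvd_diff)
qed

lemma conic_swap: "card (conic_points n \<alpha> \<gamma> r) = card (conic_points n \<gamma> \<alpha> r)"
  by (rule bij_betw_same_card[of "\<lambda>(a,c). (c,a)"])
     (auto simp: bij_betw_def conic_points_def inj_on_def add.commute image_iff)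

lemma dvd_diff_nat_eq:
  assumes "int p dvd int a - int b" "a < p" "b < p"
  shows "a = b"
  using assms by (metis cong_iff_dvd_diff cong_int_iff cong_less_modulus_unique_nat)

lemma square_root_cases:
  assumes "prime p" "\<not> p dvd \<gamma>" "int p dvd int \<gamma> * int c ^ 2 - int \<gamma> * int c' ^ 2"
  shows "int p dvd int c - int c' \<or> int p dvd int c + int c'"
proof -
  have "int \<gamma> * int c ^ 2 - int \<gamma> * int c' ^ 2 = int \<gamma> * ((int c - int c') * (int c + int c'))"
    by (simp add: algebra_simps power2_eq_square)
  then have "int p dvd int \<gamma> * ((int c - int c') * (int c + int c'))" using assms(3) by simp
  then show ?thesis using assms by (simp add: prime_dvd_mult_iff)
qed

lemma card_roots_le_2:
  assumes "prime p" "\<not> p dvd \<gamma>"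
  shows "card {c. c < p \<and> int p dvd int \<alpha> * int a ^ 2 + int \<gamma> * int c ^ 2 - int r} \<le> 2"
proof (cases "{c. c < p \<and> int p dvd int \<alpha> * int a ^ 2 + int \<gamma> * int c ^ 2 - int r} = {}")
  case False
  then obtain c0 where c0: "c0 < p" "int p dvd int \<alpha> * int a ^ 2 + int \<gamma> * int c0 ^ 2 - int r" by auto
  \<comment> \<open>The reduction modulo p is for c0 = 0, where p - c0 would leave the range of
    residues.\<close>
  have "{c. c < p \<and> int p dvd int \<alpha> * int a ^ 2 + int \<gamma> * int c ^ 2 - int r} \<subseteq> {c0, (p - c0) mod p}"
  proof
    fix c assume "c \<in> {c. c < p \<and> int p dvd int \<alpha> * int a ^ 2 + int \<gamma> * int c ^ 2 - int r}"
    then have c: "c < p" "int p dvd int \<alpha> * int a ^ 2 + int \<gamma> * int c ^ 2 - int r" by auto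
    have "int p dvd int \<gamma> * int c ^ 2 - int \<gamma> * int c0 ^ 2"
      using dvd_diff[OF c(2) c0(2)] by simp
    then consider "int p dvd int c - int c0" | "int p dvd int c + int c0"
      using square_root_cases[OF assms] by blast
    then show "c \<in> {c0, (p - c0) mod p}"
    proof cases
      case 1
      then show ?thesis using dvd_diff_nat_eq c(1) c0(1) by blast
    next
      case 2
      have "int p dvd int c - int (p - c0)" using 2 c0(1) 
        by (metis (no_types, opaque_lifting) add_diff_eq diff_diff_eq2 dvd_diff dvd_refl less_imp_le of_nat_diff)
      then have "c mod p = (p - c0) mod p" by (metis cong_def cong_iff_dvd_diff cong_int_iff)
      then show ?thesis using c(1) by simp
    qed
  qed
  then have "card {c. c < p \<and> int p dvd int \<alpha> * int a ^ 2 + int \<gamma> * int c ^ 2 - int r}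
      \<le> card {c0, (p - c0) mod p}" by (rule card_mono[rotated]) simp
  also have "\<dots> \<le> 2" by (simp add: card_insert_if)
  finally show ?thesis .
next
  case True
  then show ?thesis by (simp only: card.empty)
qed

text \<open>For each value of one coordinate there are at most two of the other. This also covers p
  dividing r or one of the two coefficients, at the price of a factor 2.\<close>

lemma card_conic_le_double:
  assumes "prime p" "\<not> p dvd \<gamma> \<or> \<not> p dvd \<alpha>"
  shows "card (conic_points p \<alpha> \<gamma> r) \<le> 2 * p"
proof -
  have *: "card (conic_points p \<alpha> \<gamma> r) \<le> 2 * p" if "\<not> p dvd \<gamma>" for \<alpha> \<gamma>
  proof -
    have "conic_points p \<alpha> \<gamma> r = (SIGMA a:{..<p}. {c. c < p \<and> int p dvd int \<alpha> * int a ^ 2 + int \<gamma> * int c ^ 2 - int r})"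
      by (auto simp: conic_int)
    then have "card (conic_points p \<alpha> \<gamma> r)
        = (\<Sum>a<p. card {c. c < p \<and> int p dvd int \<alpha> * int a ^ 2 + int \<gamma> * int c ^ 2 - int r})"
      by simp
    also have "\<dots> \<le> (\<Sum>a<p. 2)" by (rule sum_mono) (rule card_roots_le_2[OF assms(1) that])
    finally show ?thesis by simp
  qed
  show ?thesis using assms(2) *[of \<gamma> \<alpha>] *[of \<alpha> \<gamma>] conic_swap by metis
qed

text \<open>Project the conic from one of its points: every line through that point meets it in at most
  one further point, and there are at most \<open>p + 1\<close> lines.\<close>

lemma card_conic_le:
  assumes p: "prime p" "2 < p" and nd: "\<not> p dvd \<alpha>" "\<not> p dvd \<gamma>" "\<not> p dvd r"
  shows "card (conic_points p \<alpha> \<gamma> r) \<le> p + 2"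
proof (cases "conic_points p \<alpha> \<gamma> r = {}")
  case False
  then obtain a0 c0 where 0: "(a0, c0) \<in> conic_points p \<alpha> \<gamma> r" by auto
  have h0: "int p dvd int \<alpha> * int a0 ^ 2 + int \<gamma> * int c0 ^ 2 - int r"
    using 0 by (simp add: conic_int)
  \<comment> \<open>The vertical line through the base point, which has no slope, is counted
    separately.\<close>
  define A where "A = {(a,c) \<in> conic_points p \<alpha> \<gamma> r. a = a0}"
  define D where "D = {(a,c) \<in> conic_points p \<alpha> \<gamma> r. a \<noteq> a0}"
  have "card A \<le> card {c. c < p \<and> int p dvd int \<alpha> * int a0 ^ 2 + int \<gamma> * int c ^ 2 - int r}"
    by (rule card_inj_on_le[of snd]) (auto simp: A_def inj_on_def conic_int)
  also have "\<dots> \<le> 2" by (rule card_roots_le_2[OF p(1) nd(2)])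
  finally have A: "card A \<le> 2" .
  have ex: "\<exists>k<p. int p dvd (int c - int c0) - int k * (int a - int a0)" if "(a,c) \<in> D" for a c
  proof -
    have "a \<noteq> a0" "a < p" "a0 < p" using that 0 by (auto simp: D_def conic_points_def)
    then have "\<not> int p dvd int a - int a0" using dvd_diff_nat_eq by blast
    then have "coprime (int a - int a0) (int p)" using p(1)
      by (metis coprime_commute prime_imp_coprime prime_int_nat_transfer prime_nat_int_transfer)
    then obtain x where x: "[(int a - int a0) * x = 1] (mod int p)" using cong_solve_coprime_int by blast
    define k where "k = nat ((x * (int c - int c0)) mod int p)"
    have "int k = (x * (int c - int c0)) mod int p" using p by (simp add: k_def)
    then have "[int k = x * (int c - int c0)] (mod int p)" by (simp add: cong_def)
    then have "[int k * (int a - int a0) = x * (int c - int c0) * (int a - int a0)] (mod int p)"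
      by (rule cong_scalar_right)
    also have "x * (int c - int c0) * (int a - int a0) = ((int a - int a0) * x) * (int c - int c0)" by simp
    also have "[\<dots> = 1 * (int c - int c0)] (mod int p)" by (rule cong_scalar_right[OF x])
    finally have "int p dvd (int c - int c0) - int k * (int a - int a0)"
      by (metis cong_iff_dvd_diff cong_sym mult_1)
    moreover have "k < p" using p by (simp add: k_def nat_less_iff)
    ultimately show ?thesis by blast
  qed
  define sl where "sl = (\<lambda>(a,c). SOME k. k < p \<and> int p dvd (int c - int c0) - int k * (int a - int a0))"
  have sl: "sl (a,c) < p \<and> int p dvd (int c - int c0) - int (sl (a,c)) * (int a - int a0)" if "(a,c) \<in> D" for a c
    unfolding sl_def prod.case using someI_ex[OF ex[OF that]] by simp
  \<comment> \<open>On the line of slope k the difference of the two conic equations is divisible by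
    a - a0; dividing it out leaves a linear equation for a - a0.\<close>
  have key: "int p dvd (int a - int a0) * (int \<alpha> + int \<gamma> * int k ^ 2) + 2 * (int \<alpha> * int a0 + int \<gamma> * int c0 * int k)"
    if "(a,c) \<in> D" "k = sl (a,c)" for a c k
  proof -
    have h1: "int p dvd int \<alpha> * int a ^ 2 + int \<gamma> * int c ^ 2 - int r"
      using that(1) by (simp add: D_def conic_int)
    define t where "t = int a - int a0"
    have k: "k = sl (a,c)" and acD: "(a,c) \<in> D" by (rule that)+
    obtain q where q: "int c - int c0 - int k * t = int p * q" using sl[OF acD] unfolding k by (auto simp: t_def)
    have at: "int a = int a0 + t" "int c = int c0 + int k * t + int p * q" using q by (auto simp: t_def)
    have "int p dvd (int \<alpha> * int a ^ 2 + int \<gamma> * int c ^ 2 - int r) - (int \<alpha> * int a0 ^ 2 + int \<gamma> * int c0 ^ 2 - int r)"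
      using dvd_diff[OF h1 h0] .
    also have "(int \<alpha> * int a ^ 2 + int \<gamma> * int c ^ 2 - int r) - (int \<alpha> * int a0 ^ 2 + int \<gamma> * int c0 ^ 2 - int r)
      = t * (t * (int \<alpha> + int \<gamma> * int k ^ 2) + 2 * (int \<alpha> * int a0 + int \<gamma> * int c0 * int k))
        + int p * (int \<gamma> * (2 * q * (int c0 + int k * t) + int p * q ^ 2))"
      unfolding at by (simp add: algebra_simps power2_eq_square)
    finally have "int p dvd t * (t * (int \<alpha> + int \<gamma> * int k ^ 2) + 2 * (int \<alpha> * int a0 + int \<gamma> * int c0 * int k))"
      by (simp add: dvd_add_left_iff)
    moreover have "\<not> int p dvd t"
    proof
      assume "int p dvd t"
      moreover have "a < p" "a0 < p" "a \<noteq> a0" using that 0 by (auto simp: D_def conic_points_def)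
      ultimately show False unfolding t_def using dvd_diff_nat_eq by blast
    qed
    ultimately show ?thesis using p(1) by (simp add: prime_dvd_mult_iff t_def)
  qed
  have "inj_on sl D"
  proof (rule inj_onI)
    fix x y assume xy: "x \<in> D" "y \<in> D" "sl x = sl y"
    obtain a c a' c' where x: "x = (a,c)" and y: "y = (a',c')" by (cases x, cases y)
    define k where "k = sl x"
    have k: "k = sl (a,c)" "k = sl (a',c')" using xy by (auto simp: k_def x y)
    have lt: "a < p" "a' < p" "c < p" "c' < p" using xy by (auto simp: x y D_def conic_points_def)
    have "int p dvd (int a - int a') * (int \<alpha> + int \<gamma> * int k ^ 2)"
      using dvd_diff[OF key[OF _ k(1)] key[OF _ k(2)]] xy by (simp add: x y algebra_simps)
    moreover have "\<not> int p dvd int \<alpha> + int \<gamma> * int k ^ 2"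
    proof
      assume E1: "int p dvd int \<alpha> + int \<gamma> * int k ^ 2"
      then have "int p dvd 2 * (int \<alpha> * int a0 + int \<gamma> * int c0 * int k)"
        using key[OF _ k(1)] xy by (simp add: x dvd_add_right_iff)
      moreover have "\<not> int p dvd 2" using p zdvd_imp_le[of "int p" 2] by auto
      moreover have "prime (int p)" using p(1) by simp
      ultimately have E2: "int p dvd int \<alpha> * int a0 + int \<gamma> * int c0 * int k"
        using prime_dvd_mult_iff by blast
      \<comment> \<open>If the linear equation degenerated, both of its coefficients would vanish
        modulo p. This combination of them with the equation of the base point equals \<alpha> * r,
        which is prime to p.\<close>
      have "int p dvd (int \<alpha> * int a0 + int \<gamma> * int c0 * int k) * (int \<alpha> * int a0 - int \<gamma> * int c0 * int k)
          + int \<gamma> * int c0 ^ 2 * (int \<alpha> + int \<gamma> * int k ^ 2)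
          - int \<alpha> * (int \<alpha> * int a0 ^ 2 + int \<gamma> * int c0 ^ 2 - int r)"
        by (intro dvd_diff[OF dvd_add[OF dvd_mult2[OF E2] dvd_mult[OF E1]] dvd_mult[OF h0]])
      also have "\<dots> = int (\<alpha> * r)" by (simp add: algebra_simps power2_eq_square)
      finally have "p dvd \<alpha> * r" by (simp only: of_nat_dvd_iff)
      then show False using nd p(1) by (simp add: prime_dvd_mult_iff)
    qed
    ultimately have "int p dvd int a - int a'" using p(1) by (simp add: prime_dvd_mult_iff)
    then have aa: "a = a'" using dvd_diff_nat_eq lt by blast
    have "int p dvd (int c - int c0 - int k * (int a - int a0)) - (int c' - int c0 - int k * (int a' - int a0))"
      using dvd_diff[OF conjunct2[OF sl[of a c]] conjunct2[OF sl[of a' c']]] xy k by (simp add: x y)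
    then have "int p dvd int c - int c'" using aa by simp
    then have "c = c'" using dvd_diff_nat_eq lt by blast
    then show "x = y" using aa x y by simp
  qed
  moreover have "sl ` D \<subseteq> {..<p}" using sl by auto
  ultimately have "card D \<le> card {..<p}" by (intro card_inj_on_le[of sl]) auto
  moreover have "conic_points p \<alpha> \<gamma> r = A \<union> D" by (auto simp: A_def D_def)
  ultimately show ?thesis using A card_Un_le[of A D] by simp
qed simp

lemma conic_mod:
  assumes "m > 0" "m dvd n" "[\<alpha> * a\<^sup>2 + \<gamma> * c\<^sup>2 = r] (mod n)"
  shows "(a mod m, c mod m) \<in> conic_points m \<alpha> \<gamma> r"
proof -
  have "[\<alpha> * (a mod m)\<^sup>2 + \<gamma> * (c mod m)\<^sup>2 = \<alpha> * a\<^sup>2 + \<gamma> * c\<^sup>2] (mod m)"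
    by (intro cong_add cong_mult cong_pow cong_refl) (auto simp: cong_def)
  also have "[\<alpha> * a\<^sup>2 + \<gamma> * c\<^sup>2 = r] (mod m)" using assms(2,3) by (rule cong_dvd_modulus_nat[rotated])
  finally show ?thesis using assms by (simp add: conic_points_def)
qed

lemma card_conic_mult:
  assumes "coprime m n" "m > 0" "n > 0"
  shows "card (conic_points (m * n) \<alpha> \<gamma> r) \<le> card (conic_points m \<alpha> \<gamma> r) * card (conic_points n \<alpha> \<gamma> r)"
proof -
  define f where "f = (\<lambda>(a,c). ((a mod m, c mod m), (a mod n, c mod n)))"
  have "card (conic_points (m * n) \<alpha> \<gamma> r) \<le> card (conic_points m \<alpha> \<gamma> r \<times> conic_points n \<alpha> \<gamma> r)"
  proof (rule card_inj_on_le[of f])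
    have eq: "x = y" if "x mod m = y mod m" "x mod n = y mod n" "x < m * n" "y < m * n" for x y
    proof -
      have "[x = y] (mod m * n)" using that assms(1) by (simp add: cong_def[symmetric] coprime_cong_mult_nat)
      then show ?thesis using that by (simp add: cong_def)
    qed
    show "inj_on f (conic_points (m * n) \<alpha> \<gamma> r)"
      by (rule inj_onI) (auto simp: f_def conic_points_def intro: eq)
    show "f ` conic_points (m * n) \<alpha> \<gamma> r \<subseteq> conic_points m \<alpha> \<gamma> r \<times> conic_points n \<alpha> \<gamma> r"
    proof
      fix y assume "y \<in> f ` conic_points (m * n) \<alpha> \<gamma> r"
      then obtain a c where ac: "y = f (a,c)" "[\<alpha> * a\<^sup>2 + \<gamma> * c\<^sup>2 = r] (mod m * n)" by (auto simp: conic_points_def)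
      then show "y \<in> conic_points m \<alpha> \<gamma> r \<times> conic_points n \<alpha> \<gamma> r"
        using conic_mod[OF assms(2) _ ac(2)] conic_mod[OF assms(3) _ ac(2)] by (simp add: f_def)
    qed
  qed simp
  then show ?thesis by (simp add: card_cartesian_product)
qed

lemma card_conic_prod:
  assumes "finite Q" "\<And>p. p \<in> Q \<Longrightarrow> prime p"
  shows "card (conic_points (\<Prod>Q) \<alpha> \<gamma> r) \<le> (\<Prod>p\<in>Q. card (conic_points p \<alpha> \<gamma> r))"
  using assms
proof (induction Q)
  case empty
  have "conic_points 1 \<alpha> \<gamma> r \<subseteq> {(0,0)}" by (auto simp: conic_points_def)
  then have "card (conic_points 1 \<alpha> \<gamma> r) \<le> card {(0::nat,0::nat)}" by (rule card_mono[rotated]) simp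
  then show ?case by simp
next
  case (insert p Q)
  have "coprime p (\<Prod>Q)"
    using insert by (intro prod_coprime_right primes_coprime) auto
  moreover have "p > 0" using insert.prems by (simp add: prime_gt_0_nat)
  moreover have "\<Prod>Q > 0" using insert.prems by (simp add: prod_pos prime_gt_0_nat)
  ultimately have "card (conic_points (p * \<Prod>Q) \<alpha> \<gamma> r) \<le> card (conic_points p \<alpha> \<gamma> r) * card (conic_points (\<Prod>Q) \<alpha> \<gamma> r)"
    by (rule card_conic_mult)
  also have "\<dots> \<le> card (conic_points p \<alpha> \<gamma> r) * (\<Prod>p\<in>Q. card (conic_points p \<alpha> \<gamma> r))"
    using insert by (intro mult_left_mono) auto
  finally show ?case using insert.hyps by simp
qed

lemma card_conic_box:
  assumes "n > 0"
  shows "card {(a,c). a \<le> x \<and> c \<le> y \<and> [\<alpha> * a\<^sup>2 + \<gamma> * c\<^sup>2 = r] (mod n)}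
    \<le> (x div n + 1) * (y div n + 1) * card (conic_points n \<alpha> \<gamma> r)"
proof -
  define f where "f = (\<lambda>(a,c). ((a div n, c div n), (a mod n, c mod n)))"
  have "card {(a,c). a \<le> x \<and> c \<le> y \<and> [\<alpha> * a\<^sup>2 + \<gamma> * c\<^sup>2 = r] (mod n)}
      \<le> card (({..x div n} \<times> {..y div n}) \<times> conic_points n \<alpha> \<gamma> r)"
  proof (rule card_inj_on_le[of f])
    have eq: "x = y" if "x div n = y div n" "x mod n = y mod n" for x y :: nat
      using that by (metis div_mult_mod_eq)
    show "inj_on f {(a,c). a \<le> x \<and> c \<le> y \<and> [\<alpha> * a\<^sup>2 + \<gamma> * c\<^sup>2 = r] (mod n)}"
    proof (rule inj_onI)
      fix u v assume "f u = f v"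
      then show "u = v" using eq[of "fst u" "fst v"] eq[of "snd u" "snd v"]
        by (simp add: f_def case_prod_beta prod_eq_iff)
    qed
    show "f ` {(a,c). a \<le> x \<and> c \<le> y \<and> [\<alpha> * a\<^sup>2 + \<gamma> * c\<^sup>2 = r] (mod n)} \<subseteq> ({..x div n} \<times> {..y div n}) \<times> conic_points n \<alpha> \<gamma> r"
      using conic_mod[OF assms dvd_refl] by (auto simp: f_def div_le_mono)
  qed simp
  then show ?thesis by (simp add: card_cartesian_product)
qed

section \<open>Counting representations with given b and d\<close>

text \<open>Multiplying by b gives the form (ab^2)^2 + bd (cd)^2. If cd were invertible modulo p,
  then -bd would be a square.\<close>

lemma Legendre_not_one_imp_dvd:
  assumes p: "prime p" "2 < p" and nd: "\<not> p dvd b" "\<not> p dvd d"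
    and L: "Legendre (- int (b * d)) (int p) \<noteq> 1"
    and dv: "p dvd a\<^sup>2 * b ^ 3 + c\<^sup>2 * d ^ 3"
  shows "p dvd a \<and> p dvd c"
proof -
  define y where "y = int c * int d"
  define x where "x = int a * int b ^ 2"
  define e where "e = int (b * d)"
  have pi: "prime (int p)" using p by simp
  have "int p dvd int b * int (a\<^sup>2 * b ^ 3 + c\<^sup>2 * d ^ 3)" using dv by (intro dvd_mult) (simp only: of_nat_dvd_iff)
  also have "int b * int (a\<^sup>2 * b ^ 3 + c\<^sup>2 * d ^ 3) = x ^ 2 + e * y ^ 2"
    by (simp add: x_def y_def e_def algebra_simps power2_eq_square power3_eq_cube)
  finally have xy: "int p dvd x ^ 2 + e * y ^ 2" .
  have "int p dvd y"
  proof (rule ccontr)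
    assume "\<not> int p dvd y"
    then have "coprime y (int p)" using pi by (metis coprime_commute prime_imp_coprime)
    then obtain v where v: "[y * v = 1] (mod int p)" using cong_solve_coprime_int by blast
    have "[x ^ 2 + e * y ^ 2 = 0] (mod int p)" using xy by (simp add: cong_0_iff)
    then have "[(x ^ 2 + e * y ^ 2) * v ^ 2 = 0 * v ^ 2] (mod int p)" by (rule cong_scalar_right)
    moreover have eq: "(x ^ 2 + e * y ^ 2) * v ^ 2 = (x * v) ^ 2 + e * (y * v) ^ 2"
      by (simp add: algebra_simps power_mult_distrib)
    ultimately have "[(x * v) ^ 2 + e * (y * v) ^ 2 = 0] (mod int p)" by (simp only: eq mult_zero_left)
    moreover have "[(x * v) ^ 2 + e * (y * v) ^ 2 = (x * v) ^ 2 + e * 1 ^ 2] (mod int p)"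
      by (intro cong_add cong_mult cong_pow cong_refl v)
    ultimately have "[(x * v) ^ 2 + e * 1 ^ 2 = 0] (mod int p)" using cong_sym cong_trans by blast
    then have "[(x * v) ^ 2 + e = 0] (mod int p)" by simp
    then have "[(x * v) ^ 2 = - e] (mod int p)" by (simp add: cong_iff_dvd_diff)
    then have "QuadRes (int p) (- e)" unfolding QuadRes_def by blast
    moreover have "\<not> int p dvd - e" using nd p by (simp add: e_def prime_dvd_mult_iff pi)
    ultimately have "Legendre (- e) (int p) = 1" by (simp add: Legendre_def cong_0_iff)
    then show False using L by (simp add: e_def)
  qed
  then have "int p dvd int c" using nd pi by (simp add: y_def prime_dvd_mult_iff)
  have "int p dvd x ^ 2" using xy \<open>int p dvd y\<close> by (simp add: dvd_add_left_iff power2_eq_square)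
  then have "int p dvd x" using pi by (metis prime_dvd_power)
  then have "int p dvd int a" using nd pi
    by (simp add: x_def prime_dvd_mult_iff prime_dvd_power_iff)
  then show ?thesis using \<open>int p dvd int c\<close> by simp
qed

lemma root_bound:
  fixes a b Y :: nat
  assumes "a\<^sup>2 * b ^ 3 \<le> Y" "b \<ge> 1"
  shows "real a \<le> sqrt Y * real b powr (-3/2)"
proof -
  have "real (a\<^sup>2 * b ^ 3) \<le> real Y" using assms(1) by (simp only: of_nat_le_iff)
  then have "sqrt (real (a\<^sup>2 * b ^ 3)) \<le> sqrt (real Y)" by simp
  moreover have "sqrt (real (a\<^sup>2 * b ^ 3)) = real a * real b powr (3/2)"
  proof -
    have "sqrt (real b ^ 3) = (real b ^ 3) powr (1/2)" using assms(2) by (simp add: powr_half_sqrt)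
    also have "real b ^ 3 = real b powr 3" using assms(2) by simp
    also have "(real b powr 3) powr (1/2) = real b powr (3/2)" by (simp only: powr_powr) simp
    finally show ?thesis by (simp add: real_sqrt_mult)
  qed
  ultimately have "real a * real b powr (3/2) \<le> sqrt Y" by linarith
  then have "real a * real b powr (3/2) * real b powr (-3/2) \<le> sqrt Y * real b powr (-3/2)"
    by (intro mult_right_mono) auto
  moreover have "real a * real b powr (3/2) * real b powr (-3/2) = real a"
    using assms(2) by (simp add: mult.assoc flip: powr_add)
  ultimately show ?thesis by (simp only:)
qed

lemma prod_primes_dvd:
  fixes b :: nat
  assumes "finite D" "\<And>p. p \<in> D \<Longrightarrow> prime p \<and> p dvd b"
  shows "\<Prod>D dvd b"
  using assms
proof (induction D)
  case (insert p D)
  have "coprime p (\<Prod>D)" using insert by (intro prod_coprime_right primes_coprime) auto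
  then show ?case using insert by (simp add: divides_mult)
qed simp

text \<open>Each prime divisor in \<open>Q\<close> is at least 16 = 2^4, so a factor 2 per divisor
  costs at most its fourth root.\<close>

lemma two_power_card_divisors:
  assumes "finite Q" "\<And>p. p \<in> Q \<Longrightarrow> prime p \<and> 16 \<le> p" "b \<ge> 1"
  shows "(\<Prod>p\<in>Q. if p dvd b then 2 else 1) \<le> real b powr (1/4)"
proof -
  define D where "D = {p\<in>Q. p dvd b}"
  have finD: "finite D" using assms by (simp add: D_def)
  have "(\<Prod>p\<in>Q. if p dvd b then 2 else 1) = (\<Prod>p\<in>D. 2::real)"
    by (simp only: D_def prod.inter_filter[OF assms(1)])
  also have "\<dots> = (16 powr (1/4)) ^ card D"
  proof -
    have "(16::real) = 2 powr 4" by simp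
    then have "(16::real) powr (1/4) = 2" by (simp only: powr_powr) simp
    then show ?thesis by simp
  qed
  also have "\<dots> = (16 ^ card D) powr (1/4)" by (simp add: powr_powr mult.commute flip: powr_realpow)
  also have "\<dots> \<le> real b powr (1/4)"
  proof (rule powr_mono2)
    have "16 ^ card D = (\<Prod>p\<in>D. 16::nat)" by simp
    also have "\<dots> \<le> (\<Prod>p\<in>D. p)" using assms(2) by (intro prod_mono) (auto simp: D_def)
    finally have 1: "16 ^ card D \<le> (\<Prod>p\<in>D. p)" .
    have "\<Prod>D dvd b" using finD assms(2) by (intro prod_primes_dvd) (auto simp: D_def)
    then have "(\<Prod>p\<in>D. p) \<le> b" using assms(3) by (intro dvd_imp_le) auto
    with 1 have "16 ^ card D \<le> b" by linarith
    then show "16 ^ card D \<le> real b" by (metis of_nat_le_iff of_nat_numeral of_nat_power)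
  qed auto
  finally show ?thesis .
qed

text \<open>The box for (a,c) is covered by blocks of side P, each holding as many solutions as the
  conic modulo P. Primewise, the conic has about p points, twice that for p in \<open>S\<close>, and
  possibly twice that for p dividing b or d; the last effect is absorbed by (bd)^(1/4).\<close>

lemma card_reps_near:
  fixes Q S :: "nat set" and b d r Y :: nat
  assumes Q: "finite Q" "S \<subseteq> Q" "\<And>p. p \<in> Q \<Longrightarrow> prime p \<and> 16 \<le> p"
    and prod: "(\<Prod>p\<in>Q. 1 + 2 / real p) \<le> 2"
    and r: "\<And>p. p \<in> Q - S \<Longrightarrow> \<not> p dvd r" "\<And>p. p \<in> S \<Longrightarrow> p dvd r"
    and bd: "1 \<le> b" "1 \<le> d" "b \<le> \<Prod>Q ^ 4" "d \<le> \<Prod>Q ^ 4" and Y: "\<Prod>Q ^ 14 \<le> Y"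
  shows "real (card {(a,c). a\<^sup>2 * b ^ 3 + c\<^sup>2 * d ^ 3 \<le> Y \<and> [a\<^sup>2 * b ^ 3 + c\<^sup>2 * d ^ 3 = r] (mod \<Prod>Q) \<and>
      (\<forall>p\<in>S. \<not> p\<^sup>2 dvd a\<^sup>2 * b ^ 3 + c\<^sup>2 * d ^ 3)})
    \<le> 8 * (Y / \<Prod>Q) * ((real b * real d) powr (-5/4) * (\<Prod>p\<in>S. 1 + split_sign (b * d) p))"
    (is "real (card ?A) \<le> ?R")
proof (cases "?A = {}")
  case True
  have "0 \<le> (\<Prod>p\<in>S. 1 + split_sign (b * d) p)" by (intro prod_nonneg) (simp add: split_sign_def)
  then have "0 \<le> ?R" by (intro mult_nonneg_nonneg divide_nonneg_nonneg of_nat_0_le_iff powr_ge_zero) simp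
  then show ?thesis by (subst True) simp
next
  case False
  define P where "P = \<Prod>Q"
  obtain a0 c0 where 0: "(a0, c0) \<in> ?A" using False by auto
  define N where "N = a0\<^sup>2 * b ^ 3 + c0\<^sup>2 * d ^ 3"
  have pQ: "prime p" "16 \<le> p" if "p \<in> Q" for p using Q(3) that by auto
  have P0: "P > 0" unfolding P_def using pQ by (intro prod_pos) (simp add: prime_gt_0_nat)
  \<comment> \<open>A single representation of an N divisible by p exactly once decides this: if p
    divides one summand, then p^2 does by its shape, so p and hence p^2 divides the other one. The
    product over \<open>S\<close> is thus the full power of 2.\<close>
  have S: "\<not> p dvd b \<and> \<not> p dvd d \<and> split_sign (b * d) p = 1" if p: "p \<in> S" for p
  proof -
    have pp: "prime p" "2 < p" using pQ[of p] p Q(2) by auto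
    have "[N = r] (mod P)" using 0 by (simp add: N_def P_def)
    moreover have "p dvd P" unfolding P_def using p Q by (intro dvd_prodI) auto
    ultimately have "[N = r] (mod p)" using cong_dvd_modulus_nat by blast
    then have pN: "p dvd N" using r(2)[OF p] cong_dvd_iff by blast
    have nN: "\<not> p\<^sup>2 dvd N" using 0 p by (auto simp: N_def)
    have sq: "p\<^sup>2 dvd x\<^sup>2 * y ^ 3" if "p dvd x \<or> p dvd y" for x y
      using that
    proof
      assume "p dvd x"
      then show ?thesis by (intro dvd_mult2 dvd_power_same)
    next
      assume "p dvd y"
      then have "p ^ 2 dvd y ^ 2" by (rule dvd_power_same)
      then show ?thesis by (intro dvd_mult) (simp add: power3_eq_cube power2_eq_square dvd_mult2)
    qed
    have dv: "p dvd x \<or> p dvd y" if "p dvd x\<^sup>2 * y ^ 3" for x y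
      using that pp(1) by (auto simp: prime_dvd_mult_iff dest: prime_dvd_power)
    have weak: "p dvd x" if "p\<^sup>2 dvd x" for x using that by (metis dvd_mult_left power2_eq_square)
    have bb: "\<not> p dvd b"
    proof
      assume "p dvd b"
      then have 1: "p\<^sup>2 dvd a0\<^sup>2 * b ^ 3" using sq by blast
      then have "p dvd c0\<^sup>2 * d ^ 3" using pN weak[OF 1] by (simp add: N_def dvd_add_right_iff)
      then have "p\<^sup>2 dvd c0\<^sup>2 * d ^ 3" using dv sq by blast
      then show False using nN 1 by (simp add: N_def)
    qed
    have dd: "\<not> p dvd d"
    proof
      assume "p dvd d"
      then have 1: "p\<^sup>2 dvd c0\<^sup>2 * d ^ 3" using sq by blast
      then have "p dvd a0\<^sup>2 * b ^ 3" using pN weak[OF 1] by (simp add: N_def dvd_add_left_iff)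
      then have "p\<^sup>2 dvd a0\<^sup>2 * b ^ 3" using dv sq by blast
      then show False using nN 1 by (simp add: N_def)
    qed
    have "Legendre (- int (b * d)) (int p) = 1"
    proof (rule ccontr)
      assume "Legendre (- int (b * d)) (int p) \<noteq> 1"
      then have "p dvd a0 \<and> p dvd c0"
        using Legendre_not_one_imp_dvd[OF pp bb dd _ pN[unfolded N_def]] by blast
      then have "p\<^sup>2 dvd N" unfolding N_def using dvd_add[OF sq[of a0 b] sq[of c0 d]] by blast
      then show False using nN by simp
    qed
    then show ?thesis using bb dd by (simp add: split_sign_def)
  qed
  have prodS: "(\<Prod>p\<in>S. 1 + split_sign (b * d) p) = (\<Prod>p\<in>Q. if p \<in> S then 2 else 1)"
  proof -
    have "(\<Prod>p\<in>S. 1 + split_sign (b * d) p) = (\<Prod>p\<in>S. 2)" using S by (intro prod.cong) auto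
    also have "\<dots> = (\<Prod>p\<in>{p\<in>Q. p \<in> S}. 2)" using Q(2) by (intro prod.cong) auto
    also have "\<dots> = (\<Prod>p\<in>Q. if p \<in> S then 2 else 1)" using Q(1) by (rule prod.inter_filter)
    finally show ?thesis .
  qed
  have nu: "real (card (conic_points P (b ^ 3) (d ^ 3) r))
      \<le> P * (2 * (\<Prod>p\<in>S. 1 + split_sign (b * d) p) * (real b * real d) powr (1/4))"
  proof -
    have "card (conic_points P (b ^ 3) (d ^ 3) r) \<le> (\<Prod>p\<in>Q. card (conic_points p (b ^ 3) (d ^ 3) r))"
      unfolding P_def using Q pQ by (intro card_conic_prod) auto
    then have "real (card (conic_points P (b ^ 3) (d ^ 3) r)) \<le> real (\<Prod>p\<in>Q. card (conic_points p (b ^ 3) (d ^ 3) r))"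
      by (simp only: of_nat_le_iff)
    also have "\<dots> = (\<Prod>p\<in>Q. real (card (conic_points p (b ^ 3) (d ^ 3) r)))" by simp
    also have "\<dots> \<le> (\<Prod>p\<in>Q. real p * ((1 + 2 / real p) * (if p \<in> S then 2 else 1) *
        ((if p dvd b then 2 else 1) * (if p dvd d then 2 else 1))))"
    proof (intro prod_mono conjI)
      fix p assume p: "p \<in> Q"
      note pp = pQ[OF p]
      define F where "F = (if p \<in> S then 2 else 1) * ((if p dvd b then 2 else 1) * (if p dvd d then 2 else (1::real)))"
      have pd: "p dvd x ^ 3 \<longleftrightarrow> p dvd x" for x :: nat using pp(1) by (simp add: prime_dvd_power_iff)
      have "real (card (conic_points p (b ^ 3) (d ^ 3) r)) \<le> real p * ((1 + 2 / real p) * F)"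
      proof (cases "p \<in> S \<or> p dvd b \<or> p dvd d")
        case False
        then have "card (conic_points p (b ^ 3) (d ^ 3) r) \<le> p + 2"
          using pp p r(1) pd by (intro card_conic_le) auto
        then have "real (card (conic_points p (b ^ 3) (d ^ 3) r)) \<le> real (p + 2)" by (simp only: of_nat_le_iff)
        moreover have "real p * ((1 + 2 / real p) * F) = real (p + 2)"
          using False pp by (simp add: F_def field_simps)
        ultimately show ?thesis by (simp only:)
      next
        case True
        have "card (conic_points p (b ^ 3) (d ^ 3) r) \<le> 2 * p"
        proof (cases "p dvd b \<and> p dvd d")
          case True
          then have "p \<notin> S" using S by blast
          then have nr: "\<not> p dvd r" using r(1) p by blast
          have "conic_points p (b ^ 3) (d ^ 3) r = {}"
          proof (rule ccontr)
            assume "conic_points p (b ^ 3) (d ^ 3) r \<noteq> {}"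
            then obtain a c where "[b ^ 3 * a\<^sup>2 + d ^ 3 * c\<^sup>2 = r] (mod p)" by (auto simp: conic_points_def)
            moreover have "p dvd b ^ 3 * a\<^sup>2 + d ^ 3 * c\<^sup>2" using True pd by auto
            ultimately show False using nr cong_dvd_iff by blast
          qed
          then show ?thesis by simp
        next
          case False
          then show ?thesis using pp(1) pd by (intro card_conic_le_double) auto
        qed
        then have "real (card (conic_points p (b ^ 3) (d ^ 3) r)) \<le> real (2 * p)" by (simp only: of_nat_le_iff)
        also have "\<dots> = real p * (1 * 2)" by simp
        also have "\<dots> \<le> real p * ((1 + 2 / real p) * F)"
        proof (intro mult_left_mono mult_mono)
          show "2 \<le> F" using True by (auto simp: F_def)
        qed auto
        finally show ?thesis .
      qed
      then show "real (card (conic_points p (b ^ 3) (d ^ 3) r)) \<le> real p * ((1 + 2 / real p) * (if p \<in> S then 2 else 1) *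
        ((if p dvd b then 2 else 1) * (if p dvd d then 2 else 1)))" by (simp only: F_def mult.assoc)
    qed simp
    also have "\<dots> = P * ((\<Prod>p\<in>Q. 1 + 2 / real p) * (\<Prod>p\<in>S. 1 + split_sign (b * d) p) *
        ((\<Prod>p\<in>Q. if p dvd b then 2 else 1) * (\<Prod>p\<in>Q. if p dvd d then 2 else 1)))"
      by (simp only: prod.distrib prodS P_def of_nat_prod)
    also have "\<dots> \<le> P * (2 * (\<Prod>p\<in>S. 1 + split_sign (b * d) p) * (real b powr (1/4) * real d powr (1/4)))"
    proof (intro mult_left_mono mult_mono prod)
      show "(\<Prod>p\<in>Q. if p dvd b then 2 else 1) \<le> real b powr (1/4)"
        using Q bd by (intro two_power_card_divisors) auto
      show "(\<Prod>p\<in>Q. if p dvd d then 2 else 1) \<le> real d powr (1/4)"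
        using Q bd by (intro two_power_card_divisors) auto
    qed (auto intro!: prod_nonneg mult_nonneg_nonneg simp: split_sign_def)
    finally show ?thesis by (simp add: powr_mult)
  qed
  define x where "x = nat \<lfloor>sqrt Y * real b powr (-3/2)\<rfloor>"
  define y where "y = nat \<lfloor>sqrt Y * real d powr (-3/2)\<rfloor>"
  \<comment> \<open>From Y \<ge> P^14 and t \<le> P^4 the side of the box is at least P^7 * P^(-6) =
    P, so the incomplete block at most doubles the count.\<close>
  have block: "real (nat \<lfloor>sqrt Y * real t powr (-3/2)\<rfloor> div P + 1) \<le> 2 * (sqrt Y * real t powr (-3/2)) / P"
    if t: "1 \<le> t" "t \<le> P ^ 4" for t
  proof -
    define Z where "Z = sqrt Y * real t powr (-3/2)"
    have "real (P ^ 14) \<le> real Y" using Y unfolding P_def by (simp only: of_nat_le_iff)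
    then have "real P ^ 14 \<le> real Y" by simp
    then have "sqrt (real P ^ 14) \<le> sqrt (real Y)" by simp
    moreover have "sqrt (real P ^ 14) = real P ^ 7"
      by (rule real_sqrt_unique) (simp_all flip: power_mult)
    moreover have "real t powr (-3/2) \<ge> (real P ^ 4) powr (-3/2)"
    proof (rule powr_mono2')
      have "real t \<le> real (P ^ 4)" using t(2) by (simp only: of_nat_le_iff)
      then show "real t \<le> real P ^ 4" by simp
    qed (use t in auto)
    moreover have "(real P ^ 4) powr (-3/2) = real P powr (-6)"
    proof -
      have "real P ^ 4 = real P powr 4" using P0 by simp
      then show ?thesis by (simp only: powr_powr) simp
    qed
    ultimately have "real P ^ 7 * real P powr (-6) \<le> Z" unfolding Z_def by (intro mult_mono) auto
    moreover have "real P ^ 7 * real P powr (-6) = real P"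
    proof -
      have "real P ^ 7 = real P powr 7" using P0 by simp
      then have "real P ^ 7 * real P powr (-6) = real P powr (7 + (-6))" by (simp only: powr_add)
      then show ?thesis using P0 by simp
    qed
    ultimately have ZP: "real P \<le> Z" by simp
    have "real (nat \<lfloor>Z\<rfloor> div P) \<le> real (nat \<lfloor>Z\<rfloor>) / real P" by (rule of_nat_div_le_of_nat)
    also have "\<dots> \<le> Z / real P" using ZP P0 by (intro divide_right_mono) auto
    finally show ?thesis unfolding Z_def[symmetric] using ZP P0 by (simp add: field_simps)
  qed
  have "?A \<subseteq> {(a,c). a \<le> x \<and> c \<le> y \<and> [b ^ 3 * a\<^sup>2 + d ^ 3 * c\<^sup>2 = r] (mod P)}"
  proof clarify
    fix a c assume ac: "a\<^sup>2 * b ^ 3 + c\<^sup>2 * d ^ 3 \<le> Y" "[a\<^sup>2 * b ^ 3 + c\<^sup>2 * d ^ 3 = r] (mod \<Prod>Q)"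
    have "real a \<le> sqrt Y * real b powr (-3/2)" "real c \<le> sqrt Y * real d powr (-3/2)"
      using root_bound[of a b Y] root_bound[of c d Y] ac(1) bd by linarith+
    then have "a \<le> x" "c \<le> y" unfolding x_def y_def by (simp_all add: le_nat_floor)
    then show "a \<le> x \<and> c \<le> y \<and> [b ^ 3 * a\<^sup>2 + d ^ 3 * c\<^sup>2 = r] (mod P)"
      using ac(2) by (simp add: P_def mult.commute)
  qed
  then have "card ?A \<le> card {(a,c). a \<le> x \<and> c \<le> y \<and> [b ^ 3 * a\<^sup>2 + d ^ 3 * c\<^sup>2 = r] (mod P)}"
    by (rule card_mono[rotated]) (rule finite_subset[of _ "{..x} \<times> {..y}"], auto)
  also have "\<dots> \<le> (x div P + 1) * (y div P + 1) * card (conic_points P (b ^ 3) (d ^ 3) r)"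
    by (rule card_conic_box[OF P0])
  finally have "real (card ?A) \<le> real ((x div P + 1) * (y div P + 1) * card (conic_points P (b ^ 3) (d ^ 3) r))"
    by (simp only: of_nat_le_iff)
  also have "\<dots> = real (x div P + 1) * real (y div P + 1) * real (card (conic_points P (b ^ 3) (d ^ 3) r))"
    by (simp only: of_nat_mult)
  also have "\<dots> \<le> (2 * (sqrt Y * real b powr (-3/2)) / P) * (2 * (sqrt Y * real d powr (-3/2)) / P) *
      (P * (2 * (\<Prod>p\<in>S. 1 + split_sign (b * d) p) * (real b * real d) powr (1/4)))"
    using bd block[of b] block[of d] nu by (intro mult_mono) (auto simp: x_def y_def P_def)
  also have "\<dots> = 8 * ((sqrt Y * sqrt Y) / P) * ((real b powr (-3/2) * real d powr (-3/2) * (real b * real d) powr (1/4))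
       * (\<Prod>p\<in>S. 1 + split_sign (b * d) p))"
    using P0 by (simp add: field_simps)
  also have "sqrt Y * sqrt Y = Y" by simp
  also have "real b powr (-3/2) * real d powr (-3/2) * (real b * real d) powr (1/4) = (real b * real d) powr (-5/4)"
    by (simp flip: powr_mult powr_add)
  finally show ?thesis by (simp add: P_def)
qed

lemma card_reps_far:
  fixes b d Y :: nat
  assumes "1 \<le> b" "1 \<le> d" "b ^ 3 \<le> Y" "d ^ 3 \<le> Y"
  shows "real (card {(a,c). a\<^sup>2 * b ^ 3 + c\<^sup>2 * d ^ 3 \<le> Y}) \<le> 4 * Y * (real b * real d) powr (-3/2)"
proof -
  define x where "x = nat \<lfloor>sqrt Y * real b powr (-3/2)\<rfloor>"
  define y where "y = nat \<lfloor>sqrt Y * real d powr (-3/2)\<rfloor>"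
  have "{(a,c). a\<^sup>2 * b ^ 3 + c\<^sup>2 * d ^ 3 \<le> Y} \<subseteq> {..x} \<times> {..y}"
  proof clarify
    fix a c assume ac: "a\<^sup>2 * b ^ 3 + c\<^sup>2 * d ^ 3 \<le> Y"
    have "real a \<le> sqrt Y * real b powr (-3/2)" "real c \<le> sqrt Y * real d powr (-3/2)"
      using root_bound[of a b Y] root_bound[of c d Y] ac assms by linarith+
    then show "a \<in> {..x} \<and> c \<in> {..y}" unfolding x_def y_def by (simp add: le_nat_floor)
  qed
  then have "card {(a,c). a\<^sup>2 * b ^ 3 + c\<^sup>2 * d ^ 3 \<le> Y} \<le> card ({..x} \<times> {..y})"
    by (rule card_mono[rotated]) simp
  also have "\<dots> = (x + 1) * (y + 1)" by (simp add: card_cartesian_product)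
  finally have "real (card {(a,c). a\<^sup>2 * b ^ 3 + c\<^sup>2 * d ^ 3 \<le> Y}) \<le> real ((x + 1) * (y + 1))"
    by (simp only: of_nat_le_iff)
  also have "\<dots> = real (x + 1) * real (y + 1)" by (simp only: of_nat_mult)
  also have "\<dots> \<le> (2 * (sqrt Y * real b powr (-3/2))) * (2 * (sqrt Y * real d powr (-3/2)))"
  proof -
    have "real (nat \<lfloor>sqrt Y * real t powr (-3/2)\<rfloor> + 1) \<le> 2 * (sqrt Y * real t powr (-3/2))"
      if "1 \<le> t" "t ^ 3 \<le> Y" for t
    proof -
      have "real 1 \<le> sqrt Y * real t powr (-3/2)" using that by (intro root_bound) auto
      then show ?thesis by linarith
    qed
    then show ?thesis using assms by (intro mult_mono) (auto simp: x_def y_def)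
  qed
  also have "\<dots> = 4 * (sqrt Y * sqrt Y) * (real b powr (-3/2) * real d powr (-3/2))" by simp
  also have "\<dots> = 4 * Y * (real b * real d) powr (-3/2)" by (simp add: powr_mult)
  finally show ?thesis .
qed

section \<open>Construction of the gap\<close>

text \<open>b collects the primes with odd exponent, from which 3 can be split off. The condition
  for a = 0 fixes the representation of 0, where b would otherwise be arbitrary.\<close>

lemma squareful_rep:
  assumes "squareful m"
  obtains a b where "1 \<le> b" "a = 0 \<longrightarrow> b = 1" "m = a\<^sup>2 * b ^ 3"
proof (cases "m = 0")
  case True
  then show ?thesis using that[of 1 0] by simp
next
  case False
  define v where "v = (\<lambda>p. multiplicity p m)"
  define a where "a = (\<Prod>p\<in>prime_factors m. p ^ ((v p - (if odd (v p) then 3 else 0)) div 2))"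
  define b where "b = (\<Prod>p\<in>prime_factors m. if odd (v p) then p else 1)"
  have pos: "p > 0" if "p \<in> prime_factors m" for p using that by (auto intro: prime_gt_0_nat)
  have "a > 0" unfolding a_def using pos by (intro prod_pos) auto
  have "b > 0" unfolding b_def using pos by (intro prod_pos) auto
  have "a\<^sup>2 * b ^ 3 = (\<Prod>p\<in>prime_factors m. (p ^ ((v p - (if odd (v p) then 3 else 0)) div 2))\<^sup>2 * (if odd (v p) then p else 1) ^ 3)"
    by (simp add: a_def b_def prod_power_distrib prod.distrib)
  also have "\<dots> = (\<Prod>p\<in>prime_factors m. p ^ v p)"
  proof (rule prod.cong[OF refl])
    fix p assume "p \<in> prime_factors m"
    then have v2: "2 \<le> v p" using assms False by (auto simp: squareful_def v_def)
    show "(p ^ ((v p - (if odd (v p) then 3 else 0)) div 2))\<^sup>2 * (if odd (v p) then p else 1) ^ 3 = p ^ v p"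
    proof (cases "odd (v p)")
      case True
      then have "3 \<le> v p" using v2 by presburger
      then have "(v p - 3) div 2 * 2 + 3 = v p" using True by presburger
      then show ?thesis using True by (simp flip: power_mult power_add)
    next
      case False
      then have "v p div 2 * 2 = v p" by presburger
      then show ?thesis using False by (simp flip: power_mult)
    qed
  qed
  also have "\<dots> = m" unfolding v_def using prime_factorization_nat[of m] False by simp
  finally show ?thesis using that[of b a] \<open>a > 0\<close> \<open>b > 0\<close> by simp
qed

text \<open>Since p divides P exactly once, divisibility by p^2 determines u modulo p.\<close>

lemma card_square_dvd_progression:
  fixes p P r U :: nat
  assumes p: "prime p" "P = p * P'" "\<not> p dvd P'"
  shows "card {u. u < U \<and> p\<^sup>2 dvd r + P * u} \<le> U div p + 1"
proof -
  let ?A = "{u. u < U \<and> p\<^sup>2 dvd r + P * u}"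
  have p0: "p > 0" using p(1) by (rule prime_gt_0_nat)
  have same: "u mod p = v mod p" if "u \<in> ?A" "v \<in> ?A" for u v
  proof -
    have "int (p\<^sup>2) dvd int (r + P * u) - int (r + P * v)"
      using that by (intro dvd_diff) (simp_all only: of_nat_dvd_iff mem_Collect_eq)
    also have "int (r + P * u) - int (r + P * v) = int p * (int P' * (int u - int v))"
      by (simp add: p(2) algebra_simps)
    finally have "int p * int p dvd int p * (int P' * (int u - int v))" by (simp add: power2_eq_square)
    then have "int p dvd int P' * (int u - int v)" using p0 by simp
    then have "int p dvd int u - int v" using p by (simp add: prime_dvd_mult_iff)
    then show ?thesis by (metis cong_def cong_iff_dvd_diff cong_int_iff)
  qed
  have "card ?A \<le> card {..U div p}"
  proof (rule card_inj_on_le[of "\<lambda>u. u div p"])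
    show "inj_on (\<lambda>u. u div p) ?A" 
    proof (rule inj_onI)
      fix u v assume "u \<in> ?A" "v \<in> ?A" "u div p = v div p"
      then show "u = v" using same[of u v] by (metis div_mult_mod_eq)
    qed
    show "(\<lambda>u. u div p) ` ?A \<subseteq> {..U div p}" by (auto intro: div_le_mono)
  qed simp
  then show ?thesis by simp
qed

lemma finite_reps:
  fixes b d Y :: nat
  assumes "1 \<le> b" "1 \<le> d"
  shows "finite {(a,c). a\<^sup>2 * b ^ 3 + c\<^sup>2 * d ^ 3 \<le> Y}"
proof (rule finite_subset)
  show "{(a,c). a\<^sup>2 * b ^ 3 + c\<^sup>2 * d ^ 3 \<le> Y} \<subseteq> {..Y} \<times> {..Y}"
  proof clarify
    fix a c assume ac: "a\<^sup>2 * b ^ 3 + c\<^sup>2 * d ^ 3 \<le> Y"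
    have "x \<le> x\<^sup>2 * y ^ 3" if "1 \<le> y" for x y :: nat
    proof -
      have "x * 1 \<le> x\<^sup>2 * y ^ 3" using that by (intro mult_mono) (auto simp: power2_eq_square)
      then show ?thesis by simp
    qed
    then show "a \<in> {..Y} \<and> c \<in> {..Y}" using ac assms by (meson add_leD1 add_leD2 atMost_iff le_trans)
  qed
qed simp

lemma gap_construction:
  assumes s: "s \<ge> 13"
  shows "\<exists>n M. 1 \<le> n \<and> (\<forall>i<2 ^ (4 * s). n + i \<notin> squareful_sums) \<and> n + 2 ^ (4 * s) \<le> 2 * M ^ 14
    \<and> M \<le> 2 ^ (16000000 * s\<^sup>2 * 2 ^ (4 * s))"
proof -
  define L B T :: nat where "L = 2 ^ (4 * s)" and "B = 2 ^ (36 * s)" and "T = 2 ^ (340 * s)"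
  obtain S :: "nat \<Rightarrow> nat set" where 
    S0: "\<And>j. j < L \<Longrightarrow> S j \<subseteq> {p. prime p \<and> 2 ^ (16 * s) < p \<and> p \<le> 2 ^ (200000 * s)}"
    and S1: "\<And>j. j < L \<Longrightarrow> card (S j) = 80 * s"
    and S2: "\<And>j b d. j < L \<Longrightarrow> b \<in> {1..B} \<Longrightarrow> d \<in> {1..B} \<Longrightarrow> (\<Prod>p\<in>S j. 1 + split_sign (b * d) p) = 0"
    and S3: "\<And>j. j < L \<Longrightarrow> (\<Sum>(b,d) | b \<in> {1..T} \<and> d \<in> {1..T} \<and> B < max b d.
          (real b * real d) powr (-5/4) * (\<Prod>p\<in>S j. 1 + split_sign (b * d) p)) \<le> 41 / 2 ^ (5 * s)"
    and S4: "\<And>j j'. j < L \<Longrightarrow> j' < L \<Longrightarrow> j \<noteq> j' \<Longrightarrow> S j \<inter> S j' = {}"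
  proof -
    have s4: "s \<ge> 4" using s by simp
    from covering_primes[OF s4] obtain S :: "nat \<Rightarrow> nat set" where
      A: "\<forall>j<L. S j \<subseteq> {p. prime p \<and> 2 ^ (16 * s) < p \<and> p \<le> 2 ^ (200000 * s)} \<and> card (S j) = 80 * s \<and>
       (\<forall>b\<in>{1..B}. \<forall>d\<in>{1..B}. (\<Prod>p\<in>S j. 1 + split_sign (b * d) p) = 0) \<and>
       (\<Sum>(b,d) | b \<in> {1..T} \<and> d \<in> {1..T} \<and> B < max b d.
          (real b * real d) powr (-5/4) * (\<Prod>p\<in>S j. 1 + split_sign (b * d) p)) \<le> 41 / 2 ^ (5 * s)"
      and D: "\<forall>j<L. \<forall>j'<L. j \<noteq> j' \<longrightarrow> S j \<inter> S j' = {}"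
      unfolding L_def B_def T_def by (elim exE conjE)
    show thesis
    proof (rule that[of S])
      fix j assume j: "j < L"
      note A[rule_format, OF j]
      then have "S j \<subseteq> {p. prime p \<and> 2 ^ (16 * s) < p \<and> p \<le> 2 ^ (200000 * s)} \<and> card (S j) = 80 * s"
        "(\<Sum>(b,d) | b \<in> {1..T} \<and> d \<in> {1..T} \<and> B < max b d.
          (real b * real d) powr (-5/4) * (\<Prod>p\<in>S j. 1 + split_sign (b * d) p)) \<le> 41 / 2 ^ (5 * s)"
        by (simp_all only: simp_thms)
      then show "S j \<subseteq> {p. prime p \<and> 2 ^ (16 * s) < p \<and> p \<le> 2 ^ (200000 * s)}" "card (S j) = 80 * s"
        "(\<Sum>(b,d) | b \<in> {1..T} \<and> d \<in> {1..T} \<and> B < max b d.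
          (real b * real d) powr (-5/4) * (\<Prod>p\<in>S j. 1 + split_sign (b * d) p)) \<le> 41 / 2 ^ (5 * s)"
        by (simp_all only: simp_thms)
    next
      fix j b d assume "j < L" "b \<in> {1..B}" "d \<in> {1..B}"
      then show "(\<Prod>p\<in>S j. 1 + split_sign (b * d) p) = 0" using A by simp
    next
      fix j j' assume "j < L" "j' < L" "j \<noteq> j'"
      then show "S j \<inter> S j' = {}" using D by simp
    qed
  qed
  define Q where "Q = (\<Union>j<L. S j)"
  define P where "P = \<Prod>Q"
  have finS: "finite (S j)" if "j < L" for j
    using S0[OF that] by (rule finite_subset) (rule finite_subset[of _ "{..2 ^ (200000 * s)}"], auto)
  have finQ: "finite Q" unfolding Q_def using finS by simp
  have pQ: "prime p" "2 ^ (16 * s) < p" "p \<le> 2 ^ (200000 * s)" if "p \<in> Q" for p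
    using that S0 by (auto simp: Q_def)
  have cardQ: "card Q \<le> 80 * s * 2 ^ (4 * s)"
  proof -
    have "card Q \<le> (\<Sum>j<L. card (S j))" unfolding Q_def by (rule card_UN_le) simp
    also have "\<dots> = 80 * s * 2 ^ (4 * s)" using S1 by (simp add: L_def)
    finally show ?thesis .
  qed
  have P0: "P > 0" unfolding P_def using pQ(1) by (intro prod_pos) (simp add: prime_gt_0_nat)
  have L1: "L > 1" unfolding L_def using s by (intro one_less_power) auto
  have LZ: "L \<le> 2 ^ (16 * s)" unfolding L_def by (intro power_increasing) auto
  have pL: "L < p" if "p \<in> Q" for p using pQ(2)[OF that] LZ by linarith
  \<comment> \<open>A prime from position 1 rules out n0 = 0, since it divides n0 + 1.\<close>
  have "S 1 \<noteq> {}" using S1[OF L1] s by (metis card.empty mult_eq_0_iff not_numeral_le_zero zero_neq_numeral)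
  then obtain q1 where q1: "q1 \<in> S 1" by blast
  have q1Q: "q1 \<in> Q" unfolding Q_def using L1 q1 by blast
  have pdP: "p dvd P" if "p \<in> Q" for p unfolding P_def using that finQ by (intro dvd_prodI)
  have Pbig: "2 ^ (16 * s) < P" using pQ(2)[OF q1Q] dvd_imp_le[OF pdP[OF q1Q] P0] by linarith
  have LP: "L \<le> P" using LZ Pbig by linarith
  have ex: "\<exists>j<L. p \<in> S j" if "p \<in> Q" for p using that by (auto simp: Q_def)
  define ix where "ix = (\<lambda>p. SOME j. j < L \<and> p \<in> S j)"
  have ix: "ix p < L" "p \<in> S (ix p)" if "p \<in> Q" for p
    using someI_ex[OF ex[OF that]] by (auto simp: ix_def)
  have ix_eq: "ix p = j" if "p \<in> S j" "j < L" for p j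
  proof -
    have "p \<in> Q" using that by (auto simp: Q_def)
    then show ?thesis using ix[of p] S4[of "ix p" j] that by blast
  qed
  \<comment> \<open>The subtraction is exact, because \<open>ix p < L < p\<close>.\<close>
  have "\<exists>!x. x < (\<Prod>p\<in>Q. p) \<and> (\<forall>p\<in>Q. [x = p - ix p] (mod p))"
  proof (rule chinese_remainder_unique_nat[OF finQ])
    show "\<forall>i\<in>Q. i \<noteq> 0" using pQ(1) prime_gt_0_nat by blast
    show "\<forall>i\<in>Q. \<forall>j\<in>Q. i \<noteq> j \<longrightarrow> coprime i j" using pQ(1) primes_coprime by blast
  qed
  then obtain n0 where n0: "n0 < P" "\<And>p. p \<in> Q \<Longrightarrow> [n0 = p - ix p] (mod p)" unfolding P_def by blast
  have dv: "p dvd n0 + ix p" if "p \<in> Q" for p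
  proof -
    have "[n0 + ix p = (p - ix p) + ix p] (mod p)" using n0(2)[OF that] by (intro cong_add cong_refl)
    also have "(p - ix p) + ix p = p" using ix(1)[OF that] pL[OF that] by simp
    finally show ?thesis by (simp add: cong_def dvd_eq_mod_eq_0)
  qed
  have dvj: "p dvd n0 + j \<longleftrightarrow> j = ix p" if p: "p \<in> Q" and j: "j < L" for p j
  proof
    assume "p dvd n0 + j"
    then have "int p dvd int (n0 + j) - int (n0 + ix p)" using dv[OF p] by (intro dvd_diff) (simp_all only: of_nat_dvd_iff)
    then have "int p dvd int j - int (ix p)" by simp
    then show "j = ix p" using dvd_diff_nat_eq[of p j "ix p"] ix(1)[OF p] j pL[OF p] by simp
  qed (use dv[OF p] in simp)
  have n01: "1 \<le> n0"
  proof (rule ccontr)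
    assume "\<not> 1 \<le> n0"
    then have "n0 = 0" by simp
    then have "q1 dvd 1" using dv[OF q1Q] ix_eq[OF q1 L1] by simp
    then show False using pQ(1)[OF q1Q] not_prime_unit by blast
  qed
  \<comment> \<open>The class of n0 modulo P is followed up to order P^14, as the box count for b, d
    \<le> P^4 requires.\<close>
  define U where "U = P ^ 13"
  define Y where "Y = 2 * P ^ 14"
  have U0: "U > 0" using P0 by (simp add: U_def)
  have YU: "Y = 2 * (P * U)" by (simp add: Y_def U_def flip: power_Suc)
  have NY: "n0 + P * u + i \<le> Y" if "u < U" "i \<le> L" for u i
  proof -
    have "P * u + P \<le> P * U" using that(1) mult_le_mono2[of "Suc u" U P] by simp
    moreover have "P * 1 \<le> P * U" using U0 by (intro mult_left_mono) auto
    ultimately show ?thesis using n0(1) that LP YU by linarith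
  qed
  have ss: "real s \<le> 2 ^ s" using less_exp[of s] by (simp add: less_imp_le)
  define Bad1 where "Bad1 = {u. u < U \<and> (\<exists>j<L. \<exists>p\<in>S j. p\<^sup>2 dvd n0 + P * u + j)}"
  have sum_inv: "real (card Q) * (2 / 2 ^ (16 * s)) \<le> 1 / 4"
  proof -
    have "real (card Q) \<le> real (80 * s * 2 ^ (4 * s))" using cardQ by (simp only: of_nat_le_iff)
    also have "\<dots> = 80 * real s * 2 ^ (4 * s)" by simp
    also have "\<dots> \<le> 2 ^ (10 * s) * 2 ^ s * 2 ^ (4 * s)"
    proof (intro mult_right_mono mult_mono ss)
      have "(80::real) \<le> 2 ^ 10" by simp
      also have "\<dots> \<le> 2 ^ (10 * s)" using s by (intro power_increasing) auto
      finally show "(80::real) \<le> 2 ^ (10 * s)" .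
    qed auto
    also have "\<dots> = 2 ^ (15 * s)" by (simp flip: power_add)
    finally have "real (card Q) * 8 \<le> 2 ^ (15 * s) * 2 ^ s"
    proof (rule mult_mono)
      have "(8::real) = 2 ^ 3" by simp
      also have "\<dots> \<le> 2 ^ s" using s by (intro power_increasing) auto
      finally show "(8::real) \<le> 2 ^ s" .
    qed auto
    then have "real (card Q) * 8 \<le> 2 ^ (16 * s)" by (simp flip: power_add)
    then show ?thesis by (simp add: field_simps)
  qed
  have card1: "real (card Bad1) \<le> U / 4"
  proof -
    have "Bad1 \<subseteq> (\<Union>p\<in>Q. {u. u < U \<and> p\<^sup>2 dvd (n0 + ix p) + P * u})"
    proof
      fix u assume "u \<in> Bad1"
      then obtain j p where jp: "u < U" "j < L" "p \<in> S j" "p\<^sup>2 dvd n0 + P * u + j" by (auto simp: Bad1_def)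
      then have "p \<in> Q" "ix p = j" using ix_eq by (auto simp: Q_def)
      then show "u \<in> (\<Union>p\<in>Q. {u. u < U \<and> p\<^sup>2 dvd (n0 + ix p) + P * u})"
        using jp by (auto simp: add_ac)
    qed
    then have "card Bad1 \<le> card (\<Union>p\<in>Q. {u. u < U \<and> p\<^sup>2 dvd (n0 + ix p) + P * u})"
      using finQ by (intro card_mono) auto
    also have "\<dots> \<le> (\<Sum>p\<in>Q. card {u. u < U \<and> p\<^sup>2 dvd (n0 + ix p) + P * u})"
      using finQ by (rule card_UN_le)
    finally have "real (card Bad1) \<le> real (\<Sum>p\<in>Q. card {u. u < U \<and> p\<^sup>2 dvd (n0 + ix p) + P * u})"
      by (simp only: of_nat_le_iff)
    also have "\<dots> = (\<Sum>p\<in>Q. real (card {u. u < U \<and> p\<^sup>2 dvd (n0 + ix p) + P * u}))" by simp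
    also have "\<dots> \<le> real (card Q) * (2 * U / 2 ^ (16 * s))"
    proof (rule sum_bounded_above)
      fix p assume p: "p \<in> Q"
      have "P = p * (\<Prod>(Q - {p}))" unfolding P_def using finQ p by (simp add: prod.remove)
      moreover have "\<not> p dvd \<Prod>(Q - {p})"
      proof -
        have "coprime p (\<Prod>(Q - {p}))" using pQ(1) p by (intro prod_coprime_right primes_coprime) auto
        then show ?thesis using pQ(1)[OF p] by (metis coprime_absorb_left not_prime_unit)
      qed
      ultimately have "card {u. u < U \<and> p\<^sup>2 dvd (n0 + ix p) + P * u} \<le> U div p + 1"
        by (rule card_square_dvd_progression[OF pQ(1)[OF p]])
      then have "real (card {u. u < U \<and> p\<^sup>2 dvd (n0 + ix p) + P * u}) \<le> real (U div p) + 1" by linarith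
      also have "\<dots> \<le> real U / real p + real U / real p"
      proof (intro add_mono)
        show "real (U div p) \<le> real U / real p" by (rule of_nat_div_le_of_nat)
        have "p \<le> P" using dvd_imp_le[OF pdP[OF p] P0] .
        also have "P \<le> U" unfolding U_def using P0 by (intro self_le_power) auto
        finally show "1 \<le> real U / real p" using pQ(1)[OF p] prime_gt_0_nat by (simp add: field_simps)
      qed
      also have "\<dots> = 2 * U / real p" by simp
      also have "\<dots> \<le> 2 * U / 2 ^ (16 * s)"
      proof (intro divide_left_mono)
        have "real (2 ^ (16 * s)) \<le> real p" using pQ(2)[OF p] by (simp only: of_nat_le_iff less_imp_le)
        then show "2 ^ (16 * s) \<le> real p" by simp
      qed (use pQ(1)[OF p] prime_gt_0_nat in auto)
      finally show "real (card {u. u < U \<and> p\<^sup>2 dvd (n0 + ix p) + P * u}) \<le> 2 * U / 2 ^ (16 * s)" .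
    qed
    also have "\<dots> = real (card Q) * (2 / 2 ^ (16 * s)) * U" by simp
    also have "\<dots> \<le> 1 / 4 * U" using sum_inv by (intro mult_right_mono) auto
    finally show ?thesis by simp
  qed
  have prod2: "(\<Prod>p\<in>Q. 1 + 2 / real p) \<le> 2"
  proof -
    have "(\<Prod>p\<in>Q. 1 + 2 / real p) \<le> (\<Prod>p\<in>Q. exp (2 / real p))"
      by (intro prod_mono) (auto intro: exp_ge_add_one_self)
    also have "\<dots> = exp (\<Sum>p\<in>Q. 2 / real p)" using finQ by (simp add: exp_sum)
    also have "\<dots> \<le> exp (1 / 2)"
    proof -
      have "(\<Sum>p\<in>Q. 2 / real p) \<le> real (card Q) * (2 / 2 ^ (16 * s))"
      proof (rule sum_bounded_above)
        fix p assume p: "p \<in> Q"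
        have "real (2 ^ (16 * s)) \<le> real p" using pQ(2)[OF p] by (simp only: of_nat_le_iff less_imp_le)
        then show "2 / real p \<le> 2 / 2 ^ (16 * s)"
          using pQ(1)[OF p] prime_gt_0_nat by (intro divide_left_mono) auto
      qed
      then have "(\<Sum>p\<in>Q. 2 / real p) \<le> 1 / 2" using sum_inv by linarith
      then show ?thesis by (simp only: exp_le_cancel_iff)
    qed
    also have "exp (1 / 2) \<le> (2::real)"
    proof (rule power2_le_imp_le)
      show "exp (1 / 2) ^ 2 \<le> (2::real) ^ 2" using exp_le by (simp flip: exp_of_nat_mult)
    qed simp
    finally show ?thesis .
  qed
  define A where "A = (\<lambda>j b d. {(a,c). a\<^sup>2 * b ^ 3 + c\<^sup>2 * d ^ 3 \<le> Y \<and> [a\<^sup>2 * b ^ 3 + c\<^sup>2 * d ^ 3 = n0 + j] (mod P) \<and>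
      (\<forall>p\<in>S j. \<not> p\<^sup>2 dvd a\<^sup>2 * b ^ 3 + c\<^sup>2 * d ^ 3)})"
  define w where "w = (\<lambda>(b,d). (real b * real d) powr (-5/4))"
  define F where "F = (\<lambda>j (b,d). \<Prod>p\<in>S j. 1 + split_sign (b * d) p)"
  have F0: "0 \<le> F j x" "F j x \<le> 2 ^ (80 * s)" if "j < L" for j x
  proof -
    obtain b d where x: "x = (b,d)" by (cases x)
    have "F j x = 0 \<or> F j x = 2 ^ (80 * s)"
      using prod_split_sign[of "b * d" "S j"] unfolding x F_def prod.case S1[OF that] .
    then show "0 \<le> F j x" "F j x \<le> 2 ^ (80 * s)" by auto
  qed
  have w0: "0 \<le> w x" for x by (cases x) (simp add: w_def)
  have near: "real (card (A j b d)) \<le> 16 * U * (w (b,d) * F j (b,d))"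
    if j: "j < L" and bd: "1 \<le> b" "1 \<le> d" "b \<le> P ^ 4" "d \<le> P ^ 4" for j b d
  proof -
    have "real (card (A j b d)) \<le> 8 * (real Y / real (\<Prod>Q)) * ((real b * real d) powr (-5/4) * (\<Prod>p\<in>S j. 1 + split_sign (b * d) p))"
      unfolding A_def P_def
    proof (rule card_reps_near[OF finQ _ _ prod2])
      show "S j \<subseteq> Q" using j by (auto simp: Q_def)
      show "prime p \<and> 16 \<le> p" if "p \<in> Q" for p
      proof -
        have "(2::nat) ^ 4 \<le> 2 ^ (16 * s)" using s by (intro power_increasing) auto
        then show ?thesis using pQ[OF that] by simp
      qed
      show "\<not> p dvd n0 + j" if "p \<in> Q - S j" for p
        using dvj[of p j] that j ix(2)[of p] by auto
      show "p dvd n0 + j" if "p \<in> S j" for p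
        using dvj[of p j] that j ix_eq[of p j] by (auto simp: Q_def)
      show "\<Prod>Q ^ 14 \<le> Y" by (simp add: Y_def P_def)
    qed (use bd in \<open>simp_all add: P_def\<close>)
    also have "real Y / real (\<Prod>Q) = 2 * U" using P0 by (simp add: YU P_def[symmetric] del: of_nat_prod)
    finally show ?thesis by (simp add: w_def F_def)
  qed
  have far: "real (card (A j b d)) \<le> 8 * U * w (b,d)"
    if bd: "1 \<le> b" "1 \<le> d" "b ^ 3 \<le> Y" "d ^ 3 \<le> Y" "P ^ 4 < max b d" for j b d
  proof -
    have "finite {(a,c). a\<^sup>2 * b ^ 3 + c\<^sup>2 * d ^ 3 \<le> Y}" using bd by (intro finite_reps)
    then have "card (A j b d) \<le> card {(a,c). a\<^sup>2 * b ^ 3 + c\<^sup>2 * d ^ 3 \<le> Y}"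
      by (rule card_mono) (auto simp: A_def)
    then have "real (card (A j b d)) \<le> real (card {(a,c). a\<^sup>2 * b ^ 3 + c\<^sup>2 * d ^ 3 \<le> Y})"
      by (simp only: of_nat_le_iff)
    also have "\<dots> \<le> 4 * Y * (real b * real d) powr (-3/2)" using bd by (intro card_reps_far)
    also have "(real b * real d) powr (-3/2) = (real b * real d) powr (-5/4) * (real b * real d) powr (-1/4)"
      by (simp flip: powr_add)
    \<comment> \<open>Without congruences the count has order Y instead of Y/P. As bd \<ge> P^4, the
      spare exponent 3/2 - 5/4 supplies the missing factor.\<close>
    also have "(real b * real d) powr (-1/4) \<le> 1 / P"
    proof -
      have "max b d * 1 \<le> b * d" using bd by (cases "b \<le> d") (auto simp: max_def)
      then have "P ^ 4 \<le> b * d" using bd(5) by linarith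
      then have "real (P ^ 4) \<le> real (b * d)" by (simp only: of_nat_le_iff)
      then have "(real b * real d) powr (-1/4) \<le> (real P ^ 4) powr (-1/4)"
        using P0 by (intro powr_mono2') auto
      also have "real P ^ 4 = real P powr 4" using P0 by simp
      also have "(real P powr 4) powr (-1/4) = real P powr (-1)" by (simp only: powr_powr) simp
      also have "\<dots> = 1 / P" using P0 by (simp add: powr_minus_divide)
      finally show ?thesis .
    qed
    finally have "real (card (A j b d)) \<le> 4 * Y * ((real b * real d) powr (-5/4) * (1 / P))"
      by (simp add: mult_left_mono)
    also have "\<dots> = 8 * U * w (b,d)" using P0 by (simp add: YU w_def)
    finally show ?thesis .
  qed
  define D where "D = {(b,d). b \<in> {1..Y} \<and> d \<in> {1..Y} \<and> b ^ 3 \<le> Y \<and> d ^ 3 \<le> Y \<and> B < max b d}"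
  have finD: "finite D" by (rule finite_subset[of _ "{1..Y} \<times> {1..Y}"]) (auto simp: D_def)
  define Bad2 where "Bad2 = (\<lambda>j. {u. u < U \<and> u \<notin> Bad1 \<and> (\<exists>a b c d. 1 \<le> b \<and> 1 \<le> d \<and>
    (a = 0 \<longrightarrow> b = 1) \<and> (c = 0 \<longrightarrow> d = 1) \<and> B < max b d \<and> n0 + P * u + j = a\<^sup>2 * b ^ 3 + c\<^sup>2 * d ^ 3)})"
  have card2: "real (card (Bad2 j)) \<le> 1616 * U / 2 ^ (5 * s)" if j: "j < L" for j
  proof -
    \<comment> \<open>A representation determines u, so representations may be counted instead of
      values of u.\<close>
    define h where "h = (\<lambda>(b,d) (a,c). (a\<^sup>2 * b ^ 3 + c\<^sup>2 * d ^ 3 - (n0 + j)) div P)"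
    define g where "g = (\<lambda>(b,d). A j b d)"
    have fing: "finite (g x)" if "x \<in> D" for x
    proof -
      have "x \<in> D" by (rule that)
      then obtain b d where x: "x = (b,d)" "1 \<le> b" "1 \<le> d" by (cases x) (auto simp: D_def)
      show ?thesis unfolding g_def x prod.case
        by (rule finite_subset[OF _ finite_reps[OF x(2,3), of Y]]) (auto simp: A_def)
    qed
    have "Bad2 j \<subseteq> (\<Union>x\<in>D. h x ` g x)"
    proof
      fix u assume "u \<in> Bad2 j"
      then have "u < U \<and> u \<notin> Bad1 \<and> (\<exists>a b c d. 1 \<le> b \<and> 1 \<le> d \<and> (a = 0 \<longrightarrow> b = 1) \<and>
        (c = 0 \<longrightarrow> d = 1) \<and> B < max b d \<and> n0 + P * u + j = a\<^sup>2 * b ^ 3 + c\<^sup>2 * d ^ 3)"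
        unfolding Bad2_def mem_Collect_eq .
      then obtain a b c d where u: "u < U" "u \<notin> Bad1" and bd: "1 \<le> b" "1 \<le> d" "a = 0 \<longrightarrow> b = 1" "c = 0 \<longrightarrow> d = 1"
        "B < max b d" and eq: "n0 + P * u + j = a\<^sup>2 * b ^ 3 + c\<^sup>2 * d ^ 3"
        by (elim conjE exE) (rule that; assumption)
      have le: "a\<^sup>2 * b ^ 3 + c\<^sup>2 * d ^ 3 \<le> Y" using NY[of u j] u j eq by simp
      have Y1: "1 \<le> Y" using P0 by (simp add: Y_def)
      \<comment> \<open>For x = 0 the product says nothing about y; here the normalisation of
        \<open>squareful_rep\<close> takes over.\<close>
      have cube: "y ^ 3 \<le> Y" if "x\<^sup>2 * y ^ 3 \<le> Y" "x = 0 \<longrightarrow> y = 1" for x y :: nat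
      proof (cases "x = 0")
        case False
        then have "1 * y ^ 3 \<le> x\<^sup>2 * y ^ 3" by (intro mult_right_mono) auto
        then show ?thesis using that(1) by linarith
      qed (use that(2) Y1 in simp)
      have b3: "b ^ 3 \<le> Y" "d ^ 3 \<le> Y" using cube[of a b] cube[of c d] bd le by linarith+
      have "b \<le> b ^ 3" "d \<le> d ^ 3" using bd by (simp_all add: self_le_power)
      then have D: "(b,d) \<in> D" using bd b3 by (simp add: D_def)
      have "(a,c) \<in> g (b,d)" unfolding g_def A_def prod.case mem_Collect_eq
      proof (intro conjI le ballI)
        have "[n0 + j + P * u = n0 + j] (mod P)" by (simp add: cong_def)
        then show "[a\<^sup>2 * b ^ 3 + c\<^sup>2 * d ^ 3 = n0 + j] (mod P)" unfolding eq[symmetric] by (simp add: add_ac)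
        show "\<not> p\<^sup>2 dvd a\<^sup>2 * b ^ 3 + c\<^sup>2 * d ^ 3" if "p \<in> S j" for p
          using u j that unfolding eq[symmetric] Bad1_def by blast
      qed
      moreover have "h (b,d) (a,c) = u"
      proof -
        have "a\<^sup>2 * b ^ 3 + c\<^sup>2 * d ^ 3 - (n0 + j) = P * u" using eq by linarith
        then show ?thesis using P0 by (simp add: h_def)
      qed
      ultimately show "u \<in> (\<Union>x\<in>D. h x ` g x)" using D by blast
    qed
    then have "card (Bad2 j) \<le> card (\<Union>x\<in>D. h x ` g x)" using finD fing by (intro card_mono) auto
    also have "\<dots> \<le> (\<Sum>x\<in>D. card (h x ` g x))" using finD by (rule card_UN_le)
    also have "\<dots> \<le> (\<Sum>x\<in>D. card (g x))" using fing by (intro sum_mono card_image_le)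
    finally have "real (card (Bad2 j)) \<le> real (\<Sum>x\<in>D. card (g x))" by (simp only: of_nat_le_iff)
    then have le: "real (card (Bad2 j)) \<le> (\<Sum>x\<in>D. real (card (g x)))" by simp
    \<comment> \<open>Three ranges: up to \<open>T\<close> the greedy bound applies, from
      \<open>T\<close> to \<open>P^4\<close> only the worst factor \<open>2^(80*s)\<close>, and
      beyond \<open>P^4\<close> the count without congruences.\<close>
    define D1 where "D1 = {(b,d). (b,d) \<in> D \<and> max b d \<le> P ^ 4 \<and> max b d \<le> T}"
    define D2 where "D2 = {(b,d). (b,d) \<in> D \<and> max b d \<le> P ^ 4 \<and> T < max b d}"
    define D3 where "D3 = {(b,d). (b,d) \<in> D \<and> P ^ 4 < max b d}"
    have sub: "D1 \<subseteq> D" "D2 \<subseteq> D" "D3 \<subseteq> D" by (auto simp: D1_def D2_def D3_def)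
    have fin3: "finite D1" "finite D2" "finite D3" using sub finD finite_subset by blast+
    have Dsub: "D = D1 \<union> D2 \<union> D3" by (auto simp: D1_def D2_def D3_def)
    have "(\<Sum>x\<in>D. real (card (g x))) \<le> (\<Sum>x\<in>D1 \<union> D2. real (card (g x))) + (\<Sum>x\<in>D3. real (card (g x)))"
      unfolding Dsub using fin3 by (intro sum_Un_le) auto
    also have "(\<Sum>x\<in>D1 \<union> D2. real (card (g x))) \<le> (\<Sum>x\<in>D1. real (card (g x))) + (\<Sum>x\<in>D2. real (card (g x)))"
      using fin3 by (intro sum_Un_le) auto
    also have "(\<Sum>x\<in>D1. real (card (g x))) \<le> 16 * U * (41 / 2 ^ (5 * s))"
    proof -
      define X where "X = {(b,d). b \<in> {1..T} \<and> d \<in> {1..T} \<and> B < max b d}"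
      have "(\<Sum>x\<in>D1. real (card (g x))) \<le> (\<Sum>x\<in>D1. 16 * U * (w x * F j x))"
      proof (rule sum_mono)
        fix x assume "x \<in> D1"
        then obtain b d where x: "x = (b,d)" "1 \<le> b" "1 \<le> d" "b \<le> P ^ 4" "d \<le> P ^ 4"
          by (auto simp: D1_def D_def)
        show "real (card (g x)) \<le> 16 * U * (w x * F j x)"
          unfolding x(1) g_def prod.case by (rule near[OF j x(2-5)])
      qed
      also have "\<dots> = 16 * U * (\<Sum>x\<in>D1. w x * F j x)" by (simp add: sum_distrib_left)
      also have "\<dots> \<le> 16 * U * (\<Sum>x\<in>X. w x * F j x)"
      proof (intro mult_left_mono sum_mono2)
        show "finite X" by (rule finite_subset[of _ "{1..T} \<times> {1..T}"]) (auto simp: X_def)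
        show "D1 \<subseteq> X" by (auto simp: D1_def D_def X_def)
        show "0 \<le> w x * F j x" for x using w0 F0[OF j] by (intro mult_nonneg_nonneg)
      qed simp
      also have "(\<Sum>x\<in>X. w x * F j x) \<le> 41 / 2 ^ (5 * s)"
        using S3[OF j] by (simp add: X_def w_def F_def case_prod_beta')
      finally show ?thesis by (simp add: mult_left_mono)
    qed
    also have "(\<Sum>x\<in>D2. real (card (g x))) \<le> 16 * U * (40 / 2 ^ (5 * s))"
    proof -
      define X where "X = {(b,d). b \<in> {1..Y} \<and> d \<in> {1..Y} \<and> T < max b d}"
      have "(\<Sum>x\<in>D2. real (card (g x))) \<le> (\<Sum>x\<in>D2. 16 * U * (2 ^ (80 * s) * w x))"
      proof (rule sum_mono)
        fix x assume "x \<in> D2"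
        then obtain b d where x: "x = (b,d)" "1 \<le> b" "1 \<le> d" "b \<le> P ^ 4" "d \<le> P ^ 4"
          by (auto simp: D2_def D_def)
        have "real (card (g x)) \<le> 16 * U * (w x * F j x)"
          unfolding x(1) g_def prod.case by (rule near[OF j x(2-5)])
        also have "\<dots> \<le> 16 * U * (w x * 2 ^ (80 * s))"
          using F0[OF j] w0 by (intro mult_left_mono) auto
        finally show "real (card (g x)) \<le> 16 * U * (2 ^ (80 * s) * w x)" by (simp add: mult_ac)
      qed
      also have "\<dots> = 16 * U * (2 ^ (80 * s) * (\<Sum>x\<in>D2. w x))" by (simp add: sum_distrib_left)
      also have "\<dots> \<le> 16 * U * (2 ^ (80 * s) * (\<Sum>x\<in>X. w x))"
      proof (intro mult_left_mono sum_mono2)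
        show "finite X" by (rule finite_subset[of _ "{1..Y} \<times> {1..Y}"]) (auto simp: X_def)
        show "D2 \<subseteq> X" by (auto simp: D2_def D_def X_def)
      qed (use w0 in auto)
      also have "\<dots> \<le> 16 * U * (2 ^ (80 * s) * (40 * real T powr (-1/4)))"
        using pair_tail[of T Y] unfolding X_def w_def by (intro mult_left_mono) (auto simp: T_def)
      also have "real T powr (-1/4) = 1 / 2 ^ (85 * s)"
      proof -
        have "real T = 2 powr (340 * real s)" by (simp add: T_def powr_realpow[symmetric])
        then have "real T powr (-1/4) = 2 powr (- real (85 * s))" by (simp add: powr_powr)
        then show ?thesis by (simp only: powr_minus powr_realpow zero_less_numeral inverse_eq_divide)
      qed
      also have "2 ^ (80 * s) * (40 * (1 / 2 ^ (85 * s))) = (40 / 2 ^ (5 * s) :: real)"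
        by (simp add: field_simps flip: power_add)
      finally show ?thesis .
    qed
    also have "(\<Sum>x\<in>D3. real (card (g x))) \<le> 8 * U * (40 / 2 ^ (5 * s))"
    proof -
      define X where "X = {(b,d). b \<in> {1..Y} \<and> d \<in> {1..Y} \<and> P ^ 4 < max b d}"
      have "(\<Sum>x\<in>D3. real (card (g x))) \<le> (\<Sum>x\<in>D3. 8 * U * w x)"
      proof (rule sum_mono)
        fix x assume "x \<in> D3"
        then obtain b d where x: "x = (b,d)" "1 \<le> b" "1 \<le> d" "b ^ 3 \<le> Y" "d ^ 3 \<le> Y" "P ^ 4 < max b d"
          by (auto simp: D3_def D_def)
        show "real (card (g x)) \<le> 8 * U * w x"
          unfolding x(1) g_def prod.case by (rule far[OF x(2-6)])
      qed
      also have "\<dots> = 8 * U * (\<Sum>x\<in>D3. w x)" by (simp add: sum_distrib_left)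
      also have "\<dots> \<le> 8 * U * (\<Sum>x\<in>X. w x)"
      proof (intro mult_left_mono sum_mono2)
        show "finite X" by (rule finite_subset[of _ "{1..Y} \<times> {1..Y}"]) (auto simp: X_def)
        show "D3 \<subseteq> X" by (auto simp: D3_def D_def X_def)
      qed (use w0 in auto)
      also have "\<dots> \<le> 8 * U * (40 * real (P ^ 4) powr (-1/4))"
        using pair_tail[of "P ^ 4" Y] P0 unfolding X_def w_def by (intro mult_left_mono) auto
      also have "real (P ^ 4) powr (-1/4) = 1 / P"
      proof -
        have "real (P ^ 4) = real P powr 4" using P0 by simp
        then have "real (P ^ 4) powr (-1/4) = real P powr (-1)" by (simp only: powr_powr) simp
        then show ?thesis using P0 by (simp add: powr_minus_divide)
      qed
      also have "8 * U * (40 * (1 / real P)) \<le> 8 * U * (40 * (1 / 2 ^ (5 * s)))"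
      proof (intro mult_left_mono divide_left_mono)
        have "(2::nat) ^ (5 * s) \<le> 2 ^ (16 * s)" by (intro power_increasing) auto
        then have "2 ^ (5 * s) \<le> P" using Pbig by linarith
        then have "real (2 ^ (5 * s)) \<le> real P" by (simp only: of_nat_le_iff)
        then show "2 ^ (5 * s) \<le> real P" by simp
      qed (use P0 in auto)
      finally show ?thesis by simp
    qed
    finally have "(\<Sum>x\<in>D. real (card (g x))) \<le> 16 * U * (41 / 2 ^ (5 * s)) + 16 * U * (40 / 2 ^ (5 * s)) + 8 * U * (40 / 2 ^ (5 * s))"
      by simp
    also have "\<dots> = 1616 * U / 2 ^ (5 * s)" by (simp add: field_simps)
    finally show ?thesis using le by linarith
  qed
  define Bad where "Bad = Bad1 \<union> (\<Union>j<L. Bad2 j)"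
  have "\<exists>u<U. u \<notin> Bad"
  proof (rule ccontr)
    assume "\<not> ?thesis"
    then have "{..<U} \<subseteq> Bad" by auto
    moreover have fin: "finite Bad1" "finite (Bad2 j)" for j by (auto simp: Bad1_def Bad2_def)
    ultimately have "card {..<U} \<le> card Bad" by (intro card_mono) (auto simp: Bad_def)
    also have "card Bad \<le> card Bad1 + card (\<Union>j<L. Bad2 j)" unfolding Bad_def by (rule card_Un_le)
    also have "card (\<Union>j<L. Bad2 j) \<le> (\<Sum>j<L. card (Bad2 j))" by (rule card_UN_le) simp
    finally have "real U \<le> real (card Bad1 + (\<Sum>j<L. card (Bad2 j)))" by (simp only: of_nat_le_iff card_lessThan)
    also have "\<dots> = real (card Bad1) + (\<Sum>j<L. real (card (Bad2 j)))" by simp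
    also have "\<dots> \<le> U / 4 + (\<Sum>j<L. 1616 * U / 2 ^ (5 * s))"
      using card1 card2 by (intro add_mono sum_mono) auto
    also have "(\<Sum>j<L. 1616 * U / 2 ^ (5 * s)) = 1616 * U / 2 ^ s"
      by (simp add: L_def field_simps flip: power_add)
    also have "\<dots> \<le> U / 4"
    proof -
      \<comment> \<open>6464 = 4 * 1616 < 2^13, where 1616 = 16 * 41 + 16 * 40 + 8 * 40 adds up the
        three ranges. This determines the lower bound on s.\<close>
      have "(2::real) ^ 13 \<le> 2 ^ s" using s by (intro power_increasing) auto
      then have "real U * 6464 \<le> real U * 2 ^ s" by (intro mult_left_mono) auto
      then show ?thesis by (simp add: field_simps)
    qed
    finally show False using U0 by simp
  qed
  then obtain u where u: "u < U" "u \<notin> Bad1" "\<And>j. j < L \<Longrightarrow> u \<notin> Bad2 j" by (auto simp: Bad_def)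
  have free: "n0 + P * u + i \<notin> squareful_sums" if i: "i < L" for i
  proof
    assume "n0 + P * u + i \<in> squareful_sums"
    then obtain m m' where m: "n0 + P * u + i = m + m'" "squareful m" "squareful m'" by (auto simp: squareful_sums_def)
    obtain a b where ab: "1 \<le> b" "a = 0 \<longrightarrow> b = 1" "m = a\<^sup>2 * b ^ 3" using squareful_rep[OF m(2)] .
    obtain c d where cd: "1 \<le> d" "c = 0 \<longrightarrow> d = 1" "m' = c\<^sup>2 * d ^ 3" using squareful_rep[OF m(3)] .
    have eq: "n0 + P * u + i = a\<^sup>2 * b ^ 3 + c\<^sup>2 * d ^ 3" using m ab cd by simp
    show False
    proof (cases "B < max b d")
      case True
      have "\<exists>a b c d. 1 \<le> b \<and> 1 \<le> d \<and> (a = 0 \<longrightarrow> b = 1) \<and>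
        (c = 0 \<longrightarrow> d = 1) \<and> B < max b d \<and> n0 + P * u + i = a\<^sup>2 * b ^ 3 + c\<^sup>2 * d ^ 3"
        by (rule exI[of _ a], rule exI[of _ b], rule exI[of _ c], rule exI[of _ d])
           (intro conjI ab(1) cd(1) ab(2) cd(2) True eq)
      then have "u \<in> Bad2 i" unfolding Bad2_def mem_Collect_eq using u(1,2) by (intro conjI)
      then show False using u(3)[OF i] by simp
    next
      case False
      then have "b \<in> {1..B}" "d \<in> {1..B}" using ab cd by auto
      then have "(\<Prod>p\<in>S i. 1 + split_sign (b * d) p) = 0" using S2 i by blast
      then obtain p where p: "p \<in> S i" "1 + split_sign (b * d) p = 0" using finS[OF i] by (auto simp: prod_zero_iff)
      have pQ': "p \<in> Q" using p(1) i by (auto simp: Q_def)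
      have nd: "\<not> p dvd b * d" "Legendre (- int (b * d)) (int p) \<noteq> 1" using p(2)
        by (auto simp: split_sign_def split: if_splits)
      have "p dvd n0 + i" using dvj[OF pQ' i] ix_eq[OF p(1) i] by simp
      then have "p dvd n0 + i + P * u" using pdP[OF pQ'] by (rule dvd_add[OF _ dvd_mult2])
      then have "p dvd a\<^sup>2 * b ^ 3 + c\<^sup>2 * d ^ 3" unfolding eq[symmetric] by (simp add: add_ac)
      moreover have "\<not> p dvd b" "\<not> p dvd d" using nd(1) by auto
      moreover have "2 < p" using pL[OF pQ'] L1 by linarith
      \<comment> \<open>Then p^2 would divide n + i, which was excluded by the choice of u outside
        \<open>Bad1\<close>.\<close>
      ultimately have "p dvd a \<and> p dvd c" using Legendre_not_one_imp_dvd[OF pQ(1)[OF pQ']] nd(2) by blast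
      then have "p\<^sup>2 dvd a\<^sup>2 * b ^ 3 + c\<^sup>2 * d ^ 3" by (intro dvd_add dvd_mult2 dvd_power_same) auto
      then have "u \<in> Bad1" unfolding eq[symmetric] Bad1_def using u(1) i p(1) by blast
      then show False using u(2) by simp
    qed
  qed
  have PM: "P \<le> 2 ^ (16000000 * s\<^sup>2 * 2 ^ (4 * s))"
  proof -
    have "P \<le> (\<Prod>p\<in>Q. 2 ^ (200000 * s))" unfolding P_def using pQ(3) by (intro prod_mono) auto
    also have "\<dots> = 2 ^ (200000 * s * card Q)" by (simp only: prod_constant power_mult)
    also have "\<dots> \<le> 2 ^ (200000 * s * (80 * s * 2 ^ (4 * s)))" using cardQ
      by (intro power_increasing mult_left_mono) auto
    also have "200000 * s * (80 * s * 2 ^ (4 * s)) = 16000000 * s\<^sup>2 * 2 ^ (4 * s)" by (simp add: power2_eq_square)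
    finally show ?thesis .
  qed
  show ?thesis
  proof (rule exI[of _ "n0 + P * u"], rule exI[of _ P], intro conjI allI impI)
    show "n0 + P * u + i \<notin> squareful_sums" if "i < 2 ^ (4 * s)" for i using free[of i] that by (simp add: L_def)
    show "n0 + P * u + 2 ^ (4 * s) \<le> 2 * P ^ 14" using NY[OF u(1), of L] by (simp add: L_def Y_def)
  qed (use n01 PM in auto)
qed

section \<open>From runs of integers to the bound for \<open>max_gap\<close>\<close>

text \<open>Guarantees ln (ln x) > 0 on the whole range. With 3 = 2 * (9/8) * (4/3) the lower bounds
  add up to 2/3 + 1/9 + 1/4 = 37/36.\<close>

lemma ln_3_gt_1: "1 < ln (3::real)"
proof -
  have *: "1 - 1 / x \<le> ln x" if "x > 0" for x :: real
    using ln_le_minus_one[of "1 / x"] that by (simp add: ln_div)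
  have "ln (3::real) = ln (2 * ((9 / 8) * (4 / 3)))" by simp
  also have "\<dots> = ln 2 + (ln (9 / 8) + ln (4 / 3))" by (simp only: ln_mult_pos)
  finally show ?thesis using *[of "9 / 8"] *[of "4 / 3"] ln2_ge_two_thirds by simp
qed

lemma max_gap_ge:
  assumes "I \<in> gap_intervals x"
  shows "measure lborel I \<le> max_gap x"
  unfolding max_gap_def using assms bdd_above_gap_lengths by (rule cSUP_upper)

lemma max_gap_ge_one:
  assumes "x \<ge> 3"
  shows "1 \<le> max_gap x"
proof -
  have "{1<..<2} \<in> gap_intervals x"
    using assms by (auto simp: gap_intervals_def is_interval_convex_1)
  from max_gap_ge[OF this] show ?thesis by simp
qed

lemma max_gap_ge_run:
  assumes "1 \<le> n" "\<forall>i<L. n + i \<notin> squareful_sums" "real (n + L) \<le> x" "L \<ge> 1"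
  shows "real L - 1 \<le> max_gap x"
proof -
  have "{real n..real n + (real L - 1)} \<in> gap_intervals x"
    unfolding gap_intervals_def
  proof (intro CollectI conjI)
    show "is_interval {real n..real n + (real L - 1)}" by (simp add: is_interval_convex_1)
    show "{real n..real n + (real L - 1)} \<subseteq> {1..x}" using assms by auto
    show "{real n..real n + (real L - 1)} \<inter> real ` squareful_sums = {}"
    proof (rule ccontr)
      assume "{real n..real n + (real L - 1)} \<inter> real ` squareful_sums \<noteq> {}"
      then obtain k where k: "k \<in> squareful_sums" "real n \<le> real k" "real k \<le> real n + (real L - 1)" by auto
      then have "n \<le> k" "k < n + L" using assms(4) by linarith+
      then have "k - n < L" "n + (k - n) = k" by auto
      then show False using assms(2) k(1) by metis
    qed
  qed
  from max_gap_ge[OF this] show ?thesis using assms(4) by simp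
qed

text \<open>The constant leaves room for the fourteenth power of the modulus, 14 * 16000000 =
  224000000, for the factor 2, and for ln 2 being replaced by 1.\<close>

lemma max_gap_ge_pow:
  fixes x :: real
  assumes s: "s \<ge> 13" and x: "x \<ge> 3" "300000000 * real s ^ 2 * 2 ^ (4 * s) \<le> ln x"
  shows "2 ^ (4 * s) / 2 \<le> max_gap x"
proof -
  obtain n M where n: "1 \<le> n" "\<forall>i<2 ^ (4 * s). n + i \<notin> squareful_sums" "n + 2 ^ (4 * s) \<le> 2 * M ^ 14"
    "M \<le> 2 ^ (16000000 * s\<^sup>2 * 2 ^ (4 * s))"
    using gap_construction[OF s] by blast
  define K where "K = s\<^sup>2 * 2 ^ (4 * s)"
  have K1: "K \<ge> 1" using s by (simp add: K_def)
  have "n + 2 ^ (4 * s) \<le> 2 * (2 ^ (16000000 * K)) ^ 14"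
    using n(3) power_mono[OF n(4), of 14] unfolding K_def mult.assoc by linarith
  also have "\<dots> = 2 ^ (1 + 224000000 * K)" by (simp add: power_add flip: power_mult)
  also have "\<dots> \<le> 2 ^ (300000000 * K)" using K1 by (intro power_increasing) auto
  finally have "real (n + 2 ^ (4 * s)) \<le> 2 ^ (300000000 * K)"
    by (metis of_nat_le_iff of_nat_numeral of_nat_power)
  also have "\<dots> \<le> x"
  proof -
    have "ln (2 ^ (300000000 * K)) = real (300000000 * K) * ln 2" by (simp add: ln_realpow)
    also have "\<dots> \<le> real (300000000 * K) * 1"
      using ln_le_minus_one[of 2] by (intro mult_left_mono) auto
    also have "\<dots> \<le> ln x" using x(2) by (simp add: K_def)
    finally show ?thesis using x(1) by (subst (asm) ln_le_cancel_iff) auto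
  qed
  finally have "real (2 ^ (4 * s)) - 1 \<le> max_gap x" using n by (intro max_gap_ge_run) auto
  moreover have "(2::real) \<le> 2 ^ (4 * s)"
    using power_increasing[of 1 "4 * s" "2::real"] s by simp
  ultimately show ?thesis by simp
qed

theorem theorem2:
  shows "\<exists>c::real. c > 0 \<and> (\<forall>x::real. x \<ge> 3 \<longrightarrow> max_gap x \<ge> c * (ln x / (ln (ln x))\<^sup>2))"
proof -
  define g where "g = (\<lambda>s::nat. 300000000 * real s ^ 2 * 2 ^ (4 * s))"
  \<comment> \<open>Serves the bounded range ln x < \<open>g 13\<close>, where the gap between 1 and
    2 suffices.\<close>
  define c1 where "c1 = (ln (ln 3))\<^sup>2 / g 13"
  define c where "c = min c1 (1 / 40000000000)"
  have l3: "0 < ln (ln (3::real))" using ln_3_gt_1 by simp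
  have c1: "c1 > 0" using l3 by (simp add: c1_def g_def)
  have mono: "g s \<le> g t" if "s \<le> t" for s t
    unfolding g_def using that by (intro mult_mono power_mono power_increasing) auto
  have "c * (ln x / (ln (ln x))\<^sup>2) \<le> max_gap x" if x: "x \<ge> 3" for x
  proof -
    have lx: "ln 3 \<le> ln x" using x by simp
    then have llx: "ln (ln 3) \<le> ln (ln x)" using ln_3_gt_1 by (subst ln_le_cancel_iff) linarith+
    have q0: "0 \<le> ln x / (ln (ln x))\<^sup>2" using lx ln_3_gt_1 by simp
    show ?thesis
    proof (cases "g 13 \<le> ln x")
      case False
      have "c * (ln x / (ln (ln x))\<^sup>2) \<le> c1 * (ln x / (ln (ln x))\<^sup>2)"
        using q0 by (intro mult_right_mono) (auto simp: c_def)
      also have "\<dots> \<le> c1 * (g 13 / (ln (ln 3))\<^sup>2)"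
        using False l3 llx c1 lx ln_3_gt_1 by (intro mult_left_mono frac_le power_mono) auto
      also have "\<dots> = 1"
      proof -
        have "g 13 > 0" by (simp add: g_def)
        then show ?thesis using l3 by (simp add: c1_def)
      qed
      also have "\<dots> \<le> max_gap x" by (rule max_gap_ge_one[OF x])
      finally show ?thesis .
    next
      case True
      define A where "A = {s. 13 \<le> s \<and> g s \<le> ln x}"
      have g_ge: "real s \<le> g s" for s
      proof (cases "s = 0")
        case False
        have "real s * 1 \<le> real s * (300000000 * real s * 2 ^ (4 * s))"
        proof (intro mult_left_mono)
          have "1 * 1 \<le> real s * 2 ^ (4 * s)" using False by (intro mult_mono) auto
          then show "1 \<le> 300000000 * real s * 2 ^ (4 * s)" by simp
        qed simp
        then show ?thesis by (simp add: g_def power2_eq_square mult_ac)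
      qed (simp add: g_def)
      have "A \<subseteq> {..nat \<lceil>ln x\<rceil>}"
      proof
        fix s assume "s \<in> A"
        then have "real s \<le> ln x" using g_ge[of s] by (simp add: A_def)
        then show "s \<in> {..nat \<lceil>ln x\<rceil>}" by simp linarith
      qed
      then have finA: "finite A" by (rule finite_subset) simp
      have "A \<noteq> {}" using True by (auto simp: A_def)
      define s where "s = Max A"
      have sA: "13 \<le> s" "g s \<le> ln x" using Max_in[OF finA \<open>A \<noteq> {}\<close>] by (auto simp: A_def s_def)
      have "Suc s \<notin> A" using Max_ge[OF finA, of "Suc s"] by (auto simp: s_def)
      then have up: "ln x < g (Suc s)" using sA(1) by (simp add: A_def)
      \<comment> \<open>A factor 4 from (s+1)^2 \<le> (2s)^2 and 16 from the power of 2, so the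
        largest admissible s loses only a constant.\<close>
      also have "g (Suc s) \<le> 64 * g s"
      proof -
        have "real (Suc s) ^ 2 \<le> (2 * real s) ^ 2" using sA(1) by (intro power_mono) auto
        then have "300000000 * real (Suc s) ^ 2 * 2 ^ (4 * Suc s) \<le> 300000000 * (2 * real s) ^ 2 * 2 ^ (4 * Suc s)"
          by (intro mult_left_mono mult_right_mono) auto
        also have "\<dots> = 64 * g s" by (simp add: g_def power_mult_distrib power_add)
        finally show ?thesis by (simp only: g_def)
      qed
      finally have up: "ln x \<le> 64 * g s" by simp
      have s_le: "real s \<le> ln (ln x)"
      proof -
        have "real s = real s * 4 * (1 / 4)" by simp
        also have "\<dots> \<le> real s * 4 * ln 2"
          using ln2_ge_two_thirds by (intro mult_left_mono) auto
        also have "\<dots> = ln (2 ^ (4 * s))" by (simp add: ln_realpow)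
        also have "\<dots> \<le> ln (ln x)"
        proof -
          have "1 * 2 ^ (4 * s) \<le> (300000000 * real s ^ 2) * 2 ^ (4 * s)"
          proof (rule mult_right_mono)
            have "1 ^ 2 \<le> real s ^ 2" using sA(1) by (intro power_mono) auto
            then show "1 \<le> 300000000 * real s ^ 2" by simp
          qed simp
          then have "2 ^ (4 * s) \<le> g s" by (simp only: g_def mult_1)
          then have "2 ^ (4 * s) \<le> ln x" using sA(2) by linarith
          then show ?thesis using lx ln_3_gt_1 by (subst ln_le_cancel_iff) auto
        qed
        finally show ?thesis .
      qed
      have s0: "0 < real s" using sA(1) by simp
      have "c * (ln x / (ln (ln x))\<^sup>2) \<le> 1 / 40000000000 * (ln x / (ln (ln x))\<^sup>2)"
        using q0 by (intro mult_right_mono) (auto simp: c_def)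
      also have "\<dots> \<le> 1 / 40000000000 * (64 * g s / real s ^ 2)"
        using up s_le s0 lx ln_3_gt_1 by (intro mult_left_mono frac_le power_mono) auto
      \<comment> \<open>The constant is 0.48; the denominator in \<open>c\<close> was chosen to
        bring it below 1/2.\<close>
      also have "\<dots> = 2 ^ (4 * s) * (64 * 300000000 / 40000000000)" using s0 by (simp add: g_def)
      also have "\<dots> \<le> 2 ^ (4 * s) / 2" by simp
      also have "\<dots> \<le> max_gap x" using sA x by (intro max_gap_ge_pow) (auto simp: g_def)
      finally show ?thesis .
    qed
  qed
  moreover have "c > 0" using c1 by (simp add: c_def)
  ultimately show ?thesis by blast
qed

end
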